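(* For a generic signal $x\in\mathbb{C}^N$ and a generic window $w\in\mathbb{C}^W$, the pair $(x,w)$ is uniquely determined, modulo the trivial ambiguities described below, by the phaseless blind STFT measurements $$\{|\hat y_{x,w}[0,m]|,|\hat y_{x,w}[1,m]|,\ldots,|\hat y_{x,w}[Q(m),m]|\}_{m=0,\ldots,M-1},\qquad Q(m)=\min(2mL+1,\,10L-3),$$ which are fewer than $10(N+W)$ measurements. That is, for generic $(x,w)$, if $(x',w')\in\mathbb{C}^N\times\mathbb{C}^W$ satisfies $|\hat y_{x',w'}[k,m]|=|\hat y_{x,w}[k,m]|$ for all $m=0,\ldots,M-1$ and $0\le k\le Q(m)$, then $(x',w')=(\eta_1,\eta_2,\lambda)\circ(x,w)$ for some $\eta_1,\eta_2\in S^1$, $\lambda\in(\mathbb{C}^\times)^L$ (when $N=W$, possibly also after replacing $(x,w)$ by $(\overline{w},\overline{x})$).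
   Context: Let $N\ge W>L\ge 1$ be integers (the frequencies $e^{-2\pi i k/N}$ used are assumed distinct, i.e. $N>\max_m Q(m)$). Signals $x\in\mathbb{C}^N$ and windows $w\in\mathbb{C}^W$ are extended by zero outside $\{0,\ldots,N-1\}$, resp. $\{0,\ldots,W-1\}$. The blind STFT is $\hat y_{x,w}[k,m]=\sum_{n=0}^{N-1}x[n]w[mL-n]e^{-2\pi i kn/N}$, $m=0,\ldots,M-1$, $M=\lceil (N+W-1)/L\rceil$. $S^1=\{\eta\in\mathbb{C}:|\eta|=1\}$. The trivial ambiguities: for $\eta_1,\eta_2\in S^1$, $\lambda\in(\mathbb{C}^\times)^L$, $(\eta_1,\eta_2,\lambda)\circ(x,w)=(x',w')$ with $x'[n]=\eta_1\eta_2^{\,n}\lambda_{n\bmod L}x[n]$, $w'[n]=\eta_2^{\,n}\lambda^{-1}_{(L-n)\bmod L}w[n]$. "Generic" means: the set of exceptions lies in the zero set of a nonzero polynomial in the real and imaginary parts of the entries of $x,w$. *)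

theory Defs
  imports "HOL-Analysis.Analysis"
begin

text \<open>Signals and windows are functions nat => complex; only the entries with index
  below N (resp. W) are used (zero extension outside).\<close>

definition wext :: "nat \<Rightarrow> (nat \<Rightarrow> complex) \<Rightarrow> int \<Rightarrow> complex" where
  "wext W w j = (if 0 \<le> j \<and> j < int W then w (nat j) else 0)"

definition stft :: "nat \<Rightarrow> nat \<Rightarrow> nat \<Rightarrow> (nat \<Rightarrow> complex) \<Rightarrow> (nat \<Rightarrow> complex) \<Rightarrow> nat \<Rightarrow> nat \<Rightarrow> complex" where
  "stft N W L x w k m =
     (\<Sum>n<N. x n * wext W w (int m * int L - int n) * exp (- 2 * pi * \<i> * of_nat k * of_nat n / of_nat N))"

definition numM :: "nat \<Rightarrow> nat \<Rightarrow> nat \<Rightarrow> nat" where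
  "numM N W L = nat \<lceil>real (N + W - 1) / real L\<rceil>"

definition Qf :: "nat \<Rightarrow> nat \<Rightarrow> nat" where
  "Qf L m = min (2 * m * L + 1) (10 * L - 3)"

definition amb_x :: "nat \<Rightarrow> complex \<Rightarrow> complex \<Rightarrow> (nat \<Rightarrow> complex) \<Rightarrow> (nat \<Rightarrow> complex) \<Rightarrow> nat \<Rightarrow> complex" where
  "amb_x L \<eta>1 \<eta>2 lam x n = \<eta>1 * \<eta>2 ^ n * lam (n mod L) * x n"

definition amb_w :: "nat \<Rightarrow> complex \<Rightarrow> (nat \<Rightarrow> complex) \<Rightarrow> (nat \<Rightarrow> complex) \<Rightarrow> nat \<Rightarrow> complex" where
  "amb_w L \<eta>2 lam w n = \<eta>2 ^ n * inverse (lam (nat ((int L - int n) mod int L))) * w n"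

inductive poly_fun :: "nat \<Rightarrow> nat \<Rightarrow> ((nat \<Rightarrow> complex) \<Rightarrow> (nat \<Rightarrow> complex) \<Rightarrow> real) \<Rightarrow> bool"
  for N W where
  pf_const: "poly_fun N W (\<lambda>x w. c)"
| pf_re_x: "n < N \<Longrightarrow> poly_fun N W (\<lambda>x w. Re (x n))"
| pf_im_x: "n < N \<Longrightarrow> poly_fun N W (\<lambda>x w. Im (x n))"
| pf_re_w: "n < W \<Longrightarrow> poly_fun N W (\<lambda>x w. Re (w n))"
| pf_im_w: "n < W \<Longrightarrow> poly_fun N W (\<lambda>x w. Im (w n))"
| pf_add: "poly_fun N W p \<Longrightarrow> poly_fun N W q \<Longrightarrow> poly_fun N W (\<lambda>x w. p x w + q x w)"
| pf_mul: "poly_fun N W p \<Longrightarrow> poly_fun N W q \<Longrightarrow> poly_fun N W (\<lambda>x w. p x w * q x w)"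

text \<open>A property holds generically if its exceptions lie in the zero set of a nonzero
  polynomial (nonzero as a function, equivalently as a polynomial over the reals).\<close>
definition generic :: "nat \<Rightarrow> nat \<Rightarrow> ((nat \<Rightarrow> complex) \<Rightarrow> (nat \<Rightarrow> complex) \<Rightarrow> bool) \<Rightarrow> bool" where
  "generic N W P \<longleftrightarrow> (\<exists>p. poly_fun N W p \<and> (\<exists>x w. p x w \<noteq> 0) \<and>
      (\<forall>x w. p x w \<noteq> 0 \<longrightarrow> P x w))"

end

theory Submission
  imports Defs "HOL-Computational_Algebra.Fundamental_Theorem_Algebra"
begin

text \<open>
  The \<open>m\<close>-th column of the STFT is a polynomial \<open>Y\<^sub>m\<close> with coefficients \<open>x n * w (m L - n)\<close>,
  sampled in modulus at roots of unity. Every genericity claim rests on one dimension count: the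
  image under a polynomial map of a proper algebraic subset of a space of dimension at most \<open>q\<close>
  is not Zariski dense in a space of dimension \<open>q\<close>.

  When the samples determine \<open>\<bar>Y\<^sub>m\<bar>\<close> on the unit circle, \<open>Y\<^sub>m\<close> is known up to flipping roots:
  \<open>Y\<^sub>m = a b\<close> can only be confused with \<open>c z\<^sup>s a b'\<close>, where \<open>b'\<close> is the conjugate reversal of \<open>b\<close>.
  The identities \<open>Y\<^sub>2[L] Y\<^sub>0[0] = Y\<^sub>1[0] Y\<^sub>1[L]\<close> and \<open>Y\<^sub>3[2L] Y\<^sub>0[0] = Y\<^sub>2[2L] Y\<^sub>1[0]\<close> generically
  exclude all flips but the simultaneous reversal of everything, which is the exchange of signal
  and window. After fixing the trivial ambiguities, the entries up to \<open>(m - 1) L\<close> determine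
  those up to \<open>m L\<close>: for \<open>m \<le> 3\<close> or \<open>W \<le> 4 L\<close> because a flip would move a known coefficient,
  and otherwise because \<open>Y\<^sub>m\<close> and a competitor differ by a polynomial \<open>D\<close> with at most
  \<open>2 L\<close> terms, whose values at \<open>8 L\<close> consecutive samples satisfy more real conditions than
  \<open>D\<close> has parameters.
\<close>

section \<open>Real polynomial functions and dimension counting\<close>

text \<open>Moduli involve conjugation, so all genericity is counted in real parameters. A flip
  swaps and conjugates the extreme coefficients of \<open>b\<close>, hence preserves the modulus of
  the product of the extreme coefficients of \<open>Y_1\<close>: this is why \<open>|Y_2[L]|\<close>
  is known before \<open>Y_1\<close> is. The second identity then ties a flip of \<open>Y_1\<close>
  to \<open>Y_3\<close>. A competitor may have vanishing entries, so its columns may start at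
  another power of \<open>z\<close>; this is the free shift \<open>s\<close>. The constants come
  from sampling: on the circle \<open>z^d |Y|^2\<close> is a polynomial of degree
  \<open>2 d\<close>, fixed by \<open>2 d + 1\<close> samples. This serves the columns
  \<open>m <= 3\<close>, and the later ones if \<open>W <= 4 L\<close>, where the degree is below
  \<open>W\<close> up to a shift. For longer windows the obstacle is that a sample at which
  \<open>D\<close> vanishes says nothing about \<open>Y_m\<close>. The count is therefore made for
  each pattern of vanishing samples: the samples are cut into four blocks, each long enough to
  determine \<open>D\<close>, and the block with the fewest nonzero samples, \<open>p\<close> of
  them, supplies the \<open>2 p\<close> parameters, while all blocks together supply at least
  \<open>4 p\<close> conditions.\<close>

inductive rpoly :: "'i set \<Rightarrow> (('i \<Rightarrow> real) \<Rightarrow> real) \<Rightarrow> bool" for A where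
  rpoly_const: "rpoly A (\<lambda>v. c)"
| rpoly_var: "i \<in> A \<Longrightarrow> rpoly A (\<lambda>v. v i)"
| rpoly_add: "rpoly A f \<Longrightarrow> rpoly A g \<Longrightarrow> rpoly A (\<lambda>v. f v + g v)"
| rpoly_mult: "rpoly A f \<Longrightarrow> rpoly A g \<Longrightarrow> rpoly A (\<lambda>v. f v * g v)"

lemma rpoly_uminus: "rpoly A f \<Longrightarrow> rpoly A (\<lambda>v. - f v)"
  using rpoly_mult[OF rpoly_const[of A "-1"]] by simp

lemma rpoly_diff: "rpoly A f \<Longrightarrow> rpoly A g \<Longrightarrow> rpoly A (\<lambda>v. f v - g v)"
  using rpoly_add[OF _ rpoly_uminus] by simp

lemma rpoly_power: "rpoly A f \<Longrightarrow> rpoly A (\<lambda>v. f v ^ n)"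
  by (induction n) (auto intro: rpoly_const rpoly_mult)

lemma rpoly_sum: "(\<And>k. k \<in> K \<Longrightarrow> rpoly A (f k)) \<Longrightarrow> rpoly A (\<lambda>v. \<Sum>k\<in>K. f k v)"
  by (induction K rule: infinite_finite_induct) (auto intro: rpoly_const rpoly_add)

lemma rpoly_prod: "(\<And>k. k \<in> K \<Longrightarrow> rpoly A (f k)) \<Longrightarrow> rpoly A (\<lambda>v. \<Prod>k\<in>K. f k v)"
  by (induction K rule: infinite_finite_induct) (auto intro: rpoly_const rpoly_mult)

lemma rpoly_compose:
  assumes "rpoly B f" "\<And>b. b \<in> B \<Longrightarrow> rpoly A (\<lambda>v. \<psi> v b)"
  shows "rpoly A (\<lambda>v. f (\<psi> v))"
  using assms by induction (auto intro: rpoly.intros)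

lemma rpoly_cong_vars:
  assumes "rpoly A f" "\<And>i. i \<in> A \<Longrightarrow> u i = v i"
  shows "f u = f v"
  using assms by induction auto

lemma rpoly_on_line:
  assumes "rpoly A f"
  shows "\<exists>p. \<forall>t. f (\<lambda>i. u i + t * (v i - u i)) = poly p t"
  using assms
proof induction
  case (rpoly_const c)
  show ?case by (rule exI[of _ "[:c:]"]) simp
next
  case (rpoly_var i)
  show ?case by (rule exI[of _ "[:u i, v i - u i:]"]) (simp add: algebra_simps)
next
  case (rpoly_add f g)
  then show ?case by (metis poly_add)
next
  case (rpoly_mult f g)
  then show ?case by (metis poly_mult)
qed

text \<open>On the line through \<open>u\<close> and \<open>v\<close> both functions become nonzero
  univariate polynomials, whose product is nonzero.\<close>

lemma rpoly_mult_nonzero: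
  assumes f: "rpoly A f" "f u \<noteq> 0" and g: "rpoly A g" "g v \<noteq> 0"
  shows "\<exists>w. f w * g w \<noteq> 0"
proof -
  obtain p where p: "\<And>t. f (\<lambda>i. u i + t * (v i - u i)) = poly p t"
    using rpoly_on_line[OF f(1)] by blast
  obtain q where q: "\<And>t. g (\<lambda>i. u i + t * (v i - u i)) = poly q t"
    using rpoly_on_line[OF g(1)] by blast
  have "poly p 0 \<noteq> 0" "poly q 1 \<noteq> 0"
    using p[of 0] q[of 1] f g by simp_all
  then have "p * q \<noteq> 0" by auto
  then obtain t where "poly (p * q) t \<noteq> 0"
    using poly_all_0_iff_0 by blast
  then show ?thesis using p q by (metis poly_mult)
qed

text \<open>The degree is bounded in each variable separately, so that the bound for a product
  of polynomials in disjoint sets of variables does not grow.\<close>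

definition vdeg_le :: "'i set \<Rightarrow> nat \<Rightarrow> (('i \<Rightarrow> real) \<Rightarrow> real) \<Rightarrow> bool" where
  "vdeg_le A B f \<longleftrightarrow>
     (\<exists>m. \<forall>v. f v = (\<Sum>\<beta>\<in>PiE A (\<lambda>_. {..B}). m \<beta> * (\<Prod>i\<in>A. v i ^ \<beta> i)))"

lemma vdeg_le_monom:
  assumes "finite A" "\<And>i. i \<in> A \<Longrightarrow> \<beta> i \<le> B"
  shows "vdeg_le A B (\<lambda>v. c * (\<Prod>i\<in>A. v i ^ \<beta> i))"
  unfolding vdeg_le_def
proof (intro exI allI)
  fix v :: "'a \<Rightarrow> real"
  have mem: "restrict \<beta> A \<in> PiE A (\<lambda>_. {..B})" using assms by auto
  have fin: "finite (PiE A (\<lambda>_. {..B}))" using assms by (intro finite_PiE) auto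
  have "(\<Sum>\<gamma>\<in>PiE A (\<lambda>_. {..B}). (if \<gamma> = restrict \<beta> A then c else 0) * (\<Prod>i\<in>A. v i ^ \<gamma> i))
      = (\<Sum>\<gamma>\<in>PiE A (\<lambda>_. {..B}). if \<gamma> = restrict \<beta> A then c * (\<Prod>i\<in>A. v i ^ \<gamma> i) else 0)"
    by (intro sum.cong) auto
  also have "\<dots> = c * (\<Prod>i\<in>A. v i ^ restrict \<beta> A i)"
    using mem fin by (simp add: sum.delta)
  also have "\<dots> = c * (\<Prod>i\<in>A. v i ^ \<beta> i)" by simp
  finally show "c * (\<Prod>i\<in>A. v i ^ \<beta> i) =
    (\<Sum>\<gamma>\<in>PiE A (\<lambda>_. {..B}). (if \<gamma> = restrict \<beta> A then c else 0) * (\<Prod>i\<in>A. v i ^ \<gamma> i))" ..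
qed

lemma vdeg_le_const: "finite A \<Longrightarrow> vdeg_le A B (\<lambda>v. c)"
  using vdeg_le_monom[of A "\<lambda>_. 0" B c] by simp

lemma vdeg_le_add:
  assumes "vdeg_le A B f" "vdeg_le A B g"
  shows "vdeg_le A B (\<lambda>v. f v + g v)"
proof -
  obtain m n where "\<And>v. f v = (\<Sum>\<beta>\<in>PiE A (\<lambda>_. {..B}). m \<beta> * (\<Prod>i\<in>A. v i ^ \<beta> i))"
    "\<And>v. g v = (\<Sum>\<beta>\<in>PiE A (\<lambda>_. {..B}). n \<beta> * (\<Prod>i\<in>A. v i ^ \<beta> i))"
    using assms unfolding vdeg_le_def by blast
  then show ?thesis unfolding vdeg_le_def
    by (intro exI[of _ "\<lambda>\<beta>. m \<beta> + n \<beta>"]) (simp add: sum.distrib distrib_right)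
qed

lemma vdeg_le_sum:
  assumes "finite A" "\<And>k. k \<in> K \<Longrightarrow> vdeg_le A B (f k)"
  shows "vdeg_le A B (\<lambda>v. \<Sum>k\<in>K. f k v)"
  using assms(2)
  by (induction K rule: infinite_finite_induct)
    (auto intro: vdeg_le_const[OF assms(1)] vdeg_le_add)

lemma vdeg_le_mult:
  assumes A: "finite A" and "vdeg_le A B f" "vdeg_le A C g"
  shows "vdeg_le A (B + C) (\<lambda>v. f v * g v)"
proof -
  obtain m n where m: "\<And>v. f v = (\<Sum>\<beta>\<in>PiE A (\<lambda>_. {..B}). m \<beta> * (\<Prod>i\<in>A. v i ^ \<beta> i))"
    and n: "\<And>v. g v = (\<Sum>\<beta>\<in>PiE A (\<lambda>_. {..C}). n \<beta> * (\<Prod>i\<in>A. v i ^ \<beta> i))"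
    using assms unfolding vdeg_le_def by blast
  have eq: "f v * g v = (\<Sum>\<beta>\<in>PiE A (\<lambda>_. {..B}). \<Sum>\<gamma>\<in>PiE A (\<lambda>_. {..C}).
      (m \<beta> * n \<gamma>) * (\<Prod>i\<in>A. v i ^ (\<beta> i + \<gamma> i)))" for v
    unfolding m n sum_product
    by (intro sum.cong refl) (simp add: power_add prod.distrib mult_ac)
  show ?thesis unfolding eq
    by (intro vdeg_le_sum vdeg_le_monom A) (auto simp: PiE_iff add_mono)
qed

lemma vdeg_le_mono:
  assumes "finite A" "vdeg_le A B f" "B \<le> C"
  shows "vdeg_le A C f"
  using vdeg_le_mult[OF assms(1,2) vdeg_le_const[OF assms(1), of "C - B" 1]] assms(3) by simp

lemma vdeg_le_prod:
  assumes "finite A" "finite K" "\<And>k. k \<in> K \<Longrightarrow> vdeg_le A B (f k)"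
  shows "vdeg_le A (card K * B) (\<lambda>v. \<Prod>k\<in>K. f k v)"
  using assms(2,3)
  by (induction K) (auto intro: vdeg_le_const[OF assms(1)] vdeg_le_mult[OF assms(1)])

lemma vdeg_le_var:
  assumes "finite A" "i \<in> A"
  shows "vdeg_le A 1 (\<lambda>v. v i)"
proof -
  have "(\<Prod>j\<in>A. v j ^ (if j = i then 1 else 0)) = v i" for v :: "'a \<Rightarrow> real"
    using assms by (simp add: if_distrib[of "\<lambda>e. _ ^ e"] prod.delta cong: if_cong)
  then show ?thesis
    using vdeg_le_monom[OF assms(1), of "\<lambda>j. if j = i then 1 else 0" 1 1] by simp
qed

lemma rpoly_vdeg_le:
  assumes "rpoly A f" "finite A"
  shows "\<exists>B. vdeg_le A B f"
  using assms(1)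
proof induction
  case (rpoly_add f g)
  then obtain B C where "vdeg_le A B f" "vdeg_le A C g" by blast
  then have "vdeg_le A (max B C) (\<lambda>v. f v + g v)"
    by (intro vdeg_le_add) (auto intro: vdeg_le_mono[OF assms(2)])
  then show ?case ..
next
  case (rpoly_mult f g)
  then show ?case using vdeg_le_mult[OF assms(2)] by blast
qed (auto intro: vdeg_le_const vdeg_le_var assms(2))

section \<open>Interpolation on integer grids\<close>

definition lagrange :: "nat \<Rightarrow> nat \<Rightarrow> real poly" where
  "lagrange D g = (\<Prod>k\<in>{..D} - {g}. smult (inverse (real g - real k)) [:- real k, 1:])"

lemma poly_lagrange:
  "poly (lagrange D g) x = (\<Prod>k\<in>{..D} - {g}. inverse (real g - real k) * (x - real k))"
  by (simp add: lagrange_def poly_prod algebra_simps)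

lemma poly_lagrange_node:
  "h \<le> D \<Longrightarrow> poly (lagrange D g) (real h) = (if h = g then 1 else 0)"
  by (auto simp: poly_lagrange intro!: prod.neutral bexI[of _ h])

lemma degree_lagrange: assumes "g \<le> D" shows "degree (lagrange D g) \<le> D"
proof -
  have "degree (lagrange D g) \<le> sum (degree \<circ> (\<lambda>k. smult (inverse (real g - real k)) [:- real k, 1:])) ({..D} - {g})"
    unfolding lagrange_def by (rule degree_prod_sum_le) simp
  also have "\<dots> \<le> (\<Sum>k\<in>{..D} - {g}. 1)" by (intro sum_mono) auto
  also have "\<dots> = D" using assms by simp
  finally show ?thesis .
qed

text \<open>Basis for the unknown polynomials of the dimension count. In contrast to monomials, the
  coefficients are the values at the grid points, so a function that vanishes identically visibly
  has zero coefficients.\<close>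

definition tensor_lagrange :: "'i set \<Rightarrow> nat \<Rightarrow> ('i \<Rightarrow> nat) \<Rightarrow> ('i \<Rightarrow> real) \<Rightarrow> real" where
  "tensor_lagrange A D g v = (\<Prod>i\<in>A. poly (lagrange D (g i)) (v i))"

lemma tensor_lagrange_node:
  assumes "finite A" "g \<in> PiE A (\<lambda>_. {..D})" "h \<in> PiE A (\<lambda>_. {..D})"
  shows "tensor_lagrange A D g (\<lambda>i. real (h i)) = (if h = g then 1 else 0)"
proof (cases "h = g")
  case True
  then show ?thesis using assms
    by (auto simp: tensor_lagrange_def poly_lagrange_node PiE_iff intro!: prod.neutral)
next
  case False
  then obtain i where "i \<in> A" "h i \<noteq> g i" using assms by (meson PiE_ext)
  then show ?thesis using assms False
    by (auto simp: tensor_lagrange_def poly_lagrange_node PiE_iff intro!: bexI[of _ i])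
qed

lemma sum_tensor_lagrange_node:
  assumes "finite A" "h \<in> PiE A (\<lambda>_. {..D})"
  shows "(\<Sum>g\<in>PiE A (\<lambda>_. {..D}). c g * tensor_lagrange A D g (\<lambda>i. real (h i))) = c h"
proof -
  have fin: "finite (PiE A (\<lambda>_. {..D}))" using assms by (intro finite_PiE) auto
  have "(\<Sum>g\<in>PiE A (\<lambda>_. {..D}). c g * tensor_lagrange A D g (\<lambda>i. real (h i)))
    = (\<Sum>g\<in>PiE A (\<lambda>_. {..D}). if h = g then c g else 0)"
    using assms by (intro sum.cong) (auto simp: tensor_lagrange_node)
  then show ?thesis using fin assms by (simp add: sum.delta')
qed

lemma rpoly_tensor_lagrange: "rpoly A (tensor_lagrange A D g)"
proof -
  have "rpoly A (\<lambda>v. \<Prod>i\<in>A. poly (lagrange D (g i)) (v i))"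
    unfolding poly_altdef
    by (intro rpoly_prod rpoly_sum rpoly_mult rpoly_const rpoly_power rpoly_var)
  then show ?thesis by (simp add: tensor_lagrange_def[abs_def])
qed

lemma vdeg_le_tensor_lagrange:
  assumes "finite A" "g \<in> PiE A (\<lambda>_. {..D})"
  shows "vdeg_le A D (tensor_lagrange A D g)"
  unfolding vdeg_le_def
proof (intro exI allI)
  fix v :: "'a \<Rightarrow> real"
  have expand: "poly (lagrange D (g i)) (v i) = (\<Sum>k\<in>{..D}. coeff (lagrange D (g i)) k * v i ^ k)"
    if "i \<in> A" for i
  proof -
    have "degree (lagrange D (g i)) \<le> D"
      using that assms by (intro degree_lagrange) (auto simp: PiE_iff)
    then show ?thesis unfolding poly_altdef
      by (intro sum.mono_neutral_left) (auto simp: coeff_eq_0)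
  qed
  have "tensor_lagrange A D g v = (\<Prod>i\<in>A. \<Sum>k\<in>{..D}. coeff (lagrange D (g i)) k * v i ^ k)"
    unfolding tensor_lagrange_def by (intro prod.cong refl expand)
  also have "\<dots> = (\<Sum>\<beta>\<in>PiE A (\<lambda>_. {..D}). \<Prod>i\<in>A. coeff (lagrange D (g i)) (\<beta> i) * v i ^ \<beta> i)"
    using assms(1) by (intro prod_sum_PiE) auto
  finally show "tensor_lagrange A D g v = (\<Sum>\<beta>\<in>PiE A (\<lambda>_. {..D}).
      (\<Prod>i\<in>A. coeff (lagrange D (g i)) (\<beta> i)) * (\<Prod>i\<in>A. v i ^ \<beta> i))"
    by (simp add: prod.distrib)
qed

lemma vdeg_le_poly_compose:
  assumes "finite A" "vdeg_le A B f" "g \<le> D"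
  shows "vdeg_le A (D * B) (\<lambda>v. poly (lagrange D g) (f v))"
proof -
  have "vdeg_le A (card ({..D} - {g}) * B)
    (\<lambda>v. \<Prod>k\<in>{..D} - {g}. inverse (real g - real k) * (f v + - real k))"
  proof (intro vdeg_le_prod assms(1))
    fix k
    have "vdeg_le A (0 + B) (\<lambda>v. inverse (real g - real k) * (f v + - real k))"
      by (intro vdeg_le_mult vdeg_le_add vdeg_le_const assms)
    then show "vdeg_le A B (\<lambda>v. inverse (real g - real k) * (f v + - real k))" by simp
  qed simp
  moreover have "card ({..D} - {g}) = D" using assms(3) by simp
  ultimately show ?thesis by (simp add: poly_lagrange)
qed

section \<open>Linear algebra and the dimension count\<close>

lemma homogeneous_system_nontrivial:
  fixes M :: "'e \<Rightarrow> 'u \<Rightarrow> real"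
  assumes "finite E" "finite U" "card E < card U"
  shows "\<exists>c. (\<exists>u\<in>U. c u \<noteq> 0) \<and> (\<forall>e\<in>E. (\<Sum>u\<in>U. M e u * c u) = 0)"
  using assms
proof (induction E arbitrary: U M)
  case empty
  then obtain u where "u \<in> U" by fastforce
  then show ?case by (intro exI[of _ "\<lambda>_. 1"]) auto
next
  case (insert e E)
  show ?case
  proof (cases "\<forall>u\<in>U. M e u = 0")
    case True
    then show ?thesis using insert.IH[of U M] insert.prems insert.hyps by auto
  next
    case False
    then obtain u0 where u0: "u0 \<in> U" "M e u0 \<noteq> 0" by blast
    define U' where "U' = U - {u0}"
    \<comment> \<open>Gaussian elimination of the pivot variable \<open>u0\<close>; its value is
      afterwards recovered from equation \<open>e\<close>.\<close>
    define M' where "M' e' u = M e' u - M e' u0 * M e u / M e u0" for e' u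
    have "card E < card U'" using insert u0 by (simp add: U'_def)
    then obtain c' where c': "\<exists>u\<in>U'. c' u \<noteq> 0" "\<And>e'. e' \<in> E \<Longrightarrow> (\<Sum>u\<in>U'. M' e' u * c' u) = 0"
      using insert.IH[of U' M'] insert.prems by (auto simp: U'_def)
    define c where "c = c'(u0 := - (\<Sum>u\<in>U'. M e u * c' u) / M e u0)"
    have split: "(\<Sum>u\<in>U. M e' u * c u) = M e' u0 * c u0 + (\<Sum>u\<in>U'. M e' u * c' u)" for e'
    proof -
      have "(\<Sum>u\<in>U. M e' u * c u) = M e' u0 * c u0 + (\<Sum>u\<in>U'. M e' u * c u)"
        unfolding U'_def using u0 insert.prems by (intro sum.remove) auto
      also have "(\<Sum>u\<in>U'. M e' u * c u) = (\<Sum>u\<in>U'. M e' u * c' u)"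
        by (intro sum.cong) (auto simp: U'_def c_def)
      finally show ?thesis .
    qed
    have "(\<Sum>u\<in>U. M e' u * c u) = 0" if "e' \<in> E" for e'
    proof -
      have "0 = (\<Sum>u\<in>U'. M' e' u * c' u)" using c' that by simp
      also have "\<dots> = (\<Sum>u\<in>U'. M e' u * c' u) - (\<Sum>u\<in>U'. M e' u0 / M e u0 * (M e u * c' u))"
        unfolding M'_def sum_subtractf[symmetric] by (intro sum.cong) (auto simp: algebra_simps)
      also have "\<dots> = (\<Sum>u\<in>U. M e' u * c u)"
        unfolding split sum_distrib_left[symmetric] by (simp add: c_def)
      finally show ?thesis ..
    qed
    moreover have "(\<Sum>u\<in>U. M e u * c u) = 0"
      unfolding split using u0 by (simp add: c_def)
    moreover have "\<exists>u\<in>U. c u \<noteq> 0" using c'(1) by (auto simp: U'_def c_def)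
    ultimately show ?thesis by auto
  qed
qed

text \<open>Discrete mean value estimate. It shows that multiples of \<open>F\<close> miss only a
  part of the polynomials of bounded degree whose dimension grows with exponent
  \<open>a - 1\<close>.\<close>

lemma power_diff_bound: "(n::nat) ^ a \<le> (n - f) ^ a + a * f * n ^ (a - 1)"
proof (induction a)
  case (Suc a)
  show ?case
  proof (cases a)
    case (Suc b)
    have "n ^ Suc a = n * n ^ a" by simp
    also have "\<dots> \<le> n * ((n - f) ^ a + a * f * n ^ (a - 1))" using Suc.IH by (rule mult_left_mono) simp
    also have "\<dots> = n * (n - f) ^ a + a * f * n ^ a" using Suc by (simp add: algebra_simps)
    also have "n * (n - f) ^ a \<le> (n - f + f) * (n - f) ^ a" by (intro mult_right_mono) auto
    also have "\<dots> = (n - f) ^ Suc a + f * (n - f) ^ a" by (simp add: algebra_simps)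
    also have "f * (n - f) ^ a \<le> f * n ^ a" by (intro mult_left_mono power_mono) auto
    finally show ?thesis by (simp add: algebra_simps)
  qed auto
qed simp

definition gen :: "'i set \<Rightarrow> (('i \<Rightarrow> real) \<Rightarrow> bool) \<Rightarrow> bool" where
  "gen A Q \<longleftrightarrow> (\<exists>R. rpoly A R \<and> (\<exists>v. R v \<noteq> 0) \<and> (\<forall>v. R v \<noteq> 0 \<longrightarrow> Q v))"

text \<open>Counting dimensions: the polynomials \<open>P\<close> of degree at most \<open>D\<close> in each coordinate of \<open>B\<close>
  form a space of dimension \<open>(D+1)^card B\<close>, whereas their compositions with \<open>\<phi>\<close>,
  reduced modulo \<open>F\<close>, range over a space whose dimension grows like \<open>D^(card A - 1)\<close>.
  Hence some \<open>P \<noteq> 0\<close> has \<open>P \<circ> \<phi>\<close> divisible by \<open>F\<close>.\<close>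

lemma gen_image_zero_set:
  fixes \<phi> :: "('i \<Rightarrow> real) \<Rightarrow> 'j \<Rightarrow> real"
  assumes A: "finite A" and B: "finite B" and le: "card A \<le> card B"
    and \<phi>: "\<And>b. b \<in> B \<Longrightarrow> rpoly A (\<lambda>v. \<phi> v b)"
    and F: "rpoly A F" and F0: "F v0 \<noteq> 0"
  shows "gen B (\<lambda>u. \<forall>v. (\<forall>b\<in>B. \<phi> v b = u b) \<longrightarrow> F v \<noteq> 0)"
proof -
  have "\<forall>b\<in>B. \<exists>d. vdeg_le A d (\<lambda>v. \<phi> v b)" using \<phi> rpoly_vdeg_le[OF _ A] by blast
  then obtain d0 where d0: "\<And>b. b \<in> B \<Longrightarrow> vdeg_le A (d0 b) (\<lambda>v. \<phi> v b)" by metis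
  define \<delta> where "\<delta> = (\<Sum>b\<in>B. d0 b)"
  have \<delta>: "vdeg_le A \<delta> (\<lambda>v. \<phi> v b)" if "b \<in> B" for b
    using vdeg_le_mono[OF A d0[OF that]] member_le_sum[OF that, of d0] B by (simp add: \<delta>_def)
  obtain f where f: "vdeg_le A f F" using rpoly_vdeg_le[OF F A] by blast
  define a b where "a = card A" and "b = card B"
  \<comment> \<open>\<open>\<kappa>\<close> is independent of \<open>D\<close> and satisfies
    \<open>T + f + 1 <= \<kappa> (D + 1)\<close>. With this \<open>D\<close> the gap
    \<open>a f (T + f + 1)^(a - 1)\<close> is at most \<open>D (D + 1)^(a - 1)\<close>, which is
    less than \<open>(D + 1)^b\<close>.\<close>
  define \<kappa> where "\<kappa> = b * \<delta> + f + 1"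
  define D where "D = a * f * \<kappa> ^ (a - 1)"
  define T where "T = b * (D * \<delta>)"
  \<comment> \<open>\<open>E\<close> indexes the equations (one for each monomial),
    \<open>U1\<close> the unknown coefficients of \<open>P\<close>, and \<open>U2\<close> those of
    the cofactor \<open>G\<close> in \<open>P \<circ> \<phi> + F G = 0\<close>.\<close>
  define E where "E = PiE A (\<lambda>_. {..T + f})"
  define U1 where "U1 = PiE B (\<lambda>_. {..D})"
  define U2 where "U2 = PiE A (\<lambda>_. {..T})"
  have fin: "finite E" "finite U1" "finite U2"
    unfolding E_def U1_def U2_def using A B by (auto intro: finite_PiE)
  have cards: "card E = (T + f + 1) ^ a" "card U1 = (D + 1) ^ b" "card U2 = (T + 1) ^ a"
    unfolding E_def U1_def U2_def a_def b_def using A B by (simp_all add: card_PiE)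
  have "card E \<le> (T + f + 1 - f) ^ a + a * f * (T + f + 1) ^ (a - 1)"
    unfolding cards by (rule power_diff_bound)
  also have "\<dots> < card U2 + card U1"
  proof -
    have "a * f * (T + f + 1) ^ (a - 1) < (D + 1) ^ b"
    proof (cases "a = 0")
      case False
      have "T + f + 1 \<le> \<kappa> * (D + 1)" by (simp add: T_def \<kappa>_def algebra_simps)
      then have "a * f * (T + f + 1) ^ (a - 1) \<le> a * f * (\<kappa> * (D + 1)) ^ (a - 1)"
        by (intro mult_left_mono power_mono) auto
      also have "\<dots> = (a * f * \<kappa> ^ (a - 1)) * (D + 1) ^ (a - 1)"
        unfolding power_mult_distrib by (rule mult.assoc[symmetric])
      also have "\<dots> = D * (D + 1) ^ (a - 1)" unfolding D_def ..
      also have "\<dots> < (D + 1) * (D + 1) ^ (a - 1)" by simp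
      also have "\<dots> = (D + 1) ^ a" using False by (cases a) auto
      also have "\<dots> \<le> (D + 1) ^ b" using le by (intro power_increasing) (auto simp: a_def b_def)
      finally show ?thesis .
    qed simp
    then show ?thesis by (simp add: cards)
  qed
  finally have lt: "card E < card (U1 <+> U2)" using fin by (simp add: card_Plus)
  define H where "H u v = (case u of Inl g \<Rightarrow> tensor_lagrange B D g (\<phi> v)
      | Inr h \<Rightarrow> F v * tensor_lagrange A T h v)" for u v
  have "vdeg_le A (T + f) (H u)" if "u \<in> U1 <+> U2" for u
  proof (cases u)
    case (Inl g)
    then have "g \<in> U1" using that by auto
    then have "vdeg_le A (card B * (D * \<delta>)) (\<lambda>v. \<Prod>j\<in>B. poly (lagrange D (g j)) (\<phi> v j))"
      by (intro vdeg_le_prod[OF A B] vdeg_le_poly_compose[OF A] \<delta>) (auto simp: U1_def PiE_iff)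
    then have "vdeg_le A T (H u)"
      using Inl by (simp add: H_def[abs_def] tensor_lagrange_def T_def b_def)
    then show ?thesis by (rule vdeg_le_mono[OF A]) simp
  next
    case (Inr h)
    then have "h \<in> U2" using that by auto
    then have "vdeg_le A (f + T) (\<lambda>v. F v * tensor_lagrange A T h v)"
      by (intro vdeg_le_mult A f vdeg_le_tensor_lagrange) (auto simp: U2_def)
    then show ?thesis using Inr by (simp add: H_def[abs_def] add.commute)
  qed
  then have "\<forall>u\<in>U1 <+> U2. \<exists>m. \<forall>v. H u v = (\<Sum>\<beta>\<in>E. m \<beta> * (\<Prod>i\<in>A. v i ^ \<beta> i))"
    by (simp add: vdeg_le_def E_def)
  then obtain m where m: "\<And>u v. u \<in> U1 <+> U2 \<Longrightarrow> H u v = (\<Sum>\<beta>\<in>E. m u \<beta> * (\<Prod>i\<in>A. v i ^ \<beta> i))"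
    by metis
  obtain c where c: "\<exists>u\<in>U1 <+> U2. c u \<noteq> 0"
    and c0: "\<And>\<beta>. \<beta> \<in> E \<Longrightarrow> (\<Sum>u\<in>U1 <+> U2. m u \<beta> * c u) = 0"
    using homogeneous_system_nontrivial[of E "U1 <+> U2" "\<lambda>\<beta> u. m u \<beta>"] fin lt by auto
  define P where "P u = (\<Sum>g\<in>U1. c (Inl g) * tensor_lagrange B D g u)" for u
  define G where "G v = (\<Sum>h\<in>U2. c (Inr h) * tensor_lagrange A T h v)" for v
  have PG: "P (\<phi> v) + F v * G v = 0" for v
  proof -
    have "P (\<phi> v) + F v * G v = (\<Sum>u\<in>U1 <+> U2. c u * H u v)"
      using fin by (simp add: sum.Plus P_def G_def H_def sum_distrib_left mult_ac)
    also have "\<dots> = (\<Sum>u\<in>U1 <+> U2. \<Sum>\<beta>\<in>E. (m u \<beta> * c u) * (\<Prod>i\<in>A. v i ^ \<beta> i))"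
      by (intro sum.cong) (auto simp: m sum_distrib_left mult_ac)
    also have "\<dots> = (\<Sum>\<beta>\<in>E. (\<Sum>u\<in>U1 <+> U2. m u \<beta> * c u) * (\<Prod>i\<in>A. v i ^ \<beta> i))"
      by (subst sum.swap) (simp add: sum_distrib_right)
    also have "\<dots> = 0" using c0 by simp
    finally show ?thesis .
  qed
  have polyP: "rpoly B P" unfolding P_def
    by (intro rpoly_sum rpoly_mult rpoly_const rpoly_tensor_lagrange)
  have polyG: "rpoly A G" unfolding G_def
    by (intro rpoly_sum rpoly_mult rpoly_const rpoly_tensor_lagrange)
  have P_node: "P (\<lambda>i. real (g i)) = c (Inl g)" if "g \<in> U1" for g
    using sum_tensor_lagrange_node[OF B, of g D "\<lambda>g. c (Inl g)"] that by (simp add: P_def U1_def)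
  have G_node: "G (\<lambda>i. real (h i)) = c (Inr h)" if "h \<in> U2" for h
    using sum_tensor_lagrange_node[OF A, of h T "\<lambda>g. c (Inr g)"] that by (simp add: G_def U2_def)
  \<comment> \<open>If \<open>P\<close> vanished, so would \<open>F G\<close> and hence
    \<open>G\<close>; then all coefficients, read off at grid nodes, would be 0.\<close>
  have "\<exists>u. P u \<noteq> 0"
  proof (rule ccontr)
    assume "\<not> (\<exists>u. P u \<noteq> 0)"
    then have P0: "P u = 0" for u by simp
    then have "G v = 0" for v
      using rpoly_mult_nonzero[OF F F0 polyG, of v] PG by force
    with P0 c P_node G_node show False by auto
  qed
  moreover have "F v \<noteq> 0" if "P u \<noteq> 0" "\<forall>b\<in>B. \<phi> v b = u b" for u v
    using that PG[of v] rpoly_cong_vars[OF polyP, of "\<phi> v" u] by auto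
  ultimately show ?thesis unfolding gen_def using polyP by blast
qed

section \<open>Calculus of generic properties, real and complex\<close>

lemma gen_mono: "gen A Q \<Longrightarrow> (\<And>v. Q v \<Longrightarrow> Q' v) \<Longrightarrow> gen A Q'"
  unfolding gen_def by blast

lemma gen_True: "gen A (\<lambda>v. True)"
  unfolding gen_def by (intro exI[of _ "\<lambda>v. 1"]) (auto intro: rpoly_const)

lemma gen_nonzero: "rpoly A R \<Longrightarrow> R v \<noteq> 0 \<Longrightarrow> gen A (\<lambda>v. R v \<noteq> 0)"
  unfolding gen_def by blast

lemma gen_conj:
  assumes "gen A P" "gen A Q"
  shows "gen A (\<lambda>v. P v \<and> Q v)"
proof -
  obtain R where R: "rpoly A R" "\<exists>v. R v \<noteq> 0" "\<And>v. R v \<noteq> 0 \<Longrightarrow> P v"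
    using assms(1) unfolding gen_def by blast
  obtain S where S: "rpoly A S" "\<exists>v. S v \<noteq> 0" "\<And>v. S v \<noteq> 0 \<Longrightarrow> Q v"
    using assms(2) unfolding gen_def by blast
  show ?thesis unfolding gen_def
    using rpoly_mult_nonzero[OF R(1) _ S(1)] R S
    by (intro exI[of _ "\<lambda>v. R v * S v"]) (auto intro: rpoly_mult)
qed

lemma gen_ball:
  assumes "finite K" "\<And>k. k \<in> K \<Longrightarrow> gen A (Q k)"
  shows "gen A (\<lambda>v. \<forall>k\<in>K. Q k v)"
  using assms by (induction K) (auto intro: gen_True gen_conj)

text \<open>The map \<open>\<psi>\<close> is dominant: its image contains the nonempty open set
  \<open>H \<noteq> 0\<close>, so a nonzero \<open>R\<close> cannot vanish on the whole
  image.\<close>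

lemma gen_pullback:
  assumes "gen B Q" and \<psi>: "\<And>b. b \<in> B \<Longrightarrow> rpoly A (\<lambda>v. \<psi> v b)"
    and H: "rpoly B H" "H u0 \<noteq> 0"
    and lift: "\<And>u. H u \<noteq> 0 \<Longrightarrow> \<exists>v. \<forall>b\<in>B. \<psi> v b = u b"
  shows "gen A (\<lambda>v. Q (\<psi> v))"
proof -
  obtain R where R: "rpoly B R" "\<exists>v. R v \<noteq> 0" "\<And>v. R v \<noteq> 0 \<Longrightarrow> Q v"
    using assms(1) unfolding gen_def by blast
  then obtain u where u: "R u * H u \<noteq> 0" using rpoly_mult_nonzero[OF R(1) _ H] by blast
  then obtain v where "\<forall>b\<in>B. \<psi> v b = u b" using lift by auto
  then have "R (\<psi> v) \<noteq> 0" using rpoly_cong_vars[OF R(1), of "\<psi> v" u] u by auto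
  then show ?thesis unfolding gen_def
    using R rpoly_compose[OF R(1) \<psi>] by (intro exI[of _ "\<lambda>v. R (\<psi> v)"]) auto
qed

text \<open>Complex coordinates are pairs of real ones, tagged \<open>False\<close> for the real part and
  \<open>True\<close> for the imaginary part.\<close>

definition cvec :: "('c \<times> bool \<Rightarrow> real) \<Rightarrow> 'c \<Rightarrow> complex" where
  "cvec v i = Complex (v (i, False)) (v (i, True))"

definition rvec :: "('c \<Rightarrow> complex) \<Rightarrow> 'c \<times> bool \<Rightarrow> real" where
  "rvec y = (\<lambda>(i, b). if b then Im (y i) else Re (y i))"

lemma cvec_rvec [simp]: "cvec (rvec y) = y"
  by (simp add: cvec_def rvec_def fun_eq_iff)

lemma rvec_pair: "rvec y (i, b) = (if b then Im (y i) else Re (y i))"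
  by (simp add: rvec_def)

lemma Re_cvec: "Re (cvec v i) = v (i, False)" and Im_cvec: "Im (cvec v i) = v (i, True)"
  by (simp_all add: cvec_def)

lemma rvec_cvec [simp]: "rvec (cvec v) = v"
  by (auto simp: cvec_def rvec_def fun_eq_iff)

definition cpoly :: "'i set \<Rightarrow> (('i \<Rightarrow> real) \<Rightarrow> complex) \<Rightarrow> bool" where
  "cpoly A f \<longleftrightarrow> rpoly A (\<lambda>v. Re (f v)) \<and> rpoly A (\<lambda>v. Im (f v))"

lemma cpoly_const: "cpoly A (\<lambda>v. c)"
  by (simp add: cpoly_def rpoly_const)

lemma cpoly_add: "cpoly A f \<Longrightarrow> cpoly A g \<Longrightarrow> cpoly A (\<lambda>v. f v + g v)"
  by (auto simp: cpoly_def intro: rpoly_add)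

lemma cpoly_mult: "cpoly A f \<Longrightarrow> cpoly A g \<Longrightarrow> cpoly A (\<lambda>v. f v * g v)"
  by (auto simp: cpoly_def intro!: rpoly_add rpoly_mult rpoly_diff)

lemma cpoly_cnj: "cpoly A f \<Longrightarrow> cpoly A (\<lambda>v. cnj (f v))"
  by (auto simp: cpoly_def intro: rpoly_uminus)

lemma cpoly_sum: "(\<And>k. k \<in> K \<Longrightarrow> cpoly A (f k)) \<Longrightarrow> cpoly A (\<lambda>v. \<Sum>k\<in>K. f k v)"
  by (induction K rule: infinite_finite_induct) (auto intro: cpoly_const cpoly_add)

lemma cpoly_Complex: "rpoly A f \<Longrightarrow> rpoly A g \<Longrightarrow> cpoly A (\<lambda>v. Complex (f v) (g v))"
  by (simp add: cpoly_def)

lemma cpoly_cvec: "i \<in> C \<Longrightarrow> cpoly (C \<times> UNIV) (\<lambda>v. cvec v i)"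
  by (auto simp: cpoly_def cvec_def intro: rpoly_var)

lemma rpoly_cmod2: "cpoly A f \<Longrightarrow> rpoly A (\<lambda>v. (cmod (f v))\<^sup>2)"
  by (auto simp: cpoly_def cmod_power2 intro!: rpoly_add rpoly_power)

lemma rpoly_rvec: "cpoly A (\<lambda>v. y v i) \<Longrightarrow> rpoly A (\<lambda>v. rvec (y v) (i, b))"
  by (cases b) (auto simp: cpoly_def rvec_def)

definition cgen :: "'c set \<Rightarrow> (('c \<Rightarrow> complex) \<Rightarrow> bool) \<Rightarrow> bool" where
  "cgen C Q \<longleftrightarrow> gen (C \<times> UNIV) (\<lambda>v. Q (cvec v))"

lemma cgen_mono: "cgen C Q \<Longrightarrow> (\<And>v. Q v \<Longrightarrow> Q' v) \<Longrightarrow> cgen C Q'"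
  unfolding cgen_def by (erule gen_mono)

lemma cgen_conj: "cgen C P \<Longrightarrow> cgen C Q \<Longrightarrow> cgen C (\<lambda>v. P v \<and> Q v)"
  unfolding cgen_def by (rule gen_conj)

lemma cgen_ball:
  "finite K \<Longrightarrow> (\<And>k. k \<in> K \<Longrightarrow> cgen C (Q k)) \<Longrightarrow> cgen C (\<lambda>v. \<forall>k\<in>K. Q k v)"
  unfolding cgen_def by (rule gen_ball)

lemma cgen_imp: "(P \<Longrightarrow> cgen C Q) \<Longrightarrow> cgen C (\<lambda>v. P \<longrightarrow> Q v)"
  unfolding cgen_def by (cases P) (auto intro: gen_True)

lemma cgen_image_zero_set:
  assumes C: "finite C" and E: "finite E" and le: "card C \<le> card E"
    and \<phi>: "\<And>b. b \<in> E \<Longrightarrow> cpoly (C \<times> UNIV) (\<lambda>v. \<phi> (cvec v) b)"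
    and F: "rpoly (C \<times> UNIV) (\<lambda>v. F (cvec v))" and F0: "F a0 \<noteq> 0"
  shows "cgen E (\<lambda>y. \<forall>a. (\<forall>b\<in>E. \<phi> a b = y b) \<longrightarrow> F a \<noteq> 0)"
proof -
  have "gen (E \<times> (UNIV :: bool set)) (\<lambda>u. \<forall>v. (\<forall>b\<in>E \<times> UNIV. rvec (\<phi> (cvec v)) b = u b) \<longrightarrow> F (cvec v) \<noteq> 0)"
    using C E le F0
    by (intro gen_image_zero_set[OF _ _ _ _ F, where ?v0.0 = "rvec a0"])
      (auto intro!: rpoly_rvec \<phi> simp: card_cartesian_product)
  then show ?thesis unfolding cgen_def
  proof (rule gen_mono, intro allI impI)
    fix u :: "'b \<times> bool \<Rightarrow> real" and a
    assume *: "\<forall>v. (\<forall>b\<in>E \<times> UNIV. rvec (\<phi> (cvec v)) b = u b) \<longrightarrow> F (cvec v) \<noteq> 0"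
      and "\<forall>b\<in>E. \<phi> a b = cvec u b"
    then have "\<forall>b\<in>E \<times> UNIV. rvec (\<phi> (cvec (rvec a))) b = u b"
      by (auto simp: rvec_pair Re_cvec Im_cvec)
    with * have "F (cvec (rvec a)) \<noteq> 0" by blast
    then show "F a \<noteq> 0" by simp
  qed
qed

lemma cgen_pullback:
  assumes "cgen E Q" and \<psi>: "\<And>b. b \<in> E \<Longrightarrow> cpoly (C \<times> UNIV) (\<lambda>v. \<psi> (cvec v) b)"
    and H: "rpoly (E \<times> UNIV) (\<lambda>u. H (cvec u))" "H u0 \<noteq> 0"
    and lift: "\<And>y. H y \<noteq> 0 \<Longrightarrow> \<exists>v. \<forall>b\<in>E. \<psi> v b = y b"
  shows "cgen C (\<lambda>v. Q (\<psi> v))"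
proof -
  have "gen (C \<times> UNIV) (\<lambda>v. Q (cvec (rvec (\<psi> (cvec v)))))"
  proof (rule gen_pullback[where \<psi> = "\<lambda>v. rvec (\<psi> (cvec v))"])
    show "gen (E \<times> UNIV) (\<lambda>v. Q (cvec v))" using assms(1) by (simp add: cgen_def)
    show "rpoly (C \<times> UNIV) (\<lambda>v. rvec (\<psi> (cvec v)) b)" if "b \<in> E \<times> UNIV" for b
      using that by (auto intro!: rpoly_rvec \<psi>)
    show "rpoly (E \<times> UNIV) (\<lambda>u. H (cvec u))" by (rule H)
    show "H (cvec (rvec u0)) \<noteq> 0" using H by simp
    fix u :: "'a \<times> bool \<Rightarrow> real" assume "H (cvec u) \<noteq> 0"
    then obtain y where "\<forall>b\<in>E. \<psi> y b = cvec u b" using lift by blast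
    then show "\<exists>v. \<forall>b\<in>E \<times> UNIV. rvec (\<psi> (cvec v)) b = u b"
      by (intro exI[of _ "rvec y"]) (auto simp: rvec_pair Re_cvec Im_cvec)
  qed
  then show ?thesis by (simp add: cgen_def)
qed

section \<open>Polynomials with equal modulus on the unit circle\<close>

text \<open>The conjugate reversal at the actual degree. On the unit circle it equals
  \<open>z ^ degree p\<close> times the conjugate of \<open>p\<close>, and it moves each nonzero
  root \<open>r\<close> to \<open>1 / cnj r\<close>.\<close>

definition crev :: "complex poly \<Rightarrow> complex poly" where
  "crev p = reflect_poly (map_poly cnj p)"

lemma degree_map_poly_cnj [simp]: "degree (map_poly cnj p) = degree p"
  by (rule degree_map_poly) simp

lemma map_poly_cnj_mult: "map_poly cnj (p * q) = map_poly cnj p * map_poly cnj q"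
  by (rule poly_ext) simp

lemma crev_mult: "crev (p * q) = crev p * crev q"
  by (simp add: crev_def map_poly_cnj_mult reflect_poly_mult)

lemma crev_smult: "crev (smult c p) = smult (cnj c) (crev p)"
  by (simp add: crev_def map_poly_smult reflect_poly_smult)

lemma coeff_crev: "coeff (crev p) i = (if i \<le> degree p then cnj (coeff p (degree p - i)) else 0)"
  by (simp add: crev_def coeff_reflect_poly coeff_map_poly)

lemma crev_eq_0_iff [simp]: "crev p = 0 \<longleftrightarrow> p = 0"
  by (simp add: crev_def map_poly_eq_0_iff)

lemma degree_crev: "coeff p 0 \<noteq> 0 \<Longrightarrow> degree (crev p) = degree p"
  by (simp add: crev_def coeff_map_poly)

lemma poly_crev:
  assumes "z \<noteq> 0"
  shows "poly (crev p) z = z ^ degree p * cnj (poly p (inverse (cnj z)))"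
  using assms by (simp add: crev_def poly_reflect_poly_nz)

lemma crev_const: "crev [:k:] = [:cnj k:]"
  by (simp add: crev_def map_poly_pCons)

lemma crev_linear: "crev [:- r, 1:] = [:1, - cnj r:]"
  by (simp add: crev_def map_poly_pCons reflect_poly_pCons' monom_Suc monom_0)

lemma poly_crev_circle:
  assumes "cmod z = 1"
  shows "poly p z * poly (crev p) z = z ^ degree p * of_real ((cmod (poly p z))\<^sup>2)"
proof -
  have "z \<noteq> 0" using assms by auto
  moreover have "inverse (cnj z) = z"
    using assms by (metis complex_cnj_cancel_iff complex_cnj_inverse complex_cnj_cnj complex_mod_cnj
        divide_conv_cnj inverse_eq_divide complex_cnj_one mult_1)
  ultimately show ?thesis by (simp add: poly_crev mult_ac flip: complex_norm_square)
qed

lemma poly_eq_on_circle: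
  assumes "\<And>z. cmod z = 1 \<Longrightarrow> poly p z = poly q z"
  shows "p = q"
proof (rule ccontr)
  assume "p \<noteq> q"
  then have "finite {z. poly (p - q) z = 0}" by (intro poly_roots_finite) auto
  moreover have "sphere 0 1 \<subseteq> {z. poly (p - q) z = 0}" using assms by auto
  ultimately have "finite (sphere (0::complex) 1)" by (rule finite_subset[rotated])
  moreover have "infinite (sphere (0::complex) 1)"
  proof -
    have "Arg (cis x) = x" if "x \<in> {0..1}" for x
      using that pi_gt3 by (intro Arg_cis) auto
    then have "inj_on cis {0..1}" by (metis inj_onI)
    then have "infinite (cis ` {0..1})"
      by (simp add: finite_image_iff infinite_Icc)
    moreover have "cis ` {0..1} \<subseteq> sphere 0 1" by auto
    ultimately show ?thesis using finite_subset by blast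
  qed
  ultimately show False by simp
qed

text \<open>Roots of \<open>Y'\<close> are peeled off one by one. A root \<open>r\<close> is either
  a root of \<open>Y\<close> as well, and goes into \<open>a\<close>, or its mirror image
  \<open>1 / cnj r\<close> is a root of \<open>Y\<close>, and goes into \<open>b\<close>.\<close>

lemma autocorrelation_factorization:
  assumes "Y * crev Y = Y' * crev Y'" "coeff Y 0 \<noteq> 0" "coeff Y' 0 \<noteq> 0"
  shows "\<exists>a b c. Y = a * b \<and> Y' = smult c (a * crev b) \<and> cmod c = 1"
  using assms
proof (induction "degree Y'" arbitrary: Y Y')
  case 0
  have "degree Y + degree Y = degree (Y * crev Y)"
    using 0 by (subst degree_mult_eq) (auto simp: degree_crev)
  also have "\<dots> = 0" using 0 by (subst 0(2), subst degree_mult_eq) (auto simp: degree_crev)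
  finally have "degree Y = 0" by simp
  then obtain k k' where k: "Y = [:k:]" "Y' = [:k':]" using 0(1) by (metis degree_eq_zeroE)
  have "k \<noteq> 0" "k' \<noteq> 0" using 0 k by auto
  have "k * cnj k = k' * cnj k'" using 0(2) by (simp add: k crev_const mult.commute)
  then have "(cmod k)\<^sup>2 = (cmod k')\<^sup>2" by (metis complex_norm_square of_real_eq_iff)
  then have "cmod k = cmod k'" by simp
  then show ?case using k \<open>k \<noteq> 0\<close>
    by (intro exI[of _ "[:k:]"] exI[of _ 1] exI[of _ "k' / k"]) (auto simp: crev_def norm_divide)
next
  case (Suc n)
  have "\<not> constant (poly Y')" using Suc(2) by (simp add: constant_degree)
  then obtain r where r: "poly Y' r = 0" using fundamental_theorem_of_algebra by blast
  then obtain Y1' where Y1': "Y' = [:- r, 1:] * Y1'" by (metis dvdE poly_eq_0_iff_dvd)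
  have r0: "r \<noteq> 0" using r Suc.prems by (auto simp: poly_0_coeff_0)
  have nz: "Y1' \<noteq> 0" "coeff Y1' 0 \<noteq> 0" using Suc.prems Y1' by (auto simp: coeff_mult)
  have deg: "degree Y1' = n"
    using Suc(2) nz by (simp only: Y1', subst (asm) degree_mult_eq) auto
  have "poly Y r * poly (crev Y) r = 0" using Suc.prems(1) r by (metis mult_zero_left poly_mult)
  then consider "poly Y r = 0" | "poly Y (inverse (cnj r)) = 0"
    using r0 by (auto simp: poly_crev)
  then show ?case
  proof cases
    case 1
    then obtain Y1 where Y1: "Y = [:- r, 1:] * Y1" by (metis dvdE poly_eq_0_iff_dvd)
    have "([:- r, 1:] * crev [:- r, 1:]) * (Y1 * crev Y1) = ([:- r, 1:] * crev [:- r, 1:]) * (Y1' * crev Y1')"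
      using Suc.prems(1) unfolding Y1 Y1' crev_mult by (simp only: mult_ac)
    moreover have "[:- r, 1:] * crev [:- r, 1:] \<noteq> 0"
      by (simp only: mult_eq_0_iff crev_eq_0_iff) simp
    ultimately have "Y1 * crev Y1 = Y1' * crev Y1'" using mult_left_cancel by blast
    moreover have "coeff Y1 0 \<noteq> 0" using Suc.prems Y1 by (auto simp: coeff_mult)
    ultimately obtain a b c where "Y1 = a * b" "Y1' = smult c (a * crev b)" "cmod c = 1"
      using Suc(1)[of Y1' Y1] deg nz by auto
    then show ?thesis
      by (intro exI[of _ "[:- r, 1:] * a"] exI[of _ b] exI[of _ c]) (simp only: Y1 Y1' mult_smult_right mult.assoc simp_thms)
  next
    case 2
    define s where "s = inverse (cnj r)"
    obtain Y1 where Y1: "Y = [:- s, 1:] * Y1" using 2 unfolding s_def by (metis dvdE poly_eq_0_iff_dvd)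
    have rev_s: "crev [:- s, 1:] = smult (- inverse r) [:- r, 1:]"
      using r0 by (simp add: crev_linear s_def)
    have rev_r: "crev [:- r, 1:] = smult (- cnj r) [:- s, 1:]"
      using r0 by (simp add: crev_linear s_def)
    \<comment> \<open>After cancelling the linear factors, the autocorrelation of \<open>Y1\<close>
      is \<open>|r|^2\<close> times that of \<open>Y1'\<close>. The factor is absorbed by applying
      the induction hypothesis to \<open>smult r Y1'\<close>.\<close>
    have "smult (- inverse r) ([:- s, 1:] * [:- r, 1:] * (Y1 * crev Y1))
        = smult (- cnj r) ([:- s, 1:] * [:- r, 1:] * (Y1' * crev Y1'))"
      using Suc.prems(1) unfolding Y1 Y1' crev_mult rev_s rev_r
      by (simp only: mult_smult_left mult_smult_right mult_ac)
    then have "smult (- r) (smult (- inverse r) ([:- s, 1:] * [:- r, 1:] * (Y1 * crev Y1)))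
        = smult (- r) (smult (- cnj r) ([:- s, 1:] * [:- r, 1:] * (Y1' * crev Y1')))"
      by simp
    then have "([:- s, 1:] * [:- r, 1:]) * (Y1 * crev Y1)
        = ([:- s, 1:] * [:- r, 1:]) * (smult r Y1' * crev (smult r Y1'))"
      using r0 unfolding smult_smult crev_smult
      by (simp only: mult_smult_left mult_smult_right smult_smult) (simp add: mult.commute)
    moreover have "[:- s, 1:] * [:- r, 1:] \<noteq> 0" by simp
    ultimately have "Y1 * crev Y1 = smult r Y1' * crev (smult r Y1')"
      using mult_left_cancel by blast
    moreover have "coeff Y1 0 \<noteq> 0" using Suc.prems Y1 by (auto simp: coeff_mult)
    ultimately obtain a b c where abc: "Y1 = a * b" "smult r Y1' = smult c (a * crev b)" "cmod c = 1"
      using Suc(1)[of "smult r Y1'" Y1] deg nz r0 by auto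
    have "Y1' = smult (inverse r) (smult r Y1')" using r0 by simp
    also have "\<dots> = smult (inverse r * c) (a * crev b)" unfolding abc(2) by simp
    finally have "Y' = smult (- c) (a * crev ([:- s, 1:] * b))"
      unfolding Y1' crev_mult rev_s
      by (simp only: mult_smult_left mult_smult_right smult_smult mult_ac) simp
    then show ?thesis using abc Y1
      by (intro exI[of _ a] exI[of _ "[:- s, 1:] * b"] exI[of _ "- c"]) (simp only: mult_ac norm_minus_cancel simp_thms)
  qed
qed

text \<open>Powers of \<open>z\<close> that compensate the degrees turn equality on the circle into
  a polynomial identity. Autocorrelations have nonzero constant term, so comparing lowest powers
  gives equal degrees.\<close>

lemma degree_eq_if_circle_modulus_eq:
  assumes "\<And>z. cmod z = 1 \<Longrightarrow> cmod (poly Y z) = cmod (poly Y' z)"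
    "coeff Y 0 \<noteq> 0" "coeff Y' 0 \<noteq> 0"
  shows "degree Y = degree Y' \<and> Y * crev Y = Y' * crev Y'"
proof -
  have eq: "monom 1 (degree Y') * (Y * crev Y) = monom 1 (degree Y) * (Y' * crev Y')"
  proof (rule poly_eq_on_circle)
    fix z :: complex assume z: "cmod z = 1"
    have "poly (monom 1 (degree Y') * (Y * crev Y)) z = z ^ degree Y' * (poly Y z * poly (crev Y) z)"
      by (simp add: poly_monom)
    also have "\<dots> = z ^ degree Y * (poly Y' z * poly (crev Y') z)"
      unfolding poly_crev_circle[OF z] assms(1)[OF z] by simp
    finally show "poly (monom 1 (degree Y') * (Y * crev Y)) z = poly (monom 1 (degree Y) * (Y' * crev Y')) z"
      by (simp add: poly_monom)
  qed
  have c0: "coeff (p * crev p) 0 \<noteq> 0" if "coeff p 0 \<noteq> 0" for p :: "complex poly"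
    using that by (auto simp: coeff_mult coeff_crev)
  have "degree Y = degree Y'"
    using arg_cong[OF eq, of "\<lambda>p. coeff p (degree Y)"] arg_cong[OF eq, of "\<lambda>p. coeff p (degree Y')"]
      c0 assms(2,3)
    by (auto simp: coeff_monom_mult split: if_splits)
  then show ?thesis using eq by simp
qed

text \<open>The normalisation \<open>coeff b 0 = 1\<close> removes the scalar that could be moved
  between \<open>a\<close> and \<open>b\<close>. The pair then has no more free coefficients than
  \<open>Y\<close>, as the dimension count demands; the resulting phase goes into
  \<open>c\<close>.\<close>

lemma circle_modulus_factorization:
  assumes "\<And>z. cmod z = 1 \<Longrightarrow> cmod (poly Y z) = cmod (poly Y' z)"
    "coeff Y 0 \<noteq> 0" "coeff Y' 0 \<noteq> 0"
  shows "\<exists>a b c. Y = a * b \<and> Y' = smult c (a * crev b) \<and> cmod c = 1 \<and> coeff b 0 = 1"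
proof -
  obtain a b c where abc: "Y = a * b" "Y' = smult c (a * crev b)" "cmod c = 1"
    using autocorrelation_factorization degree_eq_if_circle_modulus_eq[OF assms] assms(2,3) by blast
  define k where "k = coeff b 0"
  have k: "k \<noteq> 0" using assms(2) abc(1) by (auto simp: k_def coeff_mult)
  have "Y = smult k a * smult (inverse k) b" using abc(1) k by simp
  moreover have "Y' = smult (c * k / cnj k * (cnj k / k)) (a * crev b)" using abc(2) k by simp
  then have "Y' = smult (c * cnj k / k) (smult k a * crev (smult (inverse k) b))"
    using k by (simp add: crev_smult field_simps)
  moreover have "cmod (c * cnj k / k) = 1" using abc(3) k by (simp add: norm_mult norm_divide)
  moreover have "coeff (smult (inverse k) b) 0 = 1" using k by (simp add: k_def)
  ultimately show ?thesis by blast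
qed

section \<open>Sampling at roots of unity\<close>

definition fnode :: "nat \<Rightarrow> complex" where
  "fnode N = cis (- 2 * pi / real N)"

lemma norm_fnode [simp]: "cmod (fnode N) = 1"
  by (simp add: fnode_def)

lemma fnode_nonzero [simp]: "fnode N \<noteq> 0"
  using norm_fnode[of N] by (metis norm_zero zero_neq_one)

lemma fnode_inj:
  assumes "fnode N ^ j = fnode N ^ k" "j < N" "k < N"
  shows "j = k"
proof -
  have "cnj (fnode N ^ i) = cis (2 * pi * real i / real N)" for i
  proof -
    have "fnode N ^ i = cis (real i * (- 2 * pi / real N))" by (simp only: fnode_def Complex.DeMoivre)
    also have "real i * (- 2 * pi / real N) = - (2 * pi * real i / real N)" by simp
    finally show ?thesis by (simp only: cis_cnj minus_minus)
  qed
  then have "cis (2 * pi * real j / real N) = cis (2 * pi * real k / real N)"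
    using assms(1) by metis
  moreover have "inj_on (\<lambda>k. cis (2 * pi * real k / real N)) {..<N}"
    using Complex.bij_betw_roots_unity[of N] assms(2) by (auto simp: bij_betw_def)
  ultimately show ?thesis using assms by (auto dest: inj_onD)
qed

text \<open>The function \<open>z^d |Y z|^2\<close> agrees on the circle with a polynomial of degree
  at most \<open>2 d\<close>, and the \<open>2 d + 1\<close> nodes are distinct.\<close>

lemma circle_modulus_eq_from_samples:
  assumes deg: "degree Y \<le> d" "degree Y' \<le> d" and N: "2 * d < N"
    and eq: "\<And>k. k \<le> 2 * d \<Longrightarrow> cmod (poly Y (fnode N ^ k)) = cmod (poly Y' (fnode N ^ k))"
    and z: "cmod z = 1"
  shows "cmod (poly Y z) = cmod (poly Y' z)"
proof -
  \<comment> \<open>Reversal at the nominal degree \<open>d\<close>, because the actual degrees of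
    \<open>Y\<close> and \<open>Y'\<close> may differ.\<close>
  define rv where "rv p = (\<Sum>i\<le>d. monom (cnj (coeff p i)) (d - i))" for p :: "complex poly"
  have rv: "poly (rv p) z = z ^ d * cnj (poly p z)" if "cmod z = 1" "degree p \<le> d" for p z
  proof -
    have inv: "z * cnj z = 1" using that by (simp add: complex_norm_square[symmetric])
    have "z ^ d * cnj (poly p z) = (\<Sum>i\<le>d. z ^ d * (cnj (coeff p i) * cnj z ^ i))"
    proof -
      have "poly p z = (\<Sum>i\<le>d. coeff p i * z ^ i)" unfolding poly_altdef
        using that by (intro sum.mono_neutral_left) (auto simp: coeff_eq_0)
      then show ?thesis by (simp add: sum_distrib_left)
    qed
    also have "\<dots> = (\<Sum>i\<le>d. cnj (coeff p i) * z ^ (d - i))"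
    proof (intro sum.cong refl)
      fix i assume "i \<in> {..d}"
      then have "z ^ d = z ^ (d - i) * z ^ i" by (simp flip: power_add)
      then have "z ^ d * cnj z ^ i = z ^ (d - i) * (z * cnj z) ^ i" by (simp add: power_mult_distrib)
      then show "z ^ d * (cnj (coeff p i) * cnj z ^ i) = cnj (coeff p i) * z ^ (d - i)"
        using inv by (simp add: mult_ac)
    qed
    finally show ?thesis by (simp add: rv_def poly_sum poly_monom)
  qed
  have prod: "poly (p * rv p) z = z ^ d * of_real ((cmod (poly p z))\<^sup>2)" if "cmod z = 1" "degree p \<le> d" for p z
    using rv[OF that] by (simp add: mult_ac flip: complex_norm_square)
  have degrv: "degree (rv p) \<le> d" for p
    unfolding rv_def by (intro degree_sum_le) (auto intro: order_trans[OF degree_monom_le])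
  have "Y * rv Y = Y' * rv Y'"
  proof (rule poly_eqI_degree[where A = "(\<lambda>k. fnode N ^ k) ` {..2 * d}"])
    show "poly (Y * rv Y) x = poly (Y' * rv Y') x" if "x \<in> (\<lambda>k. fnode N ^ k) ` {..2 * d}" for x
      using that eq deg by (auto simp only: prod norm_power norm_fnode power_one atMost_iff)
    have card: "card ((\<lambda>k. fnode N ^ k) ` {..2 * d}) = 2 * d + 1"
      using N by (subst card_image) (auto intro!: inj_onI dest: fnode_inj)
    show "degree (Y * rv Y) < card ((\<lambda>k. fnode N ^ k) ` {..2 * d})"
      "degree (Y' * rv Y') < card ((\<lambda>k. fnode N ^ k) ` {..2 * d})"
      using deg degrv[of Y] degrv[of Y'] degree_mult_le[of Y "rv Y"] degree_mult_le[of Y' "rv Y'"]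
      unfolding card by linarith+
  qed
  then have "z ^ d * of_real ((cmod (poly Y z))\<^sup>2) = z ^ d * complex_of_real ((cmod (poly Y' z))\<^sup>2)"
    using prod[OF z] deg by metis
  moreover have "z \<noteq> 0" using z by auto
  ultimately have "complex_of_real ((cmod (poly Y z))\<^sup>2) = complex_of_real ((cmod (poly Y' z))\<^sup>2)" by simp
  then have "(cmod (poly Y z))\<^sup>2 = (cmod (poly Y' z))\<^sup>2" by (simp only: of_real_eq_iff)
  then show ?thesis by simp
qed

section \<open>Excluding root flips generically\<close>

text \<open>A vector \<open>v\<close> with entries \<open>0..d\<close> encodes a pair of polynomials of degrees at most
  \<open>d - e\<close> and \<open>e\<close>, the second one with constant coefficient 1.\<close>

definition fst_factor :: "nat \<Rightarrow> nat \<Rightarrow> (nat \<Rightarrow> complex) \<Rightarrow> nat \<Rightarrow> complex" where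
  "fst_factor d e v i = (if i \<le> d - e then v i else 0)"

definition snd_factor :: "nat \<Rightarrow> nat \<Rightarrow> (nat \<Rightarrow> complex) \<Rightarrow> nat \<Rightarrow> complex" where
  "snd_factor d e v j = (if j = 0 then 1 else if j \<le> e then v (d - e + j) else 0)"

text \<open>Reversal at the formal degree \<open>e\<close>, which is polynomial in real and
  imaginary parts. \<open>crev\<close> depends on the actual degree and agrees with this only when
  that degree is \<open>e\<close>.\<close>

definition snd_factor_rev :: "nat \<Rightarrow> nat \<Rightarrow> (nat \<Rightarrow> complex) \<Rightarrow> nat \<Rightarrow> complex" where
  "snd_factor_rev d e v j = (if j \<le> e then cnj (snd_factor d e v (e - j)) else 0)"

definition conv :: "(nat \<Rightarrow> complex) \<Rightarrow> (nat \<Rightarrow> complex) \<Rightarrow> nat \<Rightarrow> complex" where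
  "conv f g k = (\<Sum>i\<le>k. f i * g (k - i))"

definition shift :: "nat \<Rightarrow> (nat \<Rightarrow> complex) \<Rightarrow> nat \<Rightarrow> complex" where
  "shift s f n = (if s \<le> n then f (n - s) else 0)"

definition encode :: "nat \<Rightarrow> nat \<Rightarrow> complex poly \<Rightarrow> complex poly \<Rightarrow> nat \<Rightarrow> complex" where
  "encode d e a b i = (if i \<le> d - e then coeff a i else coeff b (i - (d - e)))"

lemma encode_factors:
  assumes "degree a \<le> d - e" "degree b = e" "coeff b 0 = 1"
  shows "fst_factor d e (encode d e a b) = coeff a"
    "snd_factor d e (encode d e a b) = coeff b"
    "snd_factor_rev d e (encode d e a b) = coeff (crev b)"
proof -
  show 1: "fst_factor d e (encode d e a b) = coeff a"
    using assms by (auto simp: fst_factor_def encode_def fun_eq_iff coeff_eq_0)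
  show 2: "snd_factor d e (encode d e a b) = coeff b"
    using assms by (auto simp: snd_factor_def encode_def fun_eq_iff coeff_eq_0)
  show "snd_factor_rev d e (encode d e a b) = coeff (crev b)"
    unfolding snd_factor_rev_def[abs_def] 2 using assms by (auto simp: coeff_crev fun_eq_iff)
qed

lemma conv_coeff: "conv (coeff a) (coeff b) = coeff (a * b)"
  by (auto simp: conv_def coeff_mult)

lemma shift_coeff: "shift s (coeff a) = coeff (monom 1 s * a)"
  by (auto simp: shift_def coeff_monom_mult)

lemma cpoly_if:
  "(c \<Longrightarrow> cpoly A f) \<Longrightarrow> (\<not> c \<Longrightarrow> cpoly A g) \<Longrightarrow> cpoly A (\<lambda>v. if c then f v else g v)"
  by (cases c) simp_all

lemma cpoly_fst_factor:
  "(\<And>i. i \<le> d \<Longrightarrow> cpoly A (\<lambda>v. y v i)) \<Longrightarrow> cpoly A (\<lambda>v. fst_factor d e (y v) i)"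
  by (auto simp: fst_factor_def intro!: cpoly_if cpoly_const)

lemma cpoly_snd_factor:
  "(\<And>i. i \<le> d \<Longrightarrow> cpoly A (\<lambda>v. y v i)) \<Longrightarrow> e \<le> d \<Longrightarrow> cpoly A (\<lambda>v. snd_factor d e (y v) i)"
  by (auto simp: snd_factor_def intro!: cpoly_if cpoly_const)

lemma cpoly_snd_factor_rev:
  "(\<And>i. i \<le> d \<Longrightarrow> cpoly A (\<lambda>v. y v i)) \<Longrightarrow> e \<le> d \<Longrightarrow> cpoly A (\<lambda>v. snd_factor_rev d e (y v) i)"
  by (auto simp: snd_factor_rev_def intro!: cpoly_if cpoly_const cpoly_cnj cpoly_snd_factor)

lemma cpoly_conv:
  "(\<And>i. cpoly A (\<lambda>v. f v i)) \<Longrightarrow> (\<And>i. cpoly A (\<lambda>v. g v i)) \<Longrightarrow> cpoly A (\<lambda>v. conv (f v) (g v) k)"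
  unfolding conv_def by (intro cpoly_sum cpoly_mult)

lemma cpoly_shift:
  "(\<And>i. cpoly A (\<lambda>v. f v i)) \<Longrightarrow> cpoly A (\<lambda>v. shift s (f v) k)"
  unfolding shift_def by (auto intro!: cpoly_if cpoly_const)

lemma conv_delta:
  assumes "\<And>i. f i = (if i = \<alpha> then 1 else 0)"
  shows "conv f g = shift \<alpha> g"
proof
  fix k
  have "conv f g k = (\<Sum>i\<le>k. if i = \<alpha> then g (k - \<alpha>) else 0)"
    unfolding conv_def assms by (intro sum.cong) auto
  then show "conv f g k = shift \<alpha> g k" by (auto simp: shift_def)
qed

text \<open>Pairs \<open>(a, b)\<close> have \<open>d + 1\<close> complex parameters, as many as the
  window has entries. So the image of the pairs with equal moduli is negligible as soon as one pair
  has different moduli; \<open>\<alpha>\<close> and \<open>\<beta>\<close> provide it.\<close>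

lemma cgen_no_flip:
  assumes e: "e \<le> d" and \<alpha>: "\<alpha> \<le> d - e" and \<beta>: "\<beta> \<le> e"
    and n: "(s + \<alpha> + \<beta> = n) \<noteq> (s' + \<alpha> + (e - \<beta>) = n)"
  shows "cgen {s..s + d} (\<lambda>y. \<forall>a b. degree a \<le> d - e \<and> degree b = e \<and> coeff b 0 = 1 \<and>
      (\<forall>k\<le>d. y (s + k) = coeff (a * b) k) \<longrightarrow>
      cmod (coeff (monom 1 s * (a * b)) n) \<noteq> cmod (coeff (monom 1 s' * (a * crev b)) n))"
proof -
  define F where "F v = (cmod (shift s (conv (fst_factor d e v) (snd_factor d e v)) n))\<^sup>2
     - (cmod (shift s' (conv (fst_factor d e v) (snd_factor_rev d e v)) n))\<^sup>2" for v
  \<comment> \<open>This encodes \<open>a = z^\<alpha>\<close> and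
    \<open>b = 1 + 3 z^\<beta>\<close> (\<open>b = 1\<close> if \<open>\<beta> = 0\<close>). The
    main term of \<open>z^s a b\<close> sits at \<open>s + \<alpha> + \<beta>\<close> and that of
    the flip at \<open>s' + \<alpha> + e - \<beta>\<close>; exactly one of these is
    \<open>n\<close>. So the moduli are 3 against 0 or 1, or 1 against 0 if
    \<open>\<beta> = 0\<close>.\<close>
  define v0 where "v0 i = (if i = \<alpha> then 1 else if i = d - e + \<beta> \<and> \<beta> > 0 then 3 else 0 :: complex)" for i
  have fst0: "fst_factor d e v0 i = (if i = \<alpha> then 1 else 0)" for i
    using \<alpha> by (auto simp: fst_factor_def v0_def)
  have snd0: "snd_factor d e v0 j = (if j = 0 then 1 else if j = \<beta> then 3 else 0)" for j
    using \<alpha> \<beta> by (auto simp: snd_factor_def v0_def)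
  have V: "shift s (shift \<alpha> (snd_factor d e v0)) n
      = (if n = s + \<alpha> then 1 else if n = s + \<alpha> + \<beta> then 3 else 0)"
    by (auto simp: shift_def snd0)
  have snd_rev0: "snd_factor_rev d e v0 j = (if j = e then 1 else if j = e - \<beta> then 3 else 0)" for j
    using \<beta> by (auto simp: snd_factor_rev_def snd0)
  have V': "shift s' (shift \<alpha> (snd_factor_rev d e v0)) n
      = (if n = s' + \<alpha> + e then 1 else if n = s' + \<alpha> + (e - \<beta>) then 3 else 0)"
    by (auto simp: shift_def snd_rev0)
  have "F v0 \<noteq> 0"
    using n \<beta> unfolding F_def conv_delta[of "fst_factor d e v0", OF fst0] V V'
    by (cases "\<beta> = 0"; cases "s + \<alpha> + \<beta> = n") (auto split: if_splits)
  then have "cgen {s..s + d} (\<lambda>y. \<forall>v. (\<forall>k\<in>{s..s + d}.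
      conv (fst_factor d e v) (snd_factor d e v) (k - s) = y k) \<longrightarrow> F v \<noteq> 0)"
    unfolding F_def using e
    by (intro cgen_image_zero_set[of "{..d}"] rpoly_diff rpoly_cmod2 cpoly_shift cpoly_conv
        cpoly_fst_factor cpoly_snd_factor cpoly_snd_factor_rev cpoly_cvec) auto
  then show ?thesis
  proof (rule cgen_mono, intro allI impI, elim conjE)
    fix y a b
    assume *: "\<forall>v. (\<forall>k\<in>{s..s + d}.
        conv (fst_factor d e v) (snd_factor d e v) (k - s) = y k) \<longrightarrow> F v \<noteq> 0"
      and ab: "degree a \<le> d - e" "degree b = e" "coeff b 0 = 1"
      and y: "\<forall>k\<le>d. y (s + k) = coeff (a * b) k"
    have "coeff (a * b) (k - s) = y k" if "k \<in> {s..s + d}" for k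
      using that y[rule_format, of "k - s"] by auto
    then have "F (encode d e a b) \<noteq> 0"
      using *[rule_format, of "encode d e a b"] by (simp add: encode_factors[OF ab] conv_coeff)
    then show "cmod (coeff (monom 1 s * (a * b)) n) \<noteq> cmod (coeff (monom 1 s' * (a * crev b)) n)"
      by (auto simp: F_def encode_factors[OF ab] conv_coeff shift_coeff)
  qed
qed

text \<open>The coefficient counts the splittings of \<open>k\<close>, and making the first part as
  large as possible gives one.\<close>

lemma conv_factors_ones:
  assumes "e \<le> d" "k \<le> d"
  shows "conv (fst_factor d e (\<lambda>_. 1)) (snd_factor d e (\<lambda>_. 1)) k \<noteq> 0"
proof -
  define S where "S = {i. i \<le> k \<and> i \<le> d - e \<and> k - i \<le> e}"
  have "conv (fst_factor d e (\<lambda>_. 1)) (snd_factor d e (\<lambda>_. 1)) k = (\<Sum>i\<le>k. if i \<in> S then 1 else 0)"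
    unfolding conv_def by (intro sum.cong) (auto simp: fst_factor_def snd_factor_def S_def)
  also have "\<dots> = of_nat (card S)"
  proof -
    have "{..k} \<inter> S = S" by (auto simp: S_def)
    then show ?thesis by (simp add: sum.If_cases)
  qed
  finally have eq: "conv (fst_factor d e (\<lambda>_. 1)) (snd_factor d e (\<lambda>_. 1)) k = of_nat (card S)" .
  have "min k (d - e) \<in> S" "finite S" using assms by (auto simp: S_def)
  then have "card S \<noteq> 0" by auto
  then show ?thesis unfolding eq by simp
qed

text \<open>For \<open>1 <= e\<close> the constant term of \<open>a * crev b\<close> contains the
  leading coefficient of \<open>b\<close>, which varies independently of the second pair. So no flip
  there can compensate for the first one.\<close>

lemma cgen_no_flip_pair:
  assumes e: "1 \<le> e" "e \<le> d" and e': "e' \<le> d'" and n: "s \<le> n" "n \<le> s + d'"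
  shows "cgen (Inl ` {..d} \<union> Inr ` {s..s + d'}) (\<lambda>y. \<forall>a b a' b'.
      degree a \<le> d - e \<and> degree b = e \<and> coeff b 0 = 1 \<and>
      degree a' \<le> d' - e' \<and> degree b' = e' \<and> coeff b' 0 = 1 \<and>
      (\<forall>k\<le>d. y (Inl k) = coeff (a * b) k) \<and> (\<forall>k\<le>d'. y (Inr (s + k)) = coeff (a' * b') k) \<longrightarrow>
      cmod (coeff (monom 1 s' * (a' * crev b')) n) * cmod (coeff (a * b) 0)
       \<noteq> cmod (coeff (monom 1 s * (a' * b')) n) * cmod (coeff (a * crev b) 0))"
proof -
  define f g r where "f v = fst_factor d e (\<lambda>i. v (Inl i))" and "g v = snd_factor d e (\<lambda>i. v (Inl i))"
    and "r v = snd_factor_rev d e (\<lambda>i. v (Inl i))" for v :: "nat + nat \<Rightarrow> complex"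
  define f' g' r' where "f' v = fst_factor d' e' (\<lambda>i. v (Inr i))"
    and "g' v = snd_factor d' e' (\<lambda>i. v (Inr i))"
    and "r' v = snd_factor_rev d' e' (\<lambda>i. v (Inr i))" for v :: "nat + nat \<Rightarrow> complex"
  let ?C = "Inl ` {..d} \<union> Inr ` {..d'} :: (nat + nat) set"
  let ?E = "Inl ` {..d} \<union> Inr ` {s..s + d'} :: (nat + nat) set"
  define F where "F v = (cmod (shift s' (conv (f' v) (r' v)) n))\<^sup>2 * (cmod (conv (f v) (g v) 0))\<^sup>2
     - (cmod (shift s (conv (f' v) (g' v)) n))\<^sup>2 * (cmod (conv (f v) (r v) 0))\<^sup>2" for v
  define \<phi> where "\<phi> v = case_sum (conv (f v) (g v)) (\<lambda>k. conv (f' v) (g' v) (k - s))" for v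
  \<comment> \<open>The first pair is \<open>a = 1\<close>, \<open>b = 1 + t z^e\<close>, the second
    has all coefficients 1. The constant terms before and after the flip are 1 and
    \<open>cnj t\<close>: \<open>t = 0\<close> leaves only the first summand of \<open>F\<close>,
    and \<open>t = 1\<close> is used when that summand is 0.\<close>
  define t :: complex where
    "t = (if shift s' (conv (fst_factor d' e' (\<lambda>_. 1)) (snd_factor_rev d' e' (\<lambda>_. 1))) n = 0 then 1 else 0)"
  define v0 where "v0 = case_sum (\<lambda>i. if i = 0 then 1 else if i = d then t else 0) (\<lambda>_ :: nat. 1 :: complex)"
  have "conv (f v0) (g v0) 0 = 1" "conv (f v0) (r v0) 0 = cnj t"
    using e by (auto simp: conv_def f_def g_def r_def fst_factor_def snd_factor_def snd_factor_rev_def v0_def)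
  moreover have "shift s (conv (f' v0) (g' v0)) n \<noteq> 0"
    using conv_factors_ones[OF e', of "n - s"] n by (simp add: shift_def f'_def g'_def v0_def)
  ultimately have F0: "F v0 \<noteq> 0"
    by (auto simp: F_def t_def f'_def r'_def v0_def)
  have poly_l: "cpoly (?C \<times> UNIV) (\<lambda>v. cvec v (Inl i))" if "i \<le> d" for i
    using that by (intro cpoly_cvec) auto
  have poly_r: "cpoly (?C \<times> UNIV) (\<lambda>v. cvec v (Inr i))" if "i \<le> d'" for i
    using that by (intro cpoly_cvec) auto
  have polys: "cpoly (?C \<times> UNIV) (\<lambda>v. f (cvec v) i)" "cpoly (?C \<times> UNIV) (\<lambda>v. g (cvec v) i)"
    "cpoly (?C \<times> UNIV) (\<lambda>v. r (cvec v) i)" "cpoly (?C \<times> UNIV) (\<lambda>v. f' (cvec v) i)"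
    "cpoly (?C \<times> UNIV) (\<lambda>v. g' (cvec v) i)" "cpoly (?C \<times> UNIV) (\<lambda>v. r' (cvec v) i)" for i
    unfolding f_def g_def r_def f'_def g'_def r'_def using e e'
    by (auto intro!: cpoly_fst_factor cpoly_snd_factor cpoly_snd_factor_rev poly_l poly_r)
  have card_sum: "card (Inl ` {..d} \<union> Inr ` I :: (nat + nat) set) = Suc d + card I" if "finite I" for I
    using that by (subst card_Un_disjoint) (auto simp: card_image)
  have "cgen ?E (\<lambda>y. \<forall>v. (\<forall>k\<in>?E. \<phi> v k = y k) \<longrightarrow> F v \<noteq> 0)"
  proof (rule cgen_image_zero_set[where C = ?C and F = F and ?a0.0 = v0])
    show "card ?C \<le> card ?E" by (simp add: card_sum)
    show "cpoly (?C \<times> UNIV) (\<lambda>v. \<phi> (cvec v) b)" if "b \<in> ?E" for b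
      using that by (auto simp: \<phi>_def intro!: cpoly_conv polys)
    show "rpoly (?C \<times> UNIV) (\<lambda>v. F (cvec v))"
      unfolding F_def by (intro rpoly_diff rpoly_mult rpoly_cmod2 cpoly_shift cpoly_conv polys)
    show "F v0 \<noteq> 0" by (rule F0)
  qed auto
  then show ?thesis
  proof (rule cgen_mono, intro allI impI, elim conjE)
    fix y a b a' b'
    assume *: "\<forall>v. (\<forall>k\<in>?E. \<phi> v k = y k) \<longrightarrow> F v \<noteq> 0"
      and ab: "degree a \<le> d - e" "degree b = e" "coeff b 0 = 1"
      and ab': "degree a' \<le> d' - e'" "degree b' = e'" "coeff b' 0 = 1"
      and y: "\<forall>k\<le>d. y (Inl k) = coeff (a * b) k" "\<forall>k\<le>d'. y (Inr (s + k)) = coeff (a' * b') k"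
    define v where "v = case_sum (encode d e a b) (encode d' e' a' b')"
    have fg: "f v = coeff a" "g v = coeff b" "r v = coeff (crev b)"
      "f' v = coeff a'" "g' v = coeff b'" "r' v = coeff (crev b')"
      by (simp_all add: v_def f_def g_def r_def f'_def g'_def r'_def encode_factors[OF ab] encode_factors[OF ab'])
    have "\<phi> v k = y k" if "k \<in> ?E" for k
    proof (cases k)
      case (Inl i)
      then show ?thesis using that y by (auto simp: \<phi>_def fg conv_coeff)
    next
      case (Inr i)
      then have "s \<le> i" "i - s \<le> d'" using that by auto
      then show ?thesis using y(2)[rule_format, of "i - s"] Inr by (simp add: \<phi>_def fg conv_coeff)
    qed
    then have "F v \<noteq> 0" using * by blast
    then show "cmod (coeff (monom 1 s' * (a' * crev b')) n) * cmod (coeff (a * b) 0)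
       \<noteq> cmod (coeff (monom 1 s * (a' * b')) n) * cmod (coeff (a * crev b) 0)"
      unfolding F_def fg conv_coeff shift_coeff power_mult_distrib[symmetric] by auto
  qed
qed

section \<open>Sparse differences\<close>

text \<open>The bound is put on coefficients instead of \<open>degree\<close> so that the empty set
  of nodes forces \<open>p = 0\<close>.\<close>

lemma interpolation:
  fixes u :: "complex \<Rightarrow> complex"
  assumes "finite X"
  shows "\<exists>p. (\<forall>i\<ge>card X. coeff p i = 0) \<and> (\<forall>x\<in>X. poly p x = u x)"
  using assms
proof induction
  case empty
  then show ?case by (intro exI[of _ 0]) auto
next
  case (insert x X)
  then obtain p where p: "\<And>i. i \<ge> card X \<Longrightarrow> coeff p i = 0" "\<And>x. x \<in> X \<Longrightarrow> poly p x = u x"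
    by blast
  define q where "q = (\<Prod>z\<in>X. [:- z, 1:])"
  have q: "poly q z = 0 \<longleftrightarrow> z \<in> X" for z
    using insert by (auto simp: q_def poly_prod)
  have "degree q \<le> sum (degree \<circ> (\<lambda>z. [:- z, 1:])) X"
    unfolding q_def by (rule degree_prod_sum_le) fact
  then have "degree q \<le> card X" by simp
  define r where "r = p + smult ((u x - poly p x) / poly q x) q"
  have "coeff r i = 0" if "i \<ge> card (insert x X)" for i
    using that insert p \<open>degree q \<le> card X\<close> by (auto simp: r_def coeff_eq_0)
  moreover have "poly r z = u z" if "z \<in> insert x X" for z
    using that p q insert by (cases "z = x") (auto simp: r_def)
  ultimately show ?case by blast
qed

lemma poly_eq_sum_lessThan:
  fixes p :: "'a :: comm_semiring_1 poly"
  assumes "\<And>i. i \<ge> n \<Longrightarrow> coeff p i = 0"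
  shows "poly p x = (\<Sum>i<n. coeff p i * x ^ i)"
  unfolding poly_altdef
proof (rule sum.mono_neutral_cong)
  show "coeff p i * x ^ i = 0" if "i \<in> {..degree p} - {..<n}" for i
    using that assms by auto
  show "coeff p i * x ^ i = 0" if "i \<in> {..<n} - {..degree p}" for i
    using that by (auto simp: coeff_eq_0)
qed auto

definition expsum :: "nat \<Rightarrow> nat set \<Rightarrow> (nat \<Rightarrow> complex) \<Rightarrow> nat \<Rightarrow> complex" where
  "expsum N J y k = (\<Sum>j\<in>J. y j * (fnode N ^ k) ^ j)"

text \<open>Surjectivity onto \<open>d + 1\<close> samples allows conditions that are generic in the
  samples to be pulled back to the coefficients.\<close>

lemma expsum_interpolation:
  assumes K: "K \<subseteq> {..<N}" "card K = Suc d"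
  shows "\<exists>y. \<forall>k\<in>K. expsum N {s..s + d} y k = u k"
proof -
  have inj: "inj_on (\<lambda>k. fnode N ^ k) K" using K by (intro inj_onI) (auto dest: fnode_inj)
  have fin: "finite K" using K finite_subset by blast
  obtain p where p: "\<And>i. i \<ge> Suc d \<Longrightarrow> coeff p i = 0"
    "\<And>k. k \<in> K \<Longrightarrow> poly p (fnode N ^ k)
       = u (inv_into K (\<lambda>k. fnode N ^ k) (fnode N ^ k)) / (fnode N ^ k) ^ s"
    using interpolation[of "(\<lambda>k. fnode N ^ k) ` K"
        "\<lambda>x. u (inv_into K (\<lambda>k. fnode N ^ k) x) / x ^ s"] fin K inj
    by (auto simp: card_image)
  have "expsum N {s..s + d} (\<lambda>n. coeff p (n - s)) k = u k" if "k \<in> K" for k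
  proof -
    have window: "{s..s + d} = (\<lambda>i. i + s) ` {..d}"
      by (auto simp: image_iff) (metis add.commute atMost_iff le_add_diff_inverse2 le_diff_conv)
    have "expsum N {s..s + d} (\<lambda>n. coeff p (n - s)) k
        = (\<Sum>i\<le>d. coeff p i * (fnode N ^ k) ^ (i + s))"
      unfolding expsum_def window by (subst sum.reindex) (auto simp: inj_on_def)
    also have "\<dots> = (fnode N ^ k) ^ s * (\<Sum>i\<le>d. coeff p i * (fnode N ^ k) ^ i)"
      unfolding sum_distrib_left by (intro sum.cong) (auto simp: power_add)
    also have "(\<Sum>i\<le>d. coeff p i * (fnode N ^ k) ^ i) = poly p (fnode N ^ k)"
      using poly_eq_sum_lessThan[of "Suc d" p, OF p(1)] by (simp add: lessThan_Suc_atMost)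
    also have "(fnode N ^ k) ^ s * \<dots> = u k" using p(2)[OF that] inj that by simp
    finally show ?thesis .
  qed
  then show ?thesis by blast
qed

text \<open>A Vandermonde system with the roles of exponent and node exchanged: over consecutive
  \<open>k\<close> the summands are geometric with distinct ratios \<open>fnode N ^ j\<close>, and
  an interpolation polynomial in these ratios isolates \<open>D j\<close>, however scattered
  \<open>J\<close> is.\<close>

lemma expsum_recover:
  assumes J: "J \<subseteq> {..<N}"
  shows "\<exists>M. \<forall>D. \<forall>j\<in>J. D j = (\<Sum>i<card J. M j i * expsum N J D (k0 + i))"
proof -
  have inj: "inj_on (\<lambda>j. fnode N ^ j) J" using J by (intro inj_onI) (auto dest: fnode_inj)
  have fin: "finite J" using J finite_subset by blast
  have "\<exists>p. (\<forall>i\<ge>card J. coeff p i = 0) \<and> (\<forall>j'\<in>J. poly p (fnode N ^ j') = (if j' = j then 1 else 0))"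
    if "j \<in> J" for j
    using interpolation[of "(\<lambda>j. fnode N ^ j) ` J" "\<lambda>x. if x = fnode N ^ j then 1 else 0"] fin inj that
    by (auto simp: card_image inj_on_eq_iff)
  then obtain p where p: "\<And>j i. j \<in> J \<Longrightarrow> i \<ge> card J \<Longrightarrow> coeff (p j) i = 0"
    "\<And>j j'. j \<in> J \<Longrightarrow> j' \<in> J \<Longrightarrow> poly (p j) (fnode N ^ j') = (if j' = j then 1 else 0)"
    by metis
  have sum_p: "(\<Sum>i<card J. coeff (p j) i * (fnode N ^ j') ^ i) = (if j' = j then 1 else 0)"
    if "j \<in> J" "j' \<in> J" for j j'
    using poly_eq_sum_lessThan[of "card J" "p j", OF p(1)] p(2) that by metis
  have "D j = (\<Sum>i<card J. (coeff (p j) i / (fnode N ^ k0) ^ j) * expsum N J D (k0 + i))"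
    if "j \<in> J" for D j
  proof -
    have "(\<Sum>i<card J. coeff (p j) i * expsum N J D (k0 + i))
        = (\<Sum>j'\<in>J. D j' * (fnode N ^ k0) ^ j' * (\<Sum>i<card J. coeff (p j) i * (fnode N ^ j') ^ i))"
      unfolding expsum_def sum_distrib_left
      by (subst sum.swap) (intro sum.cong refl, simp add: power_add power_mult_distrib flip: power_mult,
          simp add: mult_ac)
    also have "\<dots> = (\<Sum>j'\<in>J. if j' = j then D j * (fnode N ^ k0) ^ j else 0)"
      by (intro sum.cong refl) (simp add: sum_p that)
    also have "\<dots> = D j * (fnode N ^ k0) ^ j" using that fin by simp
    finally have "D j = (\<Sum>i<card J. coeff (p j) i * expsum N J D (k0 + i)) / (fnode N ^ k0) ^ j"
      by simp
    then show ?thesis by (simp add: sum_divide_distrib)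
  qed
  then show ?thesis by (intro exI[of _ "\<lambda>j i. coeff (p j) i / (fnode N ^ k0) ^ j"]) blast
qed

lemma expsum_from_block:
  assumes J: "J \<subseteq> {..<N}"
  shows "\<exists>M. \<forall>D k. expsum N J D k = (\<Sum>\<kappa>\<in>{k0..<k0 + card J}. M k \<kappa> * expsum N J D \<kappa>)"
proof -
  obtain M where M: "\<And>D j. j \<in> J \<Longrightarrow> D j = (\<Sum>i<card J. M j i * expsum N J D (k0 + i))"
    using expsum_recover[OF J] by blast
  have "expsum N J D k = (\<Sum>\<kappa>\<in>{k0..<k0 + card J}.
      (\<Sum>j\<in>J. M j (\<kappa> - k0) * (fnode N ^ k) ^ j) * expsum N J D \<kappa>)" for D k
  proof -
    have "expsum N J D k = (\<Sum>j\<in>J. (\<Sum>i<card J. M j i * expsum N J D (k0 + i)) * (fnode N ^ k) ^ j)"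
      unfolding expsum_def[of N J D k] by (intro sum.cong refl arg_cong2[of _ _ _ _ "(*)"] M)
    also have "\<dots> = (\<Sum>i<card J. (\<Sum>j\<in>J. M j i * (fnode N ^ k) ^ j) * expsum N J D (k0 + i))"
      unfolding sum_distrib_right by (subst sum.swap) (intro sum.cong refl, simp add: mult_ac)
    also have "\<dots> = (\<Sum>i\<in>{0..<card J}. (\<Sum>j\<in>J. M j (i + k0 - k0) * (fnode N ^ k) ^ j) * expsum N J D (i + k0))"
      by (intro sum.cong) (auto simp: add.commute)
    also have "\<dots> = (\<Sum>\<kappa>\<in>{0 + k0..<card J + k0}.
        (\<Sum>j\<in>J. M j (\<kappa> - k0) * (fnode N ^ k) ^ j) * expsum N J D \<kappa>)"
      by (rule sum.shift_bounds_nat_ivl[symmetric])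
    finally show ?thesis by (simp add: add.commute)
  qed
  then show ?thesis
    by (intro exI[of _ "\<lambda>k \<kappa>. \<Sum>j\<in>J. M j (\<kappa> - k0) * (fnode N ^ k) ^ j"]) blast
qed

text \<open>With \<open>q = u / D\<close> the condition says \<open>|q + 1| = |q|\<close>, that is,
  \<open>Re q = -1/2\<close>. Given \<open>D\<close>, the value \<open>u\<close> therefore has only
  one real degree of freedom.\<close>

lemma modulus_add_eqD:
  assumes "cmod (u + D) = cmod u" "D \<noteq> 0"
  shows "u = D * Complex (- 1 / 2) (Im (u / D))"
proof -
  define q where "q = u / D"
  have u: "u = q * D" using assms(2) by (simp add: q_def)
  have "cmod ((q + 1) * D) = cmod (q * D)" using assms(1) by (simp add: u algebra_simps)
  then have "cmod (q + 1) = cmod q" using assms(2) by (simp add: norm_mult)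
  then have "(cmod (q + 1))\<^sup>2 = (cmod q)\<^sup>2" by simp
  then have "Re q = - 1 / 2" unfolding cmod_power2 by (simp add: power2_eq_square algebra_simps)
  then have "q = Complex (- 1 / 2) (Im q)" by (simp add: complex_eq_iff)
  then show ?thesis using u unfolding q_def by (metis mult.commute)
qed

text \<open>The difference \<open>D\<close> is determined by its \<open>card P\<close> nonzero samples in one block, so
  \<open>2 card P\<close> real parameters, while each of the \<open>2 card P + 1\<close> samples in \<open>K'\<close> imposes one
  real condition on \<open>y\<close>.\<close>

lemma cgen_no_sparse_difference_pattern:
  assumes J: "J \<subseteq> {..<N}" and P: "P \<subseteq> {k0..<k0 + card J}" and K': "K' \<subseteq> {..<N}"
    and card: "card K' = 2 * card P + 1" and d: "2 * card P \<le> d" "d < N"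
  shows "cgen {s..s + d} (\<lambda>y. \<not> (\<exists>D. (\<forall>k\<in>{k0..<k0 + card J} - P. expsum N J D k = 0) \<and>
      (\<forall>k\<in>K'. expsum N J D k \<noteq> 0 \<and>
        cmod (expsum N {s..s + d} y k + expsum N J D k) = cmod (expsum N {s..s + d} y k))))"
proof -
  \<comment> \<open>\<open>K'\<close> is completed to \<open>d + 1\<close> positions, at which the
    samples of \<open>y\<close> are free coordinates.\<close>
  obtain K where K: "K' \<subseteq> K" "K \<subseteq> {..<N}" "card K = Suc d"
    using exists_subset_between[of K' "Suc d" "{..<N}"] K' card d by auto
  have fin: "finite K" "finite K'" "finite P"
    using K K' P finite_subset by blast+
  obtain M where M: "\<And>D k. expsum N J D k = (\<Sum>\<kappa>\<in>{k0..<k0 + card J}. M k \<kappa> * expsum N J D \<kappa>)"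
    using expsum_from_block[OF J] by metis
  have MP: "expsum N J D k = (\<Sum>\<kappa>\<in>P. M k \<kappa> * expsum N J D \<kappa>)"
    if "\<forall>k\<in>{k0..<k0 + card J} - P. expsum N J D k = 0" for D k
    unfolding M[of D k] using that P by (intro sum.mono_neutral_right) auto
  \<comment> \<open>Tag 0 holds the nonzero samples of \<open>D\<close> in the block, tag 1 the
    imaginary parts from \<open>modulus_add_eqD\<close>, tag 2 the samples of \<open>y\<close>
    outside \<open>K'\<close>, tag 3 a dummy. Without the dummy there are
    \<open>2 card P + card K' + 2 (d + 1 - card K') = 2 d + 1\<close> real parameters, one short of
    the dimension of the target.\<close>
  define A :: "((nat \<times> nat) \<times> bool) set" where "A = ({0} \<times> P) \<times> UNIV \<union> ({1} \<times> K') \<times> {False}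
     \<union> ({2} \<times> (K - K')) \<times> UNIV \<union> {((3, 0), False)}"
  define DD where "DD v k = (\<Sum>\<kappa>\<in>P. M k \<kappa> * cvec v (0::nat, \<kappa>))" for v k
  define \<phi> where "\<phi> v k = (if k \<in> K' then DD v k * Complex (- 1 / 2) (v ((1, k), False))
      else cvec v (2, k))" for v k
  have "card A = 2 * card P + card K' + 2 * card (K - K') + 1"
    unfolding A_def using fin
    by (subst card_Un_disjoint; (subst card_Un_disjoint)?; auto simp: card_cartesian_product)+
  also have "\<dots> = 2 * Suc d" using K fin card d by (simp add: card_Diff_subset card_mono)
  finally have cardA: "card A = 2 * Suc d" .
  have finA: "finite A" unfolding A_def using fin by auto
  have poly0: "cpoly A (\<lambda>v. cvec v (0, \<kappa>))" if "\<kappa> \<in> P" for \<kappa>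
    using that by (auto simp: cvec_def A_def intro!: cpoly_Complex rpoly_var)
  have poly_phi: "cpoly A (\<lambda>v. \<phi> v k)" if "k \<in> K" for k
    using that unfolding \<phi>_def DD_def
    by (auto intro!: cpoly_if cpoly_mult cpoly_sum cpoly_const poly0 cpoly_Complex rpoly_const
        rpoly_var simp: cvec_def) (auto simp: A_def)
  \<comment> \<open>\<open>\<phi>\<close> ignores the dummy, so restricting to the hyperplane where
    it is 0 loses no value of \<open>\<phi>\<close> and makes the image of a proper algebraic subset
    out of the full image.\<close>
  have "gen (K \<times> UNIV) (\<lambda>u. \<forall>v. (\<forall>b\<in>K \<times> UNIV. rvec (\<phi> v) b = u b) \<longrightarrow> v ((3, 0), False) \<noteq> 0)"
  proof (rule gen_image_zero_set[where A = A and ?v0.0 = "\<lambda>_. 1"])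
    show "card A \<le> card (K \<times> (UNIV :: bool set))"
      using cardA K by (simp add: card_cartesian_product)
    show "rpoly A (\<lambda>v. rvec (\<phi> v) b)" if "b \<in> K \<times> UNIV" for b
      using that by (auto intro!: rpoly_rvec poly_phi)
    show "rpoly A (\<lambda>v. v ((3, 0), False))" by (rule rpoly_var) (simp add: A_def)
  qed (use fin finA in auto)
  then have "cgen K (\<lambda>u. \<not> (\<exists>D. (\<forall>k\<in>{k0..<k0 + card J} - P. expsum N J D k = 0) \<and>
      (\<forall>k\<in>K'. expsum N J D k \<noteq> 0 \<and> cmod (u k + expsum N J D k) = cmod (u k))))"
    unfolding cgen_def
  proof (rule gen_mono, intro notI, elim exE conjE)
    fix w D
    assume *: "\<forall>v. (\<forall>b\<in>K \<times> UNIV. rvec (\<phi> v) b = w b) \<longrightarrow> v ((3, 0), False) \<noteq> 0"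
      and D0: "\<forall>k\<in>{k0..<k0 + card J} - P. expsum N J D k = 0"
      and D: "\<forall>k\<in>K'. expsum N J D k \<noteq> 0 \<and> cmod (cvec w k + expsum N J D k) = cmod (cvec w k)"
    define y where "y = (\<lambda>(i :: nat, k). if i = 0 then expsum N J D k
        else if i = 1 then of_real (Im (cvec w k / expsum N J D k))
        else if i = 2 then cvec w k else 0 :: complex)"
    define v where "v = rvec y"
    have "DD v k = expsum N J D k" for k
      unfolding MP[OF D0, of k] by (simp add: DD_def v_def y_def)
    moreover have "v ((1, k), False) = Im (cvec w k / expsum N J D k)" for k
      by (simp add: v_def rvec_pair y_def)
    moreover have "cvec v (2, k) = cvec w k" for k by (simp add: v_def y_def)
    ultimately have "\<phi> v k = cvec w k" for k
      using D modulus_add_eqD[of "cvec w k" "expsum N J D k"] by (auto simp: \<phi>_def)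
    then have "\<forall>b\<in>K \<times> UNIV. rvec (\<phi> v) b = w b" by (auto simp: rvec_pair Re_cvec Im_cvec)
    with * have "v ((3, 0), False) \<noteq> 0" by blast
    then show False by (simp add: v_def rvec_pair y_def)
  qed
  then show ?thesis
  proof (rule cgen_pullback[where H = "\<lambda>_. 1" and ?u0.0 = "\<lambda>_. 0" and \<psi> = "expsum N {s..s + d}"])
    show "cpoly ({s..s + d} \<times> UNIV) (\<lambda>v. expsum N {s..s + d} (cvec v) b)" for b
      unfolding expsum_def by (intro cpoly_sum cpoly_mult cpoly_const cpoly_cvec)
    show "\<exists>v. \<forall>b\<in>K. expsum N {s..s + d} v b = y b" for y
      using expsum_interpolation[OF K(2,3)] by blast
  qed (auto intro: rpoly_const)
qed

text \<open>If \<open>D\<close> is nonzero on \<open>J\<close>, each block of \<open>card J\<close>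
  consecutive samples has a nonzero one. If the block with the fewest has \<open>p >= 1\<close> of
  them, the four blocks have at least \<open>4 p >= 2 p + 1\<close>, which is an excluded pattern;
  there are finitely many patterns.\<close>

lemma cgen_no_sparse_difference:
  assumes J: "J \<subseteq> {..<N}" "4 * card J \<le> N" and d: "2 * card J \<le> d" "d < N"
  shows "cgen {s..s + d} (\<lambda>y. \<forall>D.
      (\<forall>k<4 * card J. cmod (expsum N {s..s + d} y k + expsum N J D k) = cmod (expsum N {s..s + d} y k))
      \<longrightarrow> (\<forall>j\<in>J. D j = 0))"
proof -
  define g where "g = card J"
  define I where "I = Sigma {..<4::nat} (\<lambda>i. Pow {i * g..<i * g + g}) \<times> Pow {..<4 * g}"
  have "finite I" unfolding I_def by auto
  have "cgen {s..s + d} (\<lambda>y. \<forall>((i, P), K') \<in> I. card K' = 2 * card P + 1 \<longrightarrow>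
     \<not> (\<exists>D. (\<forall>k\<in>{i * g..<i * g + g} - P. expsum N J D k = 0) \<and>
      (\<forall>k\<in>K'. expsum N J D k \<noteq> 0 \<and>
        cmod (expsum N {s..s + d} y k + expsum N J D k) = cmod (expsum N {s..s + d} y k))))"
  proof (intro cgen_ball \<open>finite I\<close>, clarify, intro cgen_imp)
    fix i P K' assume "((i, P), K') \<in> I" and card: "card K' = 2 * card P + 1"
    then have P: "P \<subseteq> {i * g..<i * g + card J}" and "K' \<subseteq> {..<N}"
      using J by (auto simp: I_def g_def)
    moreover have "card P \<le> card J" using card_mono[OF _ P] by simp
    ultimately show "cgen {s..s + d} (\<lambda>y. \<not> (\<exists>D. (\<forall>k\<in>{i * g..<i * g + g} - P. expsum N J D k = 0) \<and>
      (\<forall>k\<in>K'. expsum N J D k \<noteq> 0 \<and>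
        cmod (expsum N {s..s + d} y k + expsum N J D k) = cmod (expsum N {s..s + d} y k))))"
      unfolding g_def using card d by (intro cgen_no_sparse_difference_pattern J) auto
  qed
  then show ?thesis
  proof (rule cgen_mono, intro allI impI ballI)
    fix y D j
    assume *: "\<forall>((i, P), K') \<in> I. card K' = 2 * card P + 1 \<longrightarrow>
       \<not> (\<exists>D. (\<forall>k\<in>{i * g..<i * g + g} - P. expsum N J D k = 0) \<and>
        (\<forall>k\<in>K'. expsum N J D k \<noteq> 0 \<and>
          cmod (expsum N {s..s + d} y k + expsum N J D k) = cmod (expsum N {s..s + d} y k)))"
      and D: "\<forall>k<4 * card J. cmod (expsum N {s..s + d} y k + expsum N J D k) = cmod (expsum N {s..s + d} y k)"
      and j: "j \<in> J"
    show "D j = 0"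
    proof (rule ccontr)
      assume "D j \<noteq> 0"
      define P where "P i = {k \<in> {i * g..<i * g + g}. expsum N J D k \<noteq> 0}" for i
      have ne: "P i \<noteq> {}" for i
      proof
        assume "P i = {}"
        then have "expsum N J D (i * g + l) = 0" if "l < card J" for l
          using that by (auto simp: P_def g_def)
        moreover obtain M where "D j = (\<Sum>l<card J. M j l * expsum N J D (i * g + l))"
          using expsum_recover[OF J(1)] j by blast
        ultimately show False using \<open>D j \<noteq> 0\<close> by simp
      qed
      have finP: "finite (P i)" for i by (simp add: P_def)
      define i where "i = arg_min_on (\<lambda>i. card (P i)) {..<4::nat}"
      have i: "i < 4" "\<And>l. l < 4 \<Longrightarrow> card (P i) \<le> card (P l)"
        using arg_min_if_finite(1)[of "{..<4::nat}" "\<lambda>i. card (P i)"]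
          arg_min_least[of "{..<4::nat}" _ "\<lambda>i. card (P i)"] by (auto simp: i_def lessThan_empty_iff)
      have disj: "P a \<inter> P b = {}" if "a < b" for a b
      proof -
        have "a * g + g \<le> b * g" using that by (metis Suc_leI mult_Suc add.commute mult_le_mono1)
        then show ?thesis by (auto simp: P_def)
      qed
      have "card (\<Union>l<4. P l) = (\<Sum>l<4. card (P l))"
        using finP by (intro card_UN_disjoint) (auto, metis disj disjoint_iff nat_neq_iff)
      also have "\<dots> \<ge> (\<Sum>l<4::nat. card (P i))" using i by (intro sum_mono) auto
      finally have "card (\<Union>l<4. P l) \<ge> 4 * card (P i)" by simp
      moreover have "card (P i) \<noteq> 0" using ne finP by simp
      ultimately have "2 * card (P i) + 1 \<le> card (\<Union>l<4. P l)" by linarith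
      then obtain K' where K': "K' \<subseteq> (\<Union>l<4. P l)" "card K' = 2 * card (P i) + 1"
        by (meson obtain_subset_with_card_n)
      have lt: "k < 4 * g" if "k \<in> P l" "l < 4" for k l
      proof -
        have "k < Suc l * g" using that by (simp add: P_def)
        also have "\<dots> \<le> 4 * g" using that by (intro mult_le_mono1) simp
        finally show ?thesis .
      qed
      have "((i, P i), K') \<in> I" using K' lt i by (auto simp: I_def P_def)
      then have "\<not> ((\<forall>k\<in>{i * g..<i * g + g} - P i. expsum N J D k = 0) \<and>
        (\<forall>k\<in>K'. expsum N J D k \<noteq> 0 \<and>
          cmod (expsum N {s..s + d} y k + expsum N J D k) = cmod (expsum N {s..s + d} y k)))"
        using * K'(2) by blast
      moreover have "\<forall>k\<in>{i * g..<i * g + g} - P i. expsum N J D k = 0" by (auto simp: P_def)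
      moreover have "\<forall>k\<in>K'. expsum N J D k \<noteq> 0 \<and>
          cmod (expsum N {s..s + d} y k + expsum N J D k) = cmod (expsum N {s..s + d} y k)"
        using K' D lt by (force simp: P_def g_def)
      ultimately show False by blast
    qed
  qed
qed

section \<open>The generic conditions on signal and window\<close>

lemma generic_from_cgen:
  assumes "cgen (Inl ` {..<N} \<union> Inr ` {..<W}) Q"
  shows "generic N W (\<lambda>x w. Q (case_sum x w))"
proof -
  let ?A = "(Inl ` {..<N} \<union> Inr ` {..<W}) \<times> (UNIV :: bool set)"
  obtain R where R: "rpoly ?A R" "\<exists>v. R v \<noteq> 0" "\<And>v. R v \<noteq> 0 \<Longrightarrow> Q (cvec v)"
    using assms unfolding cgen_def gen_def by blast
  have "poly_fun N W (\<lambda>x w. R (rvec (case_sum x w)))"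
    using R(1)
  proof induction
    case (rpoly_var i)
    then show ?case by (cases "snd i") (auto simp: rvec_def intro: poly_fun.intros)
  qed (auto intro: poly_fun.intros)
  moreover obtain v where "R v \<noteq> 0" using R(2) by blast
  then have "R (rvec (case_sum (\<lambda>n. cvec v (Inl n)) (\<lambda>n. cvec v (Inr n)))) \<noteq> 0"
  proof -
    have "case_sum (\<lambda>n. cvec v (Inl n)) (\<lambda>n. cvec v (Inr n)) = cvec v"
      by (auto split: sum.splits simp: fun_eq_iff)
    then show ?thesis using \<open>R v \<noteq> 0\<close> by simp
  qed
  moreover have "Q (case_sum x w)" if "R (rvec (case_sum x w)) \<noteq> 0" for x w
    using R(3)[OF that] by simp
  ultimately show ?thesis unfolding generic_def by blast
qed

text \<open>Setting the window to 1 shows that the map from \<open>(x, w)\<close> to its products is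
  onto.\<close>

lemma cgen_window:
  fixes s d N K W :: nat
  assumes "cgen {s..s + d} Q" "\<And>n. s \<le> n \<Longrightarrow> n \<le> s + d \<Longrightarrow> n < N \<and> n \<le> K \<and> K - n < W"
  shows "cgen (Inl ` {..<N} \<union> Inr ` {..<W}) (\<lambda>v. Q (\<lambda>n. v (Inl n) * v (Inr (K - n))))"
proof (rule cgen_pullback[where H = "\<lambda>_. 1" and ?u0.0 = "\<lambda>_. 0"])
  show "cgen {s..s + d} Q" by fact
  show "cpoly ((Inl ` {..<N} \<union> Inr ` {..<W}) \<times> UNIV) (\<lambda>v. cvec v (Inl b) * cvec v (Inr (K - b)))"
    if "b \<in> {s..s + d}" for b
    using that assms(2)[of b] by (intro cpoly_mult cpoly_cvec) auto
  show "\<exists>v. \<forall>b\<in>{s..s + d}. v (Inl b) * v (Inr (K - b)) = y b" for y :: "nat \<Rightarrow> complex"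
    by (rule exI[of _ "case_sum y (\<lambda>_. 1)"]) simp
qed (auto intro: rpoly_const)

lemma cgen_two_windows:
  fixes s d N L W :: nat
  assumes "cgen (Inl ` {..L} \<union> Inr ` {s..s + d}) Q" and "1 \<le> L" "L < W" "3 * L < N"
    "s + d \<le> 3 * L" "3 * L < s + W"
  shows "cgen (Inl ` {..<N} \<union> Inr ` {..<W}) (\<lambda>v. Q (case_sum
     (\<lambda>n. v (Inl n) * v (Inr (L - n))) (\<lambda>n. v (Inl n) * v (Inr (3 * L - n)))))"
proof (rule cgen_pullback[where H = "\<lambda>y. \<Prod>n\<le>L. (cmod (y (Inl n)))\<^sup>2" and ?u0.0 = "\<lambda>_. 1"])
  let ?E = "Inl ` {..L} \<union> Inr ` {s..s + d} :: (nat + nat) set"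
  let ?C = "Inl ` {..<N} \<union> Inr ` {..<W} :: (nat + nat) set"
  show "cgen ?E Q" by fact
  show "cpoly (?C \<times> UNIV) (\<lambda>v. case_sum (\<lambda>n. cvec v (Inl n) * cvec v (Inr (L - n)))
      (\<lambda>n. cvec v (Inl n) * cvec v (Inr (3 * L - n))) b)" if "b \<in> ?E" for b
    using that assms(2-) by (auto intro!: cpoly_mult cpoly_cvec)
  show "rpoly (?E \<times> UNIV) (\<lambda>u. \<Prod>n\<le>L. (cmod (cvec u (Inl n)))\<^sup>2)"
    by (intro rpoly_prod rpoly_cmod2 cpoly_cvec) auto
  fix y :: "nat + nat \<Rightarrow> complex"
  assume "(\<Prod>n\<le>L. (cmod (y (Inl n)))\<^sup>2) \<noteq> 0"
  then have nz: "y (Inl n) \<noteq> 0" if "n \<le> L" for n using that by auto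
  \<comment> \<open>With \<open>w = 1\<close> below \<open>2 L\<close>, the first window prescribes
    \<open>x\<close> on \<open>{..L}\<close> and the second prescribes \<open>x\<close> above
    \<open>L\<close>. For \<open>n <= L\<close> the second window is met through the still free
    entry \<open>w (3 L - n)\<close>, whose index is at least \<open>2 L\<close>; this divides by
    \<open>y (Inl n)\<close>, whence \<open>H\<close>.\<close>
  show "\<exists>v. \<forall>b\<in>?E. case_sum (\<lambda>n. v (Inl n) * v (Inr (L - n)))
      (\<lambda>n. v (Inl n) * v (Inr (3 * L - n))) b = y b"
  proof (rule exI[of _ "case_sum (\<lambda>n. if n \<le> L then y (Inl n) else y (Inr n))
      (\<lambda>j. if j < 2 * L then 1 else y (Inr (3 * L - j)) / y (Inl (3 * L - j)))"], intro ballI)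
    fix b assume "b \<in> ?E"
    then show "case_sum (\<lambda>n. case_sum (\<lambda>n. if n \<le> L then y (Inl n) else y (Inr n))
      (\<lambda>j. if j < 2 * L then 1 else y (Inr (3 * L - j)) / y (Inl (3 * L - j))) (Inl n) *
        case_sum (\<lambda>n. if n \<le> L then y (Inl n) else y (Inr n))
      (\<lambda>j. if j < 2 * L then 1 else y (Inr (3 * L - j)) / y (Inl (3 * L - j))) (Inr (L - n)))
      (\<lambda>n. case_sum (\<lambda>n. if n \<le> L then y (Inl n) else y (Inr n))
      (\<lambda>j. if j < 2 * L then 1 else y (Inr (3 * L - j)) / y (Inl (3 * L - j))) (Inl n) *
        case_sum (\<lambda>n. if n \<le> L then y (Inl n) else y (Inr n))
      (\<lambda>j. if j < 2 * L then 1 else y (Inr (3 * L - j)) / y (Inl (3 * L - j))) (Inr (3 * L - n))) b = y b"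
      using assms(2-) nz by auto
  qed
qed simp

text \<open>The flip is allowed its own starting power \<open>s'\<close>, since the first entries of
  a competitor's column may vanish.\<close>

definition flip_free ::
    "nat \<Rightarrow> nat \<Rightarrow> (nat \<Rightarrow> complex) \<Rightarrow> nat \<Rightarrow> nat \<Rightarrow> nat \<Rightarrow> bool" where
  "flip_free s d y n e s' \<longleftrightarrow> (\<forall>a b. degree a \<le> d - e \<and> degree b = e \<and> coeff b 0 = 1 \<and>
      (\<forall>k\<le>d. y (s + k) = coeff (a * b) k) \<longrightarrow>
      cmod (coeff (monom 1 s * (a * b)) n) \<noteq> cmod (coeff (monom 1 s' * (a * crev b)) n))"

definition flip_free_pair ::
    "nat \<Rightarrow> nat \<Rightarrow> nat \<Rightarrow> (nat + nat \<Rightarrow> complex) \<Rightarrow> nat \<Rightarrow> nat \<Rightarrow> nat \<Rightarrow> nat \<Rightarrow> bool" where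
  "flip_free_pair d s d' y n e e' s' \<longleftrightarrow> (\<forall>a b a' b'.
      degree a \<le> d - e \<and> degree b = e \<and> coeff b 0 = 1 \<and>
      degree a' \<le> d' - e' \<and> degree b' = e' \<and> coeff b' 0 = 1 \<and>
      (\<forall>k\<le>d. y (Inl k) = coeff (a * b) k) \<and> (\<forall>k\<le>d'. y (Inr (s + k)) = coeff (a' * b') k) \<longrightarrow>
      cmod (coeff (monom 1 s' * (a' * crev b')) n) * cmod (coeff (a * b) 0)
       \<noteq> cmod (coeff (monom 1 s * (a' * b')) n) * cmod (coeff (a * crev b) 0))"

text \<open>In the \<open>K\<close>-th product \<open>n \<mapsto> x n * w (K - n)\<close> the support is
  \<open>{win_lo W K..win_lo W K + win_len N W K}\<close>.\<close>

definition win_lo :: "nat \<Rightarrow> nat \<Rightarrow> nat" where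
  "win_lo W K = K + 1 - W"

definition win_len :: "nat \<Rightarrow> nat \<Rightarrow> nat \<Rightarrow> nat" where
  "win_len N W K = min K (N - 1) - win_lo W K"

definition wprod :: "(nat \<Rightarrow> complex) \<Rightarrow> (nat \<Rightarrow> complex) \<Rightarrow> nat \<Rightarrow> nat \<Rightarrow> complex" where
  "wprod x w K n = x n * w (K - n)"

text \<open>The positions of the \<open>K\<close>-th product that involve an entry which is still unknown when
  all entries of signal and window up to index \<open>K - L\<close> are known.\<close>

definition unknown :: "nat \<Rightarrow> nat \<Rightarrow> nat \<Rightarrow> nat \<Rightarrow> nat set" where
  "unknown N W L K = (if K < W + L then {..<L} else {}) \<union> {n. K < n + L \<and> n \<le> K \<and> n < N}"

text \<open>After nonvanishing, the clauses serve in turn: column 2, where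
  \<open>(0, win_lo)\<close> is no flip and \<open>(win_len, 0)\<close> the full reversal; column 1
  compared with column 3; flips in later columns, detected at the known positions \<open>K0\<close>
  and \<open>K0 - 1\<close>; and sparse differences for long windows. The bound
  \<open>K0 + 2 <= N\<close> means that some signal entry is still unknown.\<close>

definition good :: "nat \<Rightarrow> nat \<Rightarrow> nat \<Rightarrow> (nat \<Rightarrow> complex) \<Rightarrow> (nat \<Rightarrow> complex) \<Rightarrow> bool" where
  "good N W L x w \<longleftrightarrow>
    (\<forall>n<N. x n \<noteq> 0) \<and> (\<forall>n<W. w n \<noteq> 0) \<and>
    (\<forall>e s'. e \<le> win_len N W (2 * L) \<and> s' \<le> win_lo W (2 * L) \<and> (e, s') \<noteq> (0, win_lo W (2 * L)) \<and>
       (e, s') \<noteq> (win_len N W (2 * L), 0) \<longrightarrow>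
       flip_free (win_lo W (2 * L)) (win_len N W (2 * L)) (wprod x w (2 * L)) L e s') \<and>
    (\<forall>e e' s'. 1 \<le> e \<and> e \<le> L \<and> e' \<le> win_len N W (3 * L) \<and> s' \<le> 3 * L \<longrightarrow>
       flip_free_pair L (win_lo W (3 * L)) (win_len N W (3 * L))
         (case_sum (wprod x w L) (wprod x w (3 * L))) (2 * L) e e' s') \<and>
    (\<forall>K0 e s'. 2 * L \<le> K0 \<and> K0 + 2 \<le> N \<and> e \<le> win_len N W (K0 + L) \<and> s' \<le> K0 + L \<and>
       (e, s') \<noteq> (0, win_lo W (K0 + L)) \<longrightarrow>
       (\<exists>n\<in>{K0, K0 - 1}.
         flip_free (win_lo W (K0 + L)) (win_len N W (K0 + L)) (wprod x w (K0 + L)) n e s')) \<and>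
    (4 * L < W \<longrightarrow> (\<forall>K0 D. 3 * L \<le> K0 \<and> K0 + 2 \<le> N \<and>
       (\<forall>k<4 * card (unknown N W L (K0 + L)).
          cmod (expsum N {win_lo W (K0 + L)..win_lo W (K0 + L) + win_len N W (K0 + L)} (wprod x w (K0 + L)) k
              + expsum N (unknown N W L (K0 + L)) D k)
        = cmod (expsum N {win_lo W (K0 + L)..win_lo W (K0 + L) + win_len N W (K0 + L)} (wprod x w (K0 + L)) k))
       \<longrightarrow> (\<forall>j\<in>unknown N W L (K0 + L). D j = 0)))"

text \<open>Moving a unit from \<open>\<alpha>\<close> to \<open>\<beta>\<close> keeps
  \<open>s + \<alpha> + \<beta>\<close> but changes \<open>s' + \<alpha> + (e - \<beta>)\<close> by
  2, so two splittings of \<open>L - s\<close> cannot both agree. If \<open>e = 0\<close> or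
  \<open>e = d\<close> there is one splitting, and it forces \<open>s' = s\<close> or
  \<open>s' = 0\<close>, the exempted pairs. For \<open>L = s\<close> the points
  \<open>(0, 0)\<close> and \<open>(1, 1)\<close> decide.\<close>

lemma flip_positions_middle:
  fixes d L e s s' :: nat
  assumes "1 \<le> L" "L \<le> d" "d \<le> 2 * L" "s = 2 * L - d" "e \<le> d" "s' \<le> s"
    "(e, s') \<noteq> (0, s)" "(e, s') \<noteq> (d, 0)"
  shows "\<exists>\<alpha> \<beta>. \<alpha> \<le> d - e \<and> \<beta> \<le> e \<and> (s + \<alpha> + \<beta> = L) \<noteq> (s' + \<alpha> + (e - \<beta>) = L)"
proof (rule ccontr)
  assume "\<not> ?thesis"
  then have *: "s + \<alpha> + \<beta> = L \<longleftrightarrow> s' + \<alpha> + (e - \<beta>) = L" if "\<alpha> \<le> d - e" "\<beta> \<le> e" for \<alpha> \<beta>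
    using that by blast
  consider "e = 0" | "e = d" "0 < e" | "0 < e" "e < d" using assms by linarith
  then show False
  proof cases
    case 1
    then show False using *[of "L - s" 0] assms by auto
  next
    case 2
    then show False using *[of 0 "L - s"] assms by auto
  next
    case 3
    \<comment> \<open>The least \<open>\<beta>\<close> for which
      \<open>\<alpha> = L - s - \<beta>\<close> fits into \<open>d - e\<close>.\<close>
    define lo where "lo = L - s - (d - e)"
    have lo: "lo \<le> e" "lo \<le> L - s" "L - s - lo \<le> d - e" using assms 3 by (auto simp: lo_def)
    show False
    proof (cases "L = s")
      case True
      have "1 \<le> d - e" "1 \<le> e" using 3 by auto
      from *[OF this] show False using *[of 0 0] True 3 by auto
    next
      case False
      have "Suc lo \<le> e" "Suc lo \<le> L - s" using assms 3 False by (auto simp: lo_def)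
      moreover have "L - s - Suc lo \<le> d - e" using lo by linarith
      moreover have "s + (L - s - lo) + lo = L" "s + (L - s - Suc lo) + Suc lo = L"
        using lo \<open>Suc lo \<le> L - s\<close> by linarith+
      ultimately have "s' + (L - s - lo) + (e - lo) = L" "s' + (L - s - Suc lo) + (e - Suc lo) = L"
        using *[of "L - s - lo" lo] *[of "L - s - Suc lo" "Suc lo"] lo by blast+
      then show False using \<open>Suc lo \<le> e\<close> \<open>Suc lo \<le> L - s\<close> by linarith
    qed
  qed
qed

text \<open>One position is not enough: a full reversal with \<open>s + s' + d = 2 n0\<close> leaves
  position \<open>n0\<close> fixed. It cannot fix \<open>n0 - 1\<close> as well.\<close>

lemma flip_positions_top:
  fixes d n0 e s s' :: nat
  assumes "1 \<le> n0" "s \<le> n0" "n0 < s + d" "e \<le> d" "(e, s') \<noteq> (0, s)"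
  shows "\<exists>n\<in>{n0, n0 - 1}. \<exists>\<alpha> \<beta>. \<alpha> \<le> d - e \<and> \<beta> \<le> e \<and> (s + \<alpha> + \<beta> = n) \<noteq> (s' + \<alpha> + (e - \<beta>) = n)"
proof (rule ccontr)
  assume "\<not> ?thesis"
  then have *: "s + \<alpha> + \<beta> = n \<longleftrightarrow> s' + \<alpha> + (e - \<beta>) = n"
    if "\<alpha> \<le> d - e" "\<beta> \<le> e" "n = n0 \<or> n = n0 - 1" for \<alpha> \<beta> n
    using that by blast
  define lo where "lo = n0 - s - (d - e)"
  have lo: "lo \<le> e" "lo \<le> n0 - s" "n0 - s - lo \<le> d - e" using assms by (auto simp: lo_def)
  consider "e = 0" | "e = d" "0 < e" "n0 = s" | "e = d" "0 < e" "s < n0"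
    | "0 < e" "e < d" "n0 = s" | "0 < e" "e < d" "s < n0"
    using assms by linarith
  then show False
  proof cases
    case 1
    have "n0 - s \<le> d - e" using assms 1 by simp
    then show False using *[of "n0 - s" 0 n0] assms 1 by auto
  next
    case 2
    then show False using *[of 0 0 n0] *[of 0 1 "n0 - 1"] assms by auto
  next
    case 3
    have "n0 - s \<le> e" "n0 - s - 1 \<le> e" using assms 3 by auto
    then show False using *[of 0 "n0 - s" n0] *[of 0 "n0 - s - 1" "n0 - 1"] assms 3 by auto
  next
    case 4
    have "1 \<le> d - e" "1 \<le> e" using 4 by auto
    from *[OF this, of n0] show False using *[of 0 0 n0] assms 4 by auto
  next
    case 5
    have "Suc lo \<le> e" "Suc lo \<le> n0 - s" using assms 5 by (auto simp: lo_def)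
    moreover have "n0 - s - Suc lo \<le> d - e" using lo by linarith
    moreover have "s + (n0 - s - lo) + lo = n0" "s + (n0 - s - Suc lo) + Suc lo = n0"
      using lo \<open>Suc lo \<le> n0 - s\<close> by linarith+
    ultimately have "s' + (n0 - s - lo) + (e - lo) = n0" "s' + (n0 - s - Suc lo) + (e - Suc lo) = n0"
      using *[of "n0 - s - lo" lo n0] *[of "n0 - s - Suc lo" "Suc lo" n0] lo by blast+
    then show False using \<open>Suc lo \<le> e\<close> \<open>Suc lo \<le> n0 - s\<close> by linarith
  qed
qed

lemma cgen_flip_free:
  assumes "e \<le> d" "\<alpha> \<le> d - e" "\<beta> \<le> e" "(s + \<alpha> + \<beta> = n) \<noteq> (s' + \<alpha> + (e - \<beta>) = n)"
  shows "cgen {s..s + d} (\<lambda>y. flip_free s d y n e s')"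
  using cgen_no_flip[OF assms] by (simp add: flip_free_def)

lemma cgen_all_imp:
  assumes "finite {k. P k}" "\<And>k. P k \<Longrightarrow> cgen C (Q k)"
  shows "cgen C (\<lambda>v. \<forall>k. P k \<longrightarrow> Q k v)"
  using cgen_ball[of "{k. P k}" C Q] assms by simp

lemma cgen_good:
  assumes L: "1 \<le> L" and W: "L < W" and N: "W \<le> N" "10 * L - 2 \<le> N" "6 * L + 2 \<le> N"
  shows "cgen (Inl ` {..<N} \<union> Inr ` {..<W})
    (\<lambda>v. good N W L (\<lambda>n. v (Inl n)) (\<lambda>n. v (Inr n)))"
proof -
  let ?C = "Inl ` {..<N} \<union> Inr ` {..<W} :: (nat + nat) set"
  have nonzero: "cgen ?C (\<lambda>v. v c \<noteq> 0)" if "c \<in> ?C" for c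
  proof -
    have "gen (?C \<times> UNIV) (\<lambda>v. (cmod (cvec v c))\<^sup>2 \<noteq> 0)"
      by (rule gen_nonzero[where v = "rvec (\<lambda>_. 1)"]) (auto intro: rpoly_cmod2 cpoly_cvec[OF that])
    then show ?thesis unfolding cgen_def by (rule gen_mono) auto
  qed
  have 1: "cgen ?C (\<lambda>v. \<forall>n. n < N \<longrightarrow> v (Inl n) \<noteq> 0)"
    "cgen ?C (\<lambda>v. \<forall>n. n < W \<longrightarrow> v (Inr n) \<noteq> 0)"
    by (intro cgen_all_imp nonzero; simp)+
  have win: "n < N \<and> n \<le> K \<and> K - n < W"
    if "win_lo W K \<le> n" "n \<le> win_lo W K + win_len N W K" "K + 1 < N + W" for n K
    using that W N by (auto simp: win_lo_def win_len_def)
  have 2: "cgen ?C (\<lambda>v. \<forall>p. (case p of (e, s') \<Rightarrow> e \<le> win_len N W (2 * L) \<and> s' \<le> win_lo W (2 * L) \<and>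
       (e, s') \<noteq> (0, win_lo W (2 * L)) \<and> (e, s') \<noteq> (win_len N W (2 * L), 0)) \<longrightarrow>
       (case p of (e, s') \<Rightarrow> flip_free (win_lo W (2 * L)) (win_len N W (2 * L))
          (wprod (\<lambda>n. v (Inl n)) (\<lambda>n. v (Inr n)) (2 * L)) L e s'))"
  proof (intro cgen_all_imp)
    show "finite {p. case p of (e, s') \<Rightarrow> e \<le> win_len N W (2 * L) \<and> s' \<le> win_lo W (2 * L) \<and>
       (e, s') \<noteq> (0, win_lo W (2 * L)) \<and> (e, s') \<noteq> (win_len N W (2 * L), 0)}"
      by (rule finite_subset[of _ "{..win_len N W (2 * L)} \<times> {..win_lo W (2 * L)}"]) auto
    fix p :: "nat \<times> nat"
    assume p: "case p of (e, s') \<Rightarrow> e \<le> win_len N W (2 * L) \<and> s' \<le> win_lo W (2 * L) \<and>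
       (e, s') \<noteq> (0, win_lo W (2 * L)) \<and> (e, s') \<noteq> (win_len N W (2 * L), 0)"
    obtain e s' where [simp]: "p = (e, s')" by (cases p)
    have "L \<le> win_len N W (2 * L)" "win_len N W (2 * L) \<le> 2 * L"
      "win_lo W (2 * L) = 2 * L - win_len N W (2 * L)"
      using L W N by (auto simp: win_len_def win_lo_def)
    moreover have "e \<le> win_len N W (2 * L)" "s' \<le> win_lo W (2 * L)"
      "(e, s') \<noteq> (0, win_lo W (2 * L))" "(e, s') \<noteq> (win_len N W (2 * L), 0)"
      using p by simp_all
    ultimately obtain \<alpha> \<beta>
      where ab: "\<alpha> \<le> win_len N W (2 * L) - e" "\<beta> \<le> e"
        "(win_lo W (2 * L) + \<alpha> + \<beta> = L) \<noteq> (s' + \<alpha> + (e - \<beta>) = L)"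
      using flip_positions_middle[OF L, of "win_len N W (2 * L)" "win_lo W (2 * L)" e s'] by blast
    show "cgen ?C (\<lambda>v. case p of (e, s') \<Rightarrow> flip_free (win_lo W (2 * L)) (win_len N W (2 * L))
          (wprod (\<lambda>n. v (Inl n)) (\<lambda>n. v (Inr n)) (2 * L)) L e s')"
      unfolding wprod_def prod.case \<open>p = (e, s')\<close> using p ab N L
      by (intro cgen_window[OF cgen_flip_free, of e _ \<alpha> \<beta>] win) auto
  qed
  have 3: "cgen ?C (\<lambda>v. \<forall>p. (case p of (e, e', s') \<Rightarrow> 1 \<le> e \<and> e \<le> L \<and> e' \<le> win_len N W (3 * L) \<and> s' \<le> 3 * L) \<longrightarrow>
       (case p of (e, e', s') \<Rightarrow> flip_free_pair L (win_lo W (3 * L)) (win_len N W (3 * L))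
         (case_sum (wprod (\<lambda>n. v (Inl n)) (\<lambda>n. v (Inr n)) L)
           (wprod (\<lambda>n. v (Inl n)) (\<lambda>n. v (Inr n)) (3 * L))) (2 * L) e e' s'))"
  proof (intro cgen_all_imp)
    show "finite {p. case p of (e, e', s') \<Rightarrow> 1 \<le> e \<and> e \<le> L \<and> e' \<le> win_len N W (3 * L) \<and> s' \<le> 3 * L}"
      by (rule finite_subset[of _ "{..L} \<times> {..win_len N W (3 * L)} \<times> {..3 * L}"]) auto
    fix p :: "nat \<times> nat \<times> nat"
    assume p: "case p of (e, e', s') \<Rightarrow> 1 \<le> e \<and> e \<le> L \<and> e' \<le> win_len N W (3 * L) \<and> s' \<le> 3 * L"
    obtain e e' s' where [simp]: "p = (e, e', s')" by (cases p)
    show "cgen ?C (\<lambda>v. case p of (e, e', s') \<Rightarrow> flip_free_pair L (win_lo W (3 * L)) (win_len N W (3 * L))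
         (case_sum (wprod (\<lambda>n. v (Inl n)) (\<lambda>n. v (Inr n)) L)
           (wprod (\<lambda>n. v (Inl n)) (\<lambda>n. v (Inr n)) (3 * L))) (2 * L) e e' s')"
      unfolding wprod_def[abs_def] prod.case \<open>p = (e, e', s')\<close> flip_free_pair_def
      using p N L W
      by (intro cgen_two_windows[OF cgen_no_flip_pair]) (auto simp: win_lo_def win_len_def)
  qed
  have 4: "cgen ?C (\<lambda>v. \<forall>p. (case p of (K0, e, s') \<Rightarrow> 2 * L \<le> K0 \<and> K0 + 2 \<le> N \<and> e \<le> win_len N W (K0 + L) \<and>
       s' \<le> K0 + L \<and> (e, s') \<noteq> (0, win_lo W (K0 + L))) \<longrightarrow>
       (case p of (K0, e, s') \<Rightarrow> \<exists>n\<in>{K0, K0 - 1}.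
         flip_free (win_lo W (K0 + L)) (win_len N W (K0 + L))
           (wprod (\<lambda>n. v (Inl n)) (\<lambda>n. v (Inr n)) (K0 + L)) n e s'))"
  proof (intro cgen_all_imp)
    show "finite {p. case p of (K0, e, s') \<Rightarrow> 2 * L \<le> K0 \<and> K0 + 2 \<le> N \<and> e \<le> win_len N W (K0 + L) \<and>
       s' \<le> K0 + L \<and> (e, s') \<noteq> (0, win_lo W (K0 + L))}"
      by (rule finite_subset[of _ "{..N} \<times> {..N} \<times> {..N + L}"]) (auto simp: win_len_def)
    fix p :: "nat \<times> nat \<times> nat"
    assume p: "case p of (K0, e, s') \<Rightarrow> 2 * L \<le> K0 \<and> K0 + 2 \<le> N \<and> e \<le> win_len N W (K0 + L) \<and>
       s' \<le> K0 + L \<and> (e, s') \<noteq> (0, win_lo W (K0 + L))"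
    obtain K0 e s' where [simp]: "p = (K0, e, s')" by (cases p)
    have "2 * L \<le> K0" "K0 + 2 \<le> N" using p by simp_all
    then have "1 \<le> K0" "win_lo W (K0 + L) \<le> K0" "K0 < win_lo W (K0 + L) + win_len N W (K0 + L)"
      using L W N unfolding win_len_def win_lo_def by linarith+
    moreover have "e \<le> win_len N W (K0 + L)" "(e, s') \<noteq> (0, win_lo W (K0 + L))" using p by simp_all
    ultimately obtain n \<alpha> \<beta> where n: "n \<in> {K0, K0 - 1}"
      and ab: "\<alpha> \<le> win_len N W (K0 + L) - e" "\<beta> \<le> e"
        "(win_lo W (K0 + L) + \<alpha> + \<beta> = n) \<noteq> (s' + \<alpha> + (e - \<beta>) = n)"
      using flip_positions_top by metis
    have "cgen ?C (\<lambda>v. flip_free (win_lo W (K0 + L)) (win_len N W (K0 + L))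
           (wprod (\<lambda>n. v (Inl n)) (\<lambda>n. v (Inr n)) (K0 + L)) n e s')"
      unfolding wprod_def using p ab N L W
      by (intro cgen_window[OF cgen_flip_free, of e _ \<alpha> \<beta>] win) auto
    then show "cgen ?C (\<lambda>v. case p of (K0, e, s') \<Rightarrow> \<exists>n\<in>{K0, K0 - 1}.
         flip_free (win_lo W (K0 + L)) (win_len N W (K0 + L))
           (wprod (\<lambda>n. v (Inl n)) (\<lambda>n. v (Inr n)) (K0 + L)) n e s')"
      by (rule cgen_mono) (use n in auto)
  qed
  define U where "U K0 = unknown N W L (K0 + L)" for K0
  define I where "I K0 = {win_lo W (K0 + L)..win_lo W (K0 + L) + win_len N W (K0 + L)}" for K0
  have 5: "cgen ?C (\<lambda>v. 4 * L < W \<longrightarrow> (\<forall>K0. 3 * L \<le> K0 \<and> K0 + 2 \<le> N \<longrightarrow> (\<forall>D.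
       (\<forall>k<4 * card (U K0).
          cmod (expsum N (I K0) (wprod (\<lambda>n. v (Inl n)) (\<lambda>n. v (Inr n)) (K0 + L)) k + expsum N (U K0) D k)
        = cmod (expsum N (I K0) (wprod (\<lambda>n. v (Inl n)) (\<lambda>n. v (Inr n)) (K0 + L)) k))
       \<longrightarrow> (\<forall>j\<in>U K0. D j = 0))))"
  proof (intro cgen_imp cgen_all_imp)
    show "finite {K0. 3 * L \<le> K0 \<and> K0 + 2 \<le> N}"
      by (rule finite_subset[of _ "{..N}"]) auto
    fix K0 assume W4: "4 * L < W" and K0: "3 * L \<le> K0 \<and> K0 + 2 \<le> N"
    have sub: "U K0 \<subseteq> {..<N}" using N L by (auto simp: U_def unknown_def)
    \<comment> \<open>Once \<open>W <= K0\<close>, only the top \<open>L\<close> positions are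
      unknown. This sharper count is needed near the end of the signal, where \<open>win_len\<close>
      shrinks and may only be bounded by \<open>W - L\<close>.\<close>
    have "card (U K0) \<le> card ((if K0 < W then {..<L} else {}) \<union> {K0 + 1..<K0 + 1 + L})"
      by (intro card_mono) (auto simp: U_def unknown_def)
    also have "\<dots> \<le> (if K0 < W then L else 0) + L"
      by (rule order_trans[OF card_Un_le]) simp
    finally have card: "card (U K0) \<le> (if K0 < W then L else 0) + L" .
    have "2 * card (U K0) \<le> win_len N W (K0 + L)"
      using card K0 W4 N L by (auto simp: win_len_def win_lo_def split: if_splits)
    moreover have "4 * card (U K0) \<le> N" using card N L by (auto split: if_splits)
    moreover have "win_len N W (K0 + L) < N" using N L by (auto simp: win_len_def)
    ultimately show "cgen ?C (\<lambda>v. \<forall>D.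
       (\<forall>k<4 * card (U K0).
          cmod (expsum N (I K0) (wprod (\<lambda>n. v (Inl n)) (\<lambda>n. v (Inr n)) (K0 + L)) k + expsum N (U K0) D k)
        = cmod (expsum N (I K0) (wprod (\<lambda>n. v (Inl n)) (\<lambda>n. v (Inr n)) (K0 + L)) k))
       \<longrightarrow> (\<forall>j\<in>U K0. D j = 0))"
      unfolding wprod_def I_def using K0 W
      by (intro cgen_window[OF cgen_no_sparse_difference[OF sub]] win) auto
  qed
  note conds = cgen_conj[OF cgen_conj[OF 1] cgen_conj[OF 2 cgen_conj[OF 3 cgen_conj[OF 4 5]]]]
  show ?thesis
    by (rule cgen_mono[OF conds], simp add: good_def U_def I_def) blast
qed

lemma generic_good:
  assumes "1 \<le> L" "L < W" "W \<le> N" "10 * L - 2 \<le> N" "6 * L + 2 \<le> N"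
  shows "generic N W (good N W L)"
  using generic_from_cgen[OF cgen_good[OF assms]] by simp

section \<open>Uniqueness for good pairs\<close>

definition zext :: "nat \<Rightarrow> (nat \<Rightarrow> complex) \<Rightarrow> nat \<Rightarrow> complex" where
  "zext N x n = (if n < N then x n else 0)"

definition ppoly :: "(nat \<Rightarrow> complex) \<Rightarrow> (nat \<Rightarrow> complex) \<Rightarrow> nat \<Rightarrow> complex poly" where
  "ppoly p q K = (\<Sum>n\<le>K. monom (p n * q (K - n)) n)"

lemma coeff_ppoly: "coeff (ppoly p q K) n = (if n \<le> K then p n * q (K - n) else 0)"
  by (simp add: ppoly_def coeff_sum)

lemma poly_ppoly: "poly (ppoly p q K) z = (\<Sum>n\<le>K. p n * q (K - n) * z ^ n)"
  by (simp add: ppoly_def poly_sum poly_monom)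

lemma degree_ppoly: "degree (ppoly p q K) \<le> K"
  by (rule degree_le) (simp add: coeff_ppoly)

lemma stft_eq_ppoly:
  "stft N W L x w k m = poly (ppoly (zext N x) (zext W w) (m * L)) (fnode N ^ k)"
proof -
  have e: "exp (- 2 * pi * \<i> * of_nat k * of_nat n / of_nat N) = (fnode N ^ k) ^ n" for n
  proof -
    have "(fnode N ^ k) ^ n = cis (real (k * n) * (- 2 * pi / real N))"
      by (simp only: fnode_def Complex.DeMoivre of_nat_mult mult_ac)
    also have "\<dots> = exp (\<i> * of_real (real (k * n) * (- 2 * pi / real N)))"
      by (rule cis_conv_exp)
    also have "\<i> * of_real (real (k * n) * (- 2 * pi / real N))
        = - 2 * pi * \<i> * of_nat k * of_nat n / of_nat N"
      by (simp add: field_simps)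
    finally show ?thesis ..
  qed
  have "stft N W L x w k m
    = (\<Sum>n<N. if n \<le> m * L then x n * zext W w (m * L - n) * (fnode N ^ k) ^ n else 0)"
    unfolding stft_def e
  proof (intro sum.cong refl)
    fix n
    have "wext W w (int m * int L - int n) = (if n \<le> m * L then zext W w (m * L - n) else 0)"
    proof (cases "n \<le> m * L")
      case True
      define j where "j = m * L - n"
      have e: "int m * int L - int n = int j" using True by (simp add: j_def of_nat_diff)
      show ?thesis unfolding wext_def zext_def e j_def[symmetric] using True by simp
    next
      case False
      then have "int m * int L - int n < 0" by (simp flip: of_nat_mult)
      then show ?thesis using False by (simp add: wext_def)
    qed
    then show "x n * wext W w (int m * int L - int n) * (fnode N ^ k) ^ n
      = (if n \<le> m * L then x n * zext W w (m * L - n) * (fnode N ^ k) ^ n else 0)" by simp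
  qed
  also have "\<dots> = (\<Sum>n\<in>{..<N} \<inter> {..m * L}. x n * zext W w (m * L - n) * (fnode N ^ k) ^ n)"
    by (simp add: sum.inter_restrict)
  also have "\<dots> = (\<Sum>n\<le>m * L. zext N x n * zext W w (m * L - n) * (fnode N ^ k) ^ n)"
    by (intro sum.mono_neutral_cong_left) (auto simp: zext_def)
  finally show ?thesis by (simp add: poly_ppoly)
qed

lemma nonzero_poly_eq_monom_mult:
  fixes p :: "complex poly"
  assumes "p \<noteq> 0"
  shows "\<exists>s q. p = monom 1 s * q \<and> coeff q 0 \<noteq> 0"
  using assms
proof (induction p)
  case (pCons c p)
  show ?case
  proof (cases "c = 0")
    case True
    then obtain s q where "p = monom 1 s * q" "coeff q 0 \<noteq> 0" using pCons by auto
    then show ?thesis using True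
      by (intro exI[of _ "Suc s"] exI[of _ q]) (simp add: monom_Suc)
  next
    case False
    then show ?thesis by (intro exI[of _ 0] exI[of _ "pCons c p"]) (simp add: monom_0)
  qed
qed simp

lemma degree_monom_mult_eq:
  fixes q :: "complex poly"
  shows "q \<noteq> 0 \<Longrightarrow> degree (monom 1 s * q) = s + degree q"
  by (subst degree_mult_eq) (auto simp: degree_monom_eq)

text \<open>The competitor is first stripped of its own power of \<open>z\<close>, which is
  invisible on the circle.\<close>

lemma window_factorization:
  assumes eq: "\<And>z. cmod z = 1 \<Longrightarrow> cmod (poly Yp z) = cmod (poly (monom 1 s * Y) z)"
    and Y0: "coeff Y 0 \<noteq> 0"
  obtains a b c s' where "Y = a * b" "Yp = smult c (monom 1 s' * (a * crev b))" "cmod c = 1"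
    "coeff b 0 = 1" "degree a = degree Y - degree b" "degree b \<le> degree Y"
    "s' + degree Y = degree Yp"
proof -
  have circ: "cmod (poly (monom 1 s * q) z) = cmod (poly q z)" if "cmod z = 1" for s z and q :: "complex poly"
    using that by (simp add: poly_monom norm_mult norm_power)
  have "Yp \<noteq> 0"
  proof
    assume "Yp = 0"
    then have "poly Y z = 0" if "cmod z = 1" for z
      using eq[OF that] circ[OF that, of s Y] by (metis norm_eq_zero poly_0)
    then have "Y = 0" using poly_eq_on_circle[of Y 0] by simp
    then show False using Y0 by simp
  qed
  then obtain s' Y' where Y': "Yp = monom 1 s' * Y'" "coeff Y' 0 \<noteq> 0"
    using nonzero_poly_eq_monom_mult by blast
  have eq': "cmod (poly Y z) = cmod (poly Y' z)" if "cmod z = 1" for z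
    using eq[OF that] circ[OF that] by (simp add: Y')
  obtain a b c where abc: "Y = a * b" "Y' = smult c (a * crev b)" "cmod c = 1" "coeff b 0 = 1"
    using circle_modulus_factorization[OF eq' Y0 Y'(2)] by blast
  have "a \<noteq> 0" "b \<noteq> 0" using Y0 abc(1) by auto
  then have deg: "degree Y = degree a + degree b" unfolding abc(1) by (rule degree_mult_eq)
  have "degree Yp = s' + degree Y'"
    unfolding Y'(1) using Y'(2) by (intro degree_monom_mult_eq) auto
  then have "s' + degree Y = degree Yp"
    using degree_eq_if_circle_modulus_eq[OF eq' Y0 Y'(2)] by simp
  then show ?thesis
    using that[of a b c s'] abc Y' deg by simp
qed

lemma degree_0_coeff_1: "degree b = 0 \<Longrightarrow> coeff b 0 = 1 \<Longrightarrow> b = 1"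
  by (metis degree_eq_zeroE coeff_pCons_0 one_pCons)

lemma crev_1 [simp]: "crev 1 = 1"
  using crev_const[of 1] by (simp add: one_pCons)

section \<open>What the samples say about an arbitrary competitor\<close>

locale blind =
  fixes N W L :: nat and x w :: "nat \<Rightarrow> complex"
  assumes L1: "1 \<le> L" and LW: "L < W" and WN: "W \<le> N"
    and Q: "\<forall>m < numM N W L. Qf L m < N"
begin

lemma index_less_numM:
  assumes "m * L + 1 < N + W"
  shows "m < numM N W L"
proof -
  have "real (m * L) < real (N + W - 1)" using assms by linarith
  then have "real m < real (N + W - 1) / real L" using L1 by (simp add: field_simps)
  then have "int m < \<lceil>real (N + W - 1) / real L\<rceil>" by (simp only: less_ceiling_iff of_int_of_nat_eq)
  then show ?thesis by (simp only: numM_def zless_nat_eq_int_zless)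
qed

lemma next_index_less_numM:
  assumes "K0 + L = m * L" "K0 + 2 \<le> N"
  shows "m < numM N W L"
  using assms LW by (intro index_less_numM) simp

text \<open>A bootstrap: each existing column forces \<open>N\<close> to exceed its
  \<open>Qf\<close>, which in turn guarantees that a later column exists. At \<open>m = 5\<close>
  the cap \<open>10 L - 3\<close> is in force.\<close>

lemma N_large: "6 * L + 2 \<le> N" "10 * L - 2 \<le> N"
proof -
  have "Qf L 1 < N" using Q index_less_numM[of 1] LW WN by auto
  then have 1: "2 * L + 1 < N" using L1 by (auto simp: Qf_def min_def split: if_splits)
  then have "Qf L 2 < N" using Q index_less_numM[of 2] LW by auto
  then have 2: "4 * L + 1 < N" using L1 by (auto simp: Qf_def min_def split: if_splits)
  then have "Qf L 3 < N" using Q index_less_numM[of 3] LW by auto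
  then show 3: "6 * L + 2 \<le> N" using L1 by (auto simp: Qf_def min_def split: if_splits)
  then have "Qf L 5 < N" using Q index_less_numM[of 5] LW by auto
  then show "10 * L - 2 \<le> N" using L1 by (auto simp: Qf_def min_def split: if_splits)
qed

abbreviation "X \<equiv> zext N x"
abbreviation "V \<equiv> zext W w"
abbreviation "lo \<equiv> win_lo W"
abbreviation "len \<equiv> win_len N W"

text \<open>Stated for arbitrary \<open>p\<close>, \<open>q\<close>, so that it also applies to the
  exchanged conjugate pair and to the competitor after gauge fixing.\<close>

definition data :: "(nat \<Rightarrow> complex) \<Rightarrow> (nat \<Rightarrow> complex) \<Rightarrow> bool" where
  "data p q \<longleftrightarrow> (\<forall>m<numM N W L. \<forall>k\<le>Qf L m.
     cmod (poly (ppoly p q (m * L)) (fnode N ^ k)) = cmod (poly (ppoly X V (m * L)) (fnode N ^ k)))"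

definition wpoly :: "nat \<Rightarrow> complex poly" where
  "wpoly K = (\<Sum>k\<le>len K. monom (wprod x w K (lo K + k)) k)"

lemma coeff_wpoly: "coeff (wpoly K) k = (if k \<le> len K then wprod x w K (lo K + k) else 0)"
  by (simp add: wpoly_def coeff_sum)

lemma window_iff:
  assumes "K + 1 < N + W"
  shows "lo K \<le> n \<and> n \<le> lo K + len K \<longleftrightarrow> n < N \<and> n \<le> K \<and> K - n < W"
proof
  assume "lo K \<le> n \<and> n \<le> lo K + len K"
  then show "n < N \<and> n \<le> K \<and> K - n < W"
    using assms WN LW unfolding win_lo_def win_len_def by linarith
next
  assume "n < N \<and> n \<le> K \<and> K - n < W"
  then show "lo K \<le> n \<and> n \<le> lo K + len K"
    unfolding win_lo_def win_len_def by linarith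
qed

lemma ppoly_eq_wpoly:
  assumes "K + 1 < N + W"
  shows "ppoly X V K = monom 1 (lo K) * wpoly K"
proof (rule poly_eqI)
  fix n
  show "coeff (ppoly X V K) n = coeff (monom 1 (lo K) * wpoly K) n"
  proof (cases "lo K \<le> n \<and> n \<le> lo K + len K")
    case True
    then have "n < N \<and> n \<le> K \<and> K - n < W" unfolding window_iff[OF assms] .
    moreover have "n - lo K \<le> len K" using True by linarith
    ultimately show ?thesis using True
      by (simp add: coeff_ppoly coeff_monom_mult coeff_wpoly zext_def wprod_def)
  next
    case False
    then have "\<not> n < N \<or> \<not> n \<le> K \<or> \<not> K - n < W" using window_iff[OF assms] by blast
    then have "coeff (ppoly X V K) n = 0" by (auto simp: coeff_ppoly zext_def)
    moreover have "n < lo K \<or> \<not> n - lo K \<le> len K" using False by linarith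
    then have "coeff (monom 1 (lo K) * wpoly K) n = 0" by (auto simp: coeff_monom_mult coeff_wpoly)
    ultimately show ?thesis by simp
  qed
qed

text \<open>For \<open>m <= 3\<close> the cap \<open>10 L - 3\<close> is at least
  \<open>2 m L\<close>, so all \<open>2 m L + 1\<close> samples required by degree
  \<open>m L\<close> are present.\<close>

lemma data_circle_small:
  assumes "data p q" "m \<le> 3" "cmod z = 1"
  shows "cmod (poly (ppoly p q (m * L)) z) = cmod (poly (ppoly X V (m * L)) z)"
proof -
  have "m * L \<le> 3 * L" using assms by (intro mult_le_mono1)
  then have m: "m < numM N W L" using N_large LW \<open>m * L \<le> 3 * L\<close> by (intro index_less_numM) linarith
  have le: "2 * (m * L) \<le> Qf L m" using \<open>m * L \<le> 3 * L\<close> L1 unfolding Qf_def by linarith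
  show ?thesis
  proof (rule circle_modulus_eq_from_samples[where d = "m * L" and N = N])
    show "2 * (m * L) < N" using le Q m by (meson le_less_trans)
    show "cmod (poly (ppoly p q (m * L)) (fnode N ^ k)) = cmod (poly (ppoly X V (m * L)) (fnode N ^ k))"
      if "k \<le> 2 * (m * L)" for k
      using assms(1) m le that unfolding data_def by (meson order_trans)
  qed (auto intro: degree_ppoly assms)
qed

text \<open>Up to a power of \<open>z\<close> both columns have degree at most \<open>W - 1\<close>,
  and \<open>2 (W - 1) <= 8 L - 2\<close> lies below \<open>Qf L m\<close>. The short factor is
  \<open>q\<close> for the original competitor and \<open>p\<close> after the exchange of signal and
  window.\<close>

lemma data_circle_window:
  assumes "data p q" "4 \<le> m" "m < numM N W L" "W \<le> 4 * L" "m * L + 1 < N + W"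
    and supp: "(\<forall>n\<ge>W. q n = 0) \<or> (\<forall>n\<ge>W. p n = 0)" and z: "cmod z = 1"
  shows "cmod (poly (ppoly p q (m * L)) z) = cmod (poly (ppoly X V (m * L)) z)"
proof -
  let ?K = "m * L"
  have K: "4 * L \<le> ?K" using assms by (intro mult_le_mono1)
  have "\<exists>s Y. ppoly p q ?K = monom 1 s * Y \<and> degree Y \<le> W - 1"
    using supp
  proof
    assume q: "\<forall>n\<ge>W. q n = 0"
    define S where "S = ?K + 1 - W"
    have S: "S + W = ?K + 1" unfolding S_def using K assms(4) by linarith
    define Y where "Y = (\<Sum>k\<le>W - 1. monom (p (S + k) * q (W - 1 - k)) k)"
    have "ppoly p q ?K = monom 1 S * Y"
    proof (rule poly_eqI)
      fix n
      show "coeff (ppoly p q ?K) n = coeff (monom 1 S * Y) n"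
      proof (cases "S \<le> n \<and> n \<le> ?K")
        case True
        define j where "j = n - S"
        have "S + j = n" "j \<le> W - 1" "W - 1 - j = ?K - n"
          using True S by (simp_all only: j_def) linarith+
        then show ?thesis using True
          by (simp add: coeff_ppoly coeff_monom_mult Y_def coeff_sum flip: j_def)
      next
        case False
        then consider "n < S" | "?K < n" by linarith
        then show ?thesis
        proof cases
          case 1
          then have "W \<le> ?K - n" using S by linarith
          then show ?thesis using q 1 by (simp add: coeff_ppoly coeff_monom_mult)
        next
          case 2
          then have "\<not> n - S \<le> W - 1" using S LW by linarith
          then show ?thesis using 2 by (simp add: coeff_ppoly coeff_monom_mult Y_def coeff_sum)
        qed
      qed
    qed
    moreover have "degree Y \<le> W - 1" by (rule degree_le) (simp add: Y_def coeff_sum)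
    ultimately show ?thesis by blast
  next
    assume "\<forall>n\<ge>W. p n = 0"
    then have "degree (ppoly p q ?K) \<le> W - 1"
      using LW by (intro degree_le) (auto simp: coeff_ppoly)
    then show ?thesis by (intro exI[of _ 0] exI[of _ "ppoly p q ?K"]) (simp add: monom_0)
  qed
  then obtain s Y where Y: "ppoly p q ?K = monom 1 s * Y" "degree Y \<le> W - 1" by blast
  have circ: "cmod (poly (monom 1 s * q) z) = cmod (poly q z)" if "cmod z = 1" for s z and q :: "complex poly"
    using that by (simp add: poly_monom norm_mult norm_power)
  have le: "2 * (W - 1) \<le> Qf L m" using K assms(4) LW L1 unfolding Qf_def by linarith
  have "cmod (poly Y z) = cmod (poly (wpoly ?K) z)"
  proof (rule circle_modulus_eq_from_samples[where d = "W - 1" and N = N])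
    show "degree (wpoly ?K) \<le> W - 1"
      using WN by (intro degree_le) (auto simp: coeff_wpoly win_len_def win_lo_def)
    show "2 * (W - 1) < N" using le Q assms(3) by (meson le_less_trans)
    show "cmod (poly Y (fnode N ^ k)) = cmod (poly (wpoly ?K) (fnode N ^ k))"
      if "k \<le> 2 * (W - 1)" for k
    proof -
      have "cmod (poly (ppoly p q ?K) (fnode N ^ k)) = cmod (poly (ppoly X V ?K) (fnode N ^ k))"
        using assms(1,3) le that unfolding data_def by (meson order_trans)
      moreover have "cmod (fnode N ^ k) = 1" by (simp add: norm_power)
      ultimately show ?thesis
        unfolding Y(1) ppoly_eq_wpoly[OF assms(5)] by (simp only: circ)
    qed
  qed (use Y z in auto)
  then show ?thesis unfolding Y(1) ppoly_eq_wpoly[OF assms(5)] by (simp only: circ z)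
qed

lemma data_origin:
  assumes "data p q"
  shows "cmod (p 0 * q 0) = cmod (X 0 * V 0)"
proof -
  have "0 < numM N W L" by (rule index_less_numM) (use LW WN L1 in simp)
  then have "cmod (poly (ppoly p q (0 * L)) (fnode N ^ 0)) = cmod (poly (ppoly X V (0 * L)) (fnode N ^ 0))"
    using assms unfolding data_def by blast
  then show ?thesis by (simp add: poly_ppoly)
qed

end

section \<open>Recovering a good pair column by column\<close>

locale good_blind = blind +
  assumes good: "good N W L x w"
begin

lemma X_nonzero: "n < N \<Longrightarrow> X n \<noteq> 0" and V_nonzero: "n < W \<Longrightarrow> V n \<noteq> 0"
  using good by (auto simp: good_def zext_def)

lemma wpoly_ends:
  assumes "K + 1 < N + W"
  shows "coeff (wpoly K) 0 \<noteq> 0" "degree (wpoly K) = len K"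
proof -
  have nz: "coeff (wpoly K) k \<noteq> 0" if "k \<le> len K" for k
  proof -
    have "lo K + k < N \<and> lo K + k \<le> K \<and> K - (lo K + k) < W"
      using window_iff[OF assms, of "lo K + k"] that by simp
    then show ?thesis using good that by (simp add: coeff_wpoly wprod_def good_def)
  qed
  then show "coeff (wpoly K) 0 \<noteq> 0" by simp
  have "degree (wpoly K) \<le> len K" by (rule degree_le) (simp add: coeff_wpoly)
  moreover have "len K \<le> degree (wpoly K)" using nz by (intro le_degree) simp
  ultimately show "degree (wpoly K) = len K" by simp
qed

lemma factorization:
  assumes "K + 1 < N + W"
    and "\<And>z. cmod z = 1 \<Longrightarrow> cmod (poly (ppoly p q K) z) = cmod (poly (ppoly X V K) z)"
  obtains a b c s' where "wpoly K = a * b" "ppoly X V K = monom 1 (lo K) * (a * b)"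
    "ppoly p q K = smult c (monom 1 s' * (a * crev b))"
    "cmod c = 1" "coeff b 0 = 1" "degree a = len K - degree b" "degree b \<le> len K" "s' + len K \<le> K"
proof -
  obtain a b c s' where "wpoly K = a * b" "ppoly p q K = smult c (monom 1 s' * (a * crev b))" "cmod c = 1"
    "coeff b 0 = 1" "degree a = len K - degree b" "degree b \<le> len K"
    "s' + len K = degree (ppoly p q K)"
    using window_factorization[of "ppoly p q K" "lo K" "wpoly K"] assms(2)
      wpoly_ends[OF assms(1)] ppoly_eq_wpoly[OF assms(1)] by metis
  then show ?thesis using that degree_ppoly[of p q K] ppoly_eq_wpoly[OF assms(1)] by metis
qed

lemma first_factorization:
  assumes "data p q"
  obtains a b c where "wpoly L = a * b" "ppoly X V L = a * b" "ppoly p q L = smult c (a * crev b)"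
    "cmod c = 1" "coeff b 0 = 1" "degree a = L - degree b" "degree b \<le> L"
proof -
  have lo: "lo L = 0" "len L = L" using LW WN by (auto simp: win_lo_def win_len_def)
  obtain a b c s' where *: "wpoly L = a * b" "ppoly X V L = monom 1 (lo L) * (a * b)"
    "ppoly p q L = smult c (monom 1 s' * (a * crev b))"
    "cmod c = 1" "coeff b 0 = 1" "degree a = len L - degree b" "degree b \<le> len L" "s' + len L \<le> L"
  proof (rule factorization[of L p q])
    show "L + 1 < N + W" using WN LW by simp
    show "cmod (poly (ppoly p q L) z) = cmod (poly (ppoly X V L) z)" if "cmod z = 1" for z
      using data_circle_small[OF assms, of 1, OF _ that] by simp
  qed
  then have "s' = 0" using lo by simp
  then show ?thesis using that[of a b c] * lo by (simp add: monom_0)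
qed

lemma second_middle:
  assumes "data p q"
  shows "cmod (coeff (ppoly p q (2 * L)) L) = cmod (coeff (ppoly X V (2 * L)) L)"
proof -
  obtain a b c where *: "ppoly X V L = a * b" "ppoly p q L = smult c (a * crev b)"
    "cmod c = 1" "coeff b 0 = 1" "degree a = L - degree b" "degree b \<le> L"
    using first_factorization[OF assms] by metis
  have L: "L = degree a + degree b" using * by simp
  have "b \<noteq> 0" using *(4) by auto
  have "degree (crev b) = degree b" using *(4) by (simp add: degree_crev)
  then have top: "coeff (a * crev b) L = lead_coeff a * cnj (coeff b 0)" "coeff (a * b) L = lead_coeff a * lead_coeff b"
    using coeff_mult_degree_sum[of a "crev b"] coeff_mult_degree_sum[of a b] L by (simp_all add: coeff_crev)
  have bot: "coeff (a * crev b) 0 = coeff a 0 * cnj (lead_coeff b)" "coeff (a * b) 0 = coeff a 0 * coeff b 0"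
    by (simp_all add: coeff_mult_0 coeff_crev)
  \<comment> \<open>The flip keeps the end coefficients of \<open>a\<close> and swaps and conjugates
    those of \<open>b\<close>, so the product keeps its modulus.\<close>
  have ends: "cmod (coeff (ppoly p q L) 0 * coeff (ppoly p q L) L)
      = cmod (coeff (ppoly X V L) 0 * coeff (ppoly X V L) L)"
    unfolding * coeff_smult top bot using *(3) by (simp add: norm_mult)
  have mid: "coeff (ppoly f g (2 * L)) L * (f 0 * g 0) = coeff (ppoly f g L) 0 * coeff (ppoly f g L) L" for f g
    by (simp add: coeff_ppoly)
  have "cmod (coeff (ppoly p q (2 * L)) L) * cmod (X 0 * V 0)
      = cmod (coeff (ppoly X V (2 * L)) L) * cmod (X 0 * V 0)"
    using ends mid[of p q] mid[of X V] data_origin[OF assms] by (metis norm_mult)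
  then show ?thesis using X_nonzero[of 0] V_nonzero[of 0] LW WN by simp
qed

text \<open>By \<open>second_middle\<close> the modulus at position \<open>L\<close> is unchanged,
  which for good pairs leaves only the trivial flip and the full reversal.\<close>

lemma orientation:
  assumes "data p q"
  shows "(\<exists>c. cmod c = 1 \<and> ppoly p q (2 * L) = smult c (ppoly X V (2 * L))) \<or>
    (\<exists>c. cmod c = 1 \<and> (\<forall>i\<le>2 * L. coeff (ppoly p q (2 * L)) i = c * cnj (coeff (ppoly X V (2 * L)) (2 * L - i))))"
proof -
  let ?s = "lo (2 * L)" and ?d = "len (2 * L)"
  have sd: "?s + ?d = 2 * L" using N_large LW by (auto simp: win_lo_def win_len_def)
  obtain a b c s' where *: "wpoly (2 * L) = a * b" "ppoly X V (2 * L) = monom 1 ?s * (a * b)"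
    "ppoly p q (2 * L) = smult c (monom 1 s' * (a * crev b))"
    "cmod c = 1" "coeff b 0 = 1" "degree a = ?d - degree b" "degree b \<le> ?d" "s' + ?d \<le> 2 * L"
  proof (rule factorization[of "2 * L" p q])
    show "2 * L + 1 < N + W" using N_large by simp
    show "cmod (poly (ppoly p q (2 * L)) z) = cmod (poly (ppoly X V (2 * L)) z)" if "cmod z = 1" for z
      using data_circle_small[OF assms, of 2, OF _ that] by simp
  qed
  have "\<not> flip_free ?s ?d (wprod x w (2 * L)) L (degree b) s'"
  proof
    assume "flip_free ?s ?d (wprod x w (2 * L)) L (degree b) s'"
    moreover have "\<forall>k\<le>?d. wprod x w (2 * L) (?s + k) = coeff (a * b) k"
      using *(1) coeff_wpoly[of "2 * L"] by auto
    ultimately have "cmod (coeff (monom 1 ?s * (a * b)) L) \<noteq> cmod (coeff (monom 1 s' * (a * crev b)) L)"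
      unfolding flip_free_def using *(5,6) by auto
    then show False
      using second_middle[OF assms] unfolding *(2,3) by (simp add: norm_mult *(4))
  qed
  then have "(degree b, s') = (0, ?s) \<or> (degree b, s') = (?d, 0)"
    using good sd *(7,8) unfolding good_def by (metis add_le_cancel_right)
  then show ?thesis
  proof
    assume "(degree b, s') = (0, ?s)"
    then have "b = 1" "s' = ?s" using degree_0_coeff_1 *(5) by auto
    then show ?thesis using *(2,3,4) by auto
  next
    \<comment> \<open>Here \<open>a\<close> is a constant \<open>k\<close>, so the column is
      reversed as a whole; conjugating \<open>k\<close> contributes the unimodular factor
      \<open>k / cnj k\<close>.\<close>
    assume eq: "(degree b, s') = (?d, 0)"
    then obtain k where k: "a = [:k:]" using *(6) by (metis degree_eq_zeroE diff_self_eq_0 prod.inject)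
    have "k \<noteq> 0" using *(1) k wpoly_ends(1)[of "2 * L"] N_large by auto
    define c' where "c' = c * k / cnj k"
    have "cmod c' = 1" using *(4) \<open>k \<noteq> 0\<close> by (simp add: c'_def norm_mult norm_divide)
    moreover have "coeff (ppoly p q (2 * L)) i = c' * cnj (coeff (ppoly X V (2 * L)) (2 * L - i))"
      if i: "i \<le> 2 * L" for i
    proof (cases "i \<le> ?d")
      case True
      then have "?s \<le> 2 * L - i" "2 * L - i - ?s = ?d - i" using sd by linarith+
      then show ?thesis using True \<open>k \<noteq> 0\<close> eq unfolding *(2,3) k
        by (simp add: coeff_monom_mult coeff_crev c'_def)
    next
      case False
      then have "\<not> ?s \<le> 2 * L - i" using sd i by linarith
      then show ?thesis using False eq unfolding *(2,3) k
        by (simp add: coeff_monom_mult coeff_crev)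
    qed
    ultimately show ?thesis by blast
  qed
qed

text \<open>Both pairs satisfy the identity linking columns 0 to 3, and the moduli from columns 0
  and 2 coincide. A flip in column 1 would then give a proportion that \<open>flip_free_pair\<close>
  excludes for every flip in column 3.\<close>

lemma first_determined:
  assumes "data p q" and c2: "cmod c2 = 1" "ppoly p q (2 * L) = smult c2 (ppoly X V (2 * L))"
  shows "\<exists>c. cmod c = 1 \<and> ppoly p q L = smult c (ppoly X V L)"
proof -
  let ?s = "lo (3 * L)" and ?d = "len (3 * L)"
  obtain a b c where *: "wpoly L = a * b" "ppoly X V L = a * b" "ppoly p q L = smult c (a * crev b)"
    "cmod c = 1" "coeff b 0 = 1" "degree a = L - degree b" "degree b \<le> L"
    using first_factorization[OF assms(1)] by metis
  obtain a' b' c' s' where fact3: "wpoly (3 * L) = a' * b'" "ppoly X V (3 * L) = monom 1 ?s * (a' * b')"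
    "ppoly p q (3 * L) = smult c' (monom 1 s' * (a' * crev b'))"
    "cmod c' = 1" "coeff b' 0 = 1" "degree a' = ?d - degree b'" "degree b' \<le> ?d" "s' + ?d \<le> 3 * L"
  proof (rule factorization[of "3 * L" p q])
    show "3 * L + 1 < N + W" using N_large by simp
    show "cmod (poly (ppoly p q (3 * L)) z) = cmod (poly (ppoly X V (3 * L)) z)" if "cmod z = 1" for z
      using data_circle_small[OF assms(1), of 3, OF _ that] by simp
  qed
  have "degree b = 0"
  proof (rule ccontr)
    assume "degree b \<noteq> 0"
    then have ff: "flip_free_pair L ?s ?d (case_sum (wprod x w L) (wprod x w (3 * L))) (2 * L) (degree b) (degree b') s'"
      using good *(7) fact3(7,8) unfolding good_def by simp
    have "\<forall>k\<le>L. wprod x w L k = coeff (a * b) k"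
      using *(1) coeff_wpoly[of L] LW WN by (auto simp: win_lo_def win_len_def)
    moreover have "\<forall>k\<le>?d. wprod x w (3 * L) (?s + k) = coeff (a' * b') k"
      using fact3(1) coeff_wpoly[of "3 * L"] by auto
    ultimately have "cmod (coeff (monom 1 s' * (a' * crev b')) (2 * L)) * cmod (coeff (a * b) 0)
       \<noteq> cmod (coeff (monom 1 ?s * (a' * b')) (2 * L)) * cmod (coeff (a * crev b) 0)"
      using ff *(5,6) fact3(5,6) unfolding flip_free_pair_def by simp
    then have neq: "cmod (coeff (ppoly p q (3 * L)) (2 * L)) * cmod (coeff (ppoly X V L) 0)
       \<noteq> cmod (coeff (ppoly X V (3 * L)) (2 * L)) * cmod (coeff (ppoly p q L) 0)"
      unfolding *(2,3) fact3(2,3) by (simp add: norm_mult *(4) fact3(4))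
    have rel: "coeff (ppoly f g (3 * L)) (2 * L) * (f 0 * g 0)
        = coeff (ppoly f g (2 * L)) (2 * L) * coeff (ppoly f g L) 0" for f g
      by (simp add: coeff_ppoly)
    define e where "e = cmod (coeff (ppoly X V (2 * L)) (2 * L))"
    define o' where "o' = cmod (X 0 * V 0)"
    have "cmod (coeff (ppoly p q (3 * L)) (2 * L)) * o' = e * cmod (coeff (ppoly p q L) 0)"
      using rel[of p q] data_origin[OF assms(1)] c2 unfolding e_def o'_def
      by (metis coeff_smult mult_1 norm_mult)
    moreover have "cmod (coeff (ppoly X V (3 * L)) (2 * L)) * o' = e * cmod (coeff (ppoly X V L) 0)"
      using rel[of X V] unfolding e_def o'_def by (metis norm_mult)
    moreover have "(A * D) * (o' * e) = (C * B) * (o' * e)" if "A * o' = e * B" "C * o' = e * D" for A B C D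
    proof -
      have "(A * D) * (o' * e) = (A * o') * (D * e)" by (simp only: mult_ac)
      also have "\<dots> = (C * o') * (B * e)" unfolding that by (simp only: mult_ac)
      also have "\<dots> = (C * B) * (o' * e)" by (simp only: mult_ac)
      finally show ?thesis .
    qed
    ultimately have "(cmod (coeff (ppoly p q (3 * L)) (2 * L)) * cmod (coeff (ppoly X V L) 0)) * (o' * e)
        = (cmod (coeff (ppoly X V (3 * L)) (2 * L)) * cmod (coeff (ppoly p q L) 0)) * (o' * e)"
      by blast
    moreover have "o' * e \<noteq> 0"
      using X_nonzero[of 0] V_nonzero[of 0] X_nonzero[of "2 * L"] N_large LW
      by (simp add: o'_def e_def coeff_ppoly)
    ultimately show False using neq by simp
  qed
  then have "b = 1" using degree_0_coeff_1 *(5) by blast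
  then show ?thesis using *(2,3,4) by auto
qed

definition agree :: "(nat \<Rightarrow> complex) \<Rightarrow> (nat \<Rightarrow> complex) \<Rightarrow> nat \<Rightarrow> bool" where
  "agree p q K \<longleftrightarrow> (\<forall>n\<le>K. p n = X n \<and> q n = V n)"

text \<open>The known nonzero value \<open>p W = X W\<close> rules out that \<open>p\<close> is the
  short factor.\<close>

lemma agree_window_support:
  assumes "agree p q K0" "W \<le> K0" "K0 + 2 \<le> N" "(\<forall>n\<ge>W. q n = 0) \<or> (\<forall>n\<ge>W. p n = 0)"
  shows "\<forall>n\<ge>W. q n = 0"
proof -
  have "p W \<noteq> 0" using assms X_nonzero[of W] by (simp add: agree_def)
  then show ?thesis using assms(4) by auto
qed

text \<open>Each unknown product has one known nonzero factor: new signal entries meet window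
  entries below \<open>L\<close>, and new window entries meet signal entries below
  \<open>L\<close>.\<close>

lemma agree_extend:
  assumes "agree p q K0" "L \<le> K0" "K0 + 2 \<le> N"
    and zero: "\<forall>n\<ge>N. p n = 0 \<and> q n = 0" and supp: "(\<forall>n\<ge>W. q n = 0) \<or> (\<forall>n\<ge>W. p n = 0)"
    and eq: "\<And>n. n \<in> unknown N W L (K0 + L) \<Longrightarrow> coeff (ppoly p q (K0 + L)) n = coeff (ppoly X V (K0 + L)) n"
  shows "agree p q (K0 + L)"
  unfolding agree_def
proof (intro allI impI conjI)
  fix n assume n: "n \<le> K0 + L"
  show "p n = X n"
  proof (cases "n \<le> K0 \<or> N \<le> n")
    case True
    then show ?thesis using assms(1) zero by (auto simp: agree_def zext_def)
  next
    case False
    then have "p n * V (K0 + L - n) = X n * V (K0 + L - n)"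
      using eq[of n] n assms(1,2) by (auto simp: unknown_def coeff_ppoly agree_def)
    moreover have "V (K0 + L - n) \<noteq> 0" using False LW by (intro V_nonzero) linarith
    ultimately show ?thesis by simp
  qed
  show "q n = V n"
  proof (cases "n \<le> K0 \<or> N \<le> n")
    case True
    then show ?thesis using assms(1) zero WN by (auto simp: agree_def zext_def)
  next
    case False
    show ?thesis
    proof (cases "K0 < W")
      case True
      define j where "j = K0 + L - n"
      have j: "j < L" "K0 + L - j = n" "j \<le> K0 + L" using False n by (auto simp: j_def)
      then have "p j * q n = X j * V n"
        using eq[of j] True by (simp add: unknown_def coeff_ppoly)
      moreover have "p j = X j" using assms(1,2) j by (simp add: agree_def)
      moreover have "X j \<noteq> 0" using j assms(2,3) by (intro X_nonzero) linarith
      ultimately show ?thesis by simp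
    next
      case False
      then have "\<forall>n\<ge>W. q n = 0" using agree_window_support assms(1,3) supp by auto
      then show ?thesis using False \<open>\<not> (n \<le> K0 \<or> N \<le> n)\<close> by (simp add: zext_def)
    qed
  qed
qed

text \<open>Positions \<open>L\<close> to \<open>K0\<close> involve known entries only. Those at
  \<open>K0\<close> and \<open>K0 - 1\<close> exclude every flip, and the one at \<open>K0\<close>
  also fixes the phase \<open>c\<close>.\<close>

lemma agree_step_flip:
  assumes ag: "agree p q K0" and K0: "2 * L \<le> K0" "K0 + 2 \<le> N"
    and zero: "\<forall>n\<ge>N. p n = 0 \<and> q n = 0" and supp: "(\<forall>n\<ge>W. q n = 0) \<or> (\<forall>n\<ge>W. p n = 0)"
    and circ: "\<And>z. cmod z = 1 \<Longrightarrow> cmod (poly (ppoly p q (K0 + L)) z) = cmod (poly (ppoly X V (K0 + L)) z)"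
  shows "agree p q (K0 + L)"
proof -
  let ?K = "K0 + L" let ?s = "lo ?K" and ?d = "len ?K"
  have K: "?K + 1 < N + W" using K0 LW by simp
  obtain a b c s' where *: "wpoly ?K = a * b" "ppoly X V ?K = monom 1 ?s * (a * b)"
    "ppoly p q ?K = smult c (monom 1 s' * (a * crev b))"
    "cmod c = 1" "coeff b 0 = 1" "degree a = ?d - degree b" "degree b \<le> ?d" "s' + ?d \<le> ?K"
    using factorization[OF K circ] by metis
  have known: "coeff (ppoly p q ?K) n = coeff (ppoly X V ?K) n" if "L \<le> n" "n \<le> K0" for n
    using ag that by (simp add: coeff_ppoly agree_def)
  have "(degree b, s') = (0, ?s)"
  proof (rule ccontr)
    assume "(degree b, s') \<noteq> (0, ?s)"
    then obtain n where n: "n \<in> {K0, K0 - 1}" and ff: "flip_free ?s ?d (wprod x w ?K) n (degree b) s'"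
      using good K0 *(7,8) unfolding good_def by (metis add_leD1)
    have "\<forall>k\<le>?d. wprod x w ?K (?s + k) = coeff (a * b) k"
      using *(1) coeff_wpoly[of ?K] by auto
    then have "cmod (coeff (monom 1 ?s * (a * b)) n) \<noteq> cmod (coeff (monom 1 s' * (a * crev b)) n)"
      using ff unfolding flip_free_def using *(5,6) by auto
    moreover have "coeff (ppoly p q ?K) n = coeff (ppoly X V ?K) n"
      using n K0 L1 by (intro known) auto
    then have "cmod (coeff (ppoly p q ?K) n) = cmod (coeff (ppoly X V ?K) n)" by simp
    ultimately show False unfolding *(2,3) by (simp add: norm_mult *(4))
  qed
  then have "b = 1" "s' = ?s" using degree_0_coeff_1 *(5) by auto
  then have eq: "ppoly p q ?K = smult c (ppoly X V ?K)" using *(2,3) by simp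
  have "coeff (ppoly X V ?K) K0 \<noteq> 0"
    using X_nonzero[of K0] V_nonzero[of L] K0 LW by (simp add: coeff_ppoly)
  moreover have "c * coeff (ppoly X V ?K) K0 = coeff (ppoly X V ?K) K0"
    using known[of K0] K0 unfolding eq by simp
  ultimately have "c = 1" by simp
  then show ?thesis using eq K0 by (intro agree_extend[OF ag _ _ zero supp]) auto
qed

lemma card_unknown: "card (unknown N W L K) \<le> 2 * L"
proof -
  have "card (unknown N W L K) \<le> card ({..<L} \<union> {K + 1 - L..<K + 1 - L + L})"
    by (intro card_mono) (auto simp: unknown_def)
  also have "\<dots> \<le> L + L" by (rule order_trans[OF card_Un_le]) simp
  finally show ?thesis by simp
qed

lemma expsum_window:
  assumes "K + 1 < N + W"
  shows "expsum N {lo K..lo K + len K} (wprod x w K) k = poly (ppoly X V K) (fnode N ^ k)"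
proof -
  have "(\<Sum>n\<in>{lo K..lo K + len K}. wprod x w K n * (fnode N ^ k) ^ n)
      = (\<Sum>n\<le>K. X n * V (K - n) * (fnode N ^ k) ^ n)"
    using assms WN LW
    by (intro sum.mono_neutral_cong_left) (auto simp: win_lo_def win_len_def wprod_def zext_def)
  then show ?thesis by (simp add: expsum_def poly_ppoly)
qed

lemma agree_step_sparse:
  assumes ag: "agree p q K0" and K0: "3 * L \<le> K0" "K0 + 2 \<le> N" and W: "4 * L < W"
    and zero: "\<forall>n\<ge>N. p n = 0 \<and> q n = 0" and supp: "(\<forall>n\<ge>W. q n = 0) \<or> (\<forall>n\<ge>W. p n = 0)"
    and samples: "\<And>k. k < 8 * L \<Longrightarrow> cmod (poly (ppoly p q (K0 + L)) (fnode N ^ k))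
        = cmod (poly (ppoly X V (K0 + L)) (fnode N ^ k))"
  shows "agree p q (K0 + L)"
proof -
  let ?K = "K0 + L" and ?U = "unknown N W L (K0 + L)"
  have K: "?K + 1 < N + W" using K0 LW by simp
  define D where "D n = coeff (ppoly p q ?K) n - coeff (ppoly X V ?K) n" for n
  have D0: "D n = 0" if "n \<le> ?K" "n \<notin> ?U" for n
  proof (cases "n < L")
    \<comment> \<open>A low position is missing from \<open>unknown\<close> only if
      \<open>W <= K0\<close>; both products then contain a window entry beyond the support.\<close>
    case True
    then have "W \<le> K0" using that K0 by (auto simp: unknown_def split: if_splits)
    then have "\<forall>n\<ge>W. q n = 0" using agree_window_support ag K0 supp by auto
    then show ?thesis using True \<open>W \<le> K0\<close> by (simp add: D_def coeff_ppoly zext_def)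
  next
    case False
    then show ?thesis using that ag zero
      by (cases "n \<le> K0") (auto simp: D_def coeff_ppoly agree_def unknown_def zext_def)
  qed
  have sub: "?U \<subseteq> {..?K}" using K0 by (auto simp: unknown_def)
  have "poly (ppoly X V ?K) z + (\<Sum>n\<in>?U. D n * z ^ n) = poly (ppoly p q ?K) z" for z
  proof -
    have "(\<Sum>n\<in>?U. D n * z ^ n) = (\<Sum>n\<le>?K. D n * z ^ n)"
      using sub D0 by (intro sum.mono_neutral_left) auto
    also have "\<dots> = (\<Sum>n\<le>?K. p n * q (?K - n) * z ^ n - X n * V (?K - n) * z ^ n)"
      by (intro sum.cong) (auto simp: D_def coeff_ppoly algebra_simps)
    finally show ?thesis by (simp add: poly_ppoly sum_subtractf)
  qed
  then have "expsum N {lo ?K..lo ?K + len ?K} (wprod x w ?K) k + expsum N ?U D k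
      = poly (ppoly p q ?K) (fnode N ^ k)" for k
    unfolding expsum_window[OF K] by (simp add: expsum_def)
  then have "\<forall>k<4 * card ?U. cmod (expsum N {lo ?K..lo ?K + len ?K} (wprod x w ?K) k + expsum N ?U D k)
      = cmod (expsum N {lo ?K..lo ?K + len ?K} (wprod x w ?K) k)"
    using samples card_unknown[of ?K] by (auto simp: expsum_window[OF K])
  then have "\<forall>j\<in>?U. D j = 0" using good W K0 unfolding good_def by blast
  then show ?thesis using K0 by (intro agree_extend[OF ag _ _ zero supp]) (auto simp: D_def)
qed

lemma agree_all:
  assumes d: "data p q" and ag: "agree p q (2 * L)"
    and zero: "\<forall>n\<ge>N. p n = 0 \<and> q n = 0" and supp: "(\<forall>n\<ge>W. q n = 0) \<or> (\<forall>n\<ge>W. p n = 0)"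
  shows "p n = X n \<and> q n = V n"
proof -
  have "agree p q ((m + 2) * L)" for m
  proof (induction m)
    case 0
    then show ?case using ag by (simp only: add_0)
  next
    case (Suc m)
    define K0 where "K0 = (m + 2) * L"
    have ag0: "agree p q K0" using Suc by (simp add: K0_def)
    have K: "K0 + L = (m + 3) * L" "(Suc m + 2) * L = (m + 3) * L" by (simp_all add: K0_def algebra_simps)
    have K0: "2 * L \<le> K0" "m \<ge> 1 \<Longrightarrow> 3 * L \<le> K0" unfolding K0_def by (intro mult_le_mono1; simp)+
    show ?case
    proof (cases "K0 + 2 \<le> N")
      \<comment> \<open>Every index below \<open>N\<close> is at most \<open>K0\<close>, so nothing
        is left to determine.\<close>
      case False
      then show ?thesis using ag0 zero WN K unfolding agree_def
        by (metis (no_types, lifting) Suc_1 add_2_eq_Suc' linorder_not_le not_less_eq_eq order_trans zext_def)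
    next
      case True
      have m: "m + 3 < numM N W L" using next_index_less_numM[OF K(1) True] .
      have "agree p q (K0 + L)"
      proof (cases "m = 0")
        case True
        then show ?thesis using \<open>K0 + 2 \<le> N\<close> K0 data_circle_small[OF d, of 3] K
          by (intro agree_step_flip[OF ag0 _ _ zero supp]) auto
      next
        case m0: False
        show ?thesis
        proof (cases "W \<le> 4 * L")
          case True
          then show ?thesis using \<open>K0 + 2 \<le> N\<close> K0 K m m0 LW
            by (intro agree_step_flip[OF ag0 _ _ zero supp])
              (auto intro!: data_circle_window[OF d _ _ _ _ supp] simp del: add_mult_distrib)
        next
          case False
          have "4 * L \<le> (m + 3) * L" using m0 by (intro mult_le_mono1) simp
          \<comment> \<open>When the cap is active this reads \<open>8 L <= 10 L - 2\<close>, with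
            equality for \<open>L = 1\<close>.\<close>
          then have "8 * L \<le> Suc (Qf L (m + 3))" using L1 unfolding Qf_def by linarith
          then show ?thesis using \<open>K0 + 2 \<le> N\<close> K0 K m m0 False d
            by (intro agree_step_sparse[OF ag0 _ _ _ zero supp]) (auto simp: data_def)
        qed
      qed
      then show ?thesis using K by simp
    qed
  qed
  moreover have "n \<le> (n + 2) * L" using L1 by (metis le_add1 mult.right_neutral mult_le_mono)
  ultimately show ?thesis unfolding agree_def by blast
qed

end

section \<open>Gauge fixing and the main theorem\<close>

definition rev_index :: "nat \<Rightarrow> nat \<Rightarrow> nat" where
  "rev_index L n = nat ((int L - int n) mod int L)"

text \<open>This makes \<open>lam\<close> cancel in each product \<open>x n * w (m L - n)\<close>,
  so that the ambiguity is invisible in every column.\<close>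

lemma rev_index_diff:
  assumes "n \<le> m * L"
  shows "rev_index L (m * L - n) = n mod L"
proof -
  have "int L - int (m * L - n) = int n + int L * (1 - int m)"
    using assms by (simp add: of_nat_diff algebra_simps)
  then have "(int L - int (m * L - n)) mod int L = int n mod int L"
    by (simp only: mod_mult_self2)
  then show ?thesis by (simp add: rev_index_def zmod_int[symmetric])
qed

lemma rev_index_less: "1 \<le> L \<Longrightarrow> rev_index L n < L"
  by (simp add: rev_index_def nat_less_iff)

lemma unit_root_exists:
  assumes "cmod u = 1" "1 \<le> L"
  shows "\<exists>\<eta>. cmod \<eta> = 1 \<and> \<eta> ^ L = u"
proof (intro exI conjI)
  have "cis (Arg u) = u" using assms by (subst cis_Arg) (auto simp: sgn_div_norm)
  then show "cis (Arg u / real L) ^ L = u" using assms by (simp add: Complex.DeMoivre)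
qed simp

context good_blind
begin

text \<open>The phase of column 0 gives \<open>\<eta>1\<close>, its ratio to that of column 1 gives
  \<open>\<eta>2 ^ L\<close>, and the first \<open>L\<close> signal entries define
  \<open>lam\<close>. Columns 0 and 1 then settle the other entries up to \<open>L\<close>.\<close>

lemma gauge:
  assumes d: "data p q" and c1: "cmod c1 = 1" "ppoly p q L = smult c1 (ppoly X V L)"
  obtains \<eta>1 \<eta>2 lam where "cmod \<eta>1 = 1" "cmod \<eta>2 = 1" "\<And>i. i < L \<Longrightarrow> lam i \<noteq> 0"
    "\<And>n. n \<le> L \<Longrightarrow> p n = \<eta>1 * \<eta>2 ^ n * lam (n mod L) * X n"
    "\<And>n. n \<le> L \<Longrightarrow> q n = \<eta>2 ^ n * inverse (lam (rev_index L n)) * V n"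
proof -
  have XV: "X n \<noteq> 0" "V n \<noteq> 0" if "n \<le> L" for n
    using X_nonzero[of n] V_nonzero[of n] that LW WN by simp_all
  define c0 where "c0 = p 0 * q 0 / (X 0 * V 0)"
  have c0: "cmod c0 = 1" "p 0 * q 0 = c0 * X 0 * V 0"
    using data_origin[OF d] XV[of 0] by (auto simp: c0_def norm_divide norm_mult)
  have "cmod (c1 / c0) = 1" using c0 c1 by (simp add: norm_divide)
  then obtain \<eta>2 where \<eta>2: "cmod \<eta>2 = 1" "\<eta>2 ^ L = c1 / c0"
    using unit_root_exists L1 by blast
  have nz: "c0 \<noteq> 0" "c1 \<noteq> 0" "\<eta>2 \<noteq> 0" using c0 c1 \<eta>2 by auto
  have pq: "p n * q (L - n) = c1 * X n * V (L - n)" if "n \<le> L" for n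
    using arg_cong[OF c1(2), of "\<lambda>p. coeff p n"] that by (simp add: coeff_ppoly)
  have p0: "p n \<noteq> 0" if "n \<le> L" for n using pq[OF that] nz XV that by auto
  define lam where "lam n = p n / (c0 * \<eta>2 ^ n * X n)" for n
  have p: "p n = c0 * \<eta>2 ^ n * lam n * X n" if "n \<le> L" for n
    using nz XV that by (simp add: lam_def)
  have lam: "lam n \<noteq> 0" if "n < L" for n using p0[of n] nz XV[of n] that by (simp add: lam_def)
  have q: "q n = \<eta>2 ^ n * inverse (lam (rev_index L n)) * V n" if "n \<le> L" for n
  proof (cases "n = 0")
    case True
    then have "c0 * lam 0 * X 0 * q 0 = c0 * X 0 * V 0" using c0 p[of 0] by simp
    then have "lam 0 * q 0 = V 0" using nz XV[of 0] by simp
    moreover have "rev_index L 0 = 0" by (simp add: rev_index_def)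
    ultimately show ?thesis using True lam[of 0] L1 by (simp add: field_simps)
  next
    case False
    define r where "r = L - n"
    have r: "r < L" "L - r = n" using False that L1 by (auto simp: r_def)
    have "rev_index L n = r" using rev_index_diff[of r 1 L] r by simp
    moreover have "(c0 * \<eta>2 ^ r * lam r * X r) * q n = c1 * X r * V n"
      using pq[of r] p[of r] r by simp
    then have "(c0 * \<eta>2 ^ r * lam r) * q n = c1 * V n" using XV[of r] r by (simp add: mult.assoc)
    moreover have "c1 = c0 * \<eta>2 ^ r * \<eta>2 ^ n" using \<eta>2 r nz
      by (metis add_diff_inverse_nat mult.assoc nonzero_mult_div_cancel_left not_less_iff_gr_or_eq
          power_add times_divide_eq_right)
    ultimately have "(c0 * \<eta>2 ^ r) * (lam r * q n) = (c0 * \<eta>2 ^ r) * (\<eta>2 ^ n * V n)"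
      by (simp only: mult_ac)
    then have "lam r * q n = \<eta>2 ^ n * V n" using nz by simp
    then show ?thesis using lam[of r] r \<open>rev_index L n = r\<close> by (simp add: field_simps)
  qed
  have p': "p n = c0 * \<eta>2 ^ n * lam (n mod L) * X n" if "n \<le> L" for n
  proof (cases "n = L")
    case True
    have "V 0 = lam 0 * q 0" using q[of 0] lam[of 0] L1 by (simp add: rev_index_def)
    then have "p L * q 0 = c1 * X L * lam 0 * q 0" using pq[of L] by (simp add: mult.assoc)
    moreover have "q 0 \<noteq> 0" using q[of 0] lam[of 0] XV[of 0] L1 by (simp add: rev_index_def)
    ultimately show ?thesis using True \<eta>2 nz by simp
  next
    case False
    then show ?thesis using p[OF that] that by simp
  qed
  show ?thesis using that[of c0 \<eta>2 lam] c0 \<eta>2 lam p' q by blast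
qed

text \<open>Dividing out the ambiguity keeps \<open>data\<close> and yields agreement up to
  \<open>L\<close>. The middle coefficient of column 2 is then known, which forces its phase to be 1
  and extends the agreement to \<open>2 L\<close>, where the induction starts.\<close>

lemma uniqueness_oriented:
  assumes d: "data p q" and c2: "cmod c2 = 1" "ppoly p q (2 * L) = smult c2 (ppoly X V (2 * L))"
    and zero: "\<forall>n\<ge>N. p n = 0 \<and> q n = 0" and supp: "(\<forall>n\<ge>W. q n = 0) \<or> (\<forall>n\<ge>W. p n = 0)"
  obtains \<eta>1 \<eta>2 lam where "cmod \<eta>1 = 1" "cmod \<eta>2 = 1" "\<And>i. i < L \<Longrightarrow> lam i \<noteq> 0"
    "\<And>n. p n = \<eta>1 * \<eta>2 ^ n * lam (n mod L) * X n"
    "\<And>n. q n = \<eta>2 ^ n * inverse (lam (rev_index L n)) * V n"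
proof -
  obtain c1 where "cmod c1 = 1" "ppoly p q L = smult c1 (ppoly X V L)"
    using first_determined[OF d c2] by blast
  then obtain \<eta>1 \<eta>2 lam where \<eta>: "cmod \<eta>1 = 1" "cmod \<eta>2 = 1" and lam: "\<And>i. i < L \<Longrightarrow> lam i \<noteq> 0"
    and pL: "\<And>n. n \<le> L \<Longrightarrow> p n = \<eta>1 * \<eta>2 ^ n * lam (n mod L) * X n"
    and qL: "\<And>n. n \<le> L \<Longrightarrow> q n = \<eta>2 ^ n * inverse (lam (rev_index L n)) * V n"
    using gauge[OF d] by metis
  have nz: "\<eta>1 \<noteq> 0" "\<eta>2 \<noteq> 0" using \<eta> by auto
  have lam_mod: "lam (n mod L) \<noteq> 0" "lam (rev_index L n) \<noteq> 0" for n
    using lam L1 rev_index_less[of L n] by auto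
  define p' where "p' n = p n / (\<eta>1 * \<eta>2 ^ n * lam (n mod L))" for n
  define q' where "q' n = q n / (\<eta>2 ^ n * inverse (lam (rev_index L n)))" for n
  have p: "p n = \<eta>1 * \<eta>2 ^ n * lam (n mod L) * p' n" for n
    using nz lam_mod by (simp add: p'_def)
  have q: "q n = \<eta>2 ^ n * inverse (lam (rev_index L n)) * q' n" for n
    using nz lam_mod by (simp add: q'_def)
  have pp: "ppoly p q (m * L) = smult (\<eta>1 * \<eta>2 ^ (m * L)) (ppoly p' q' (m * L))" for m
  proof (rule poly_eqI)
    fix n
    define K where "K = m * L"
    show "coeff (ppoly p q (m * L)) n = coeff (smult (\<eta>1 * \<eta>2 ^ (m * L)) (ppoly p' q' (m * L))) n"
    proof (cases "n \<le> m * L")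
      case True
      then have "rev_index L (K - n) = n mod L" by (simp add: K_def rev_index_diff)
      moreover have "\<eta>2 ^ K = \<eta>2 ^ n * \<eta>2 ^ (K - n)" using True by (simp add: K_def flip: power_add)
      ultimately show ?thesis
        using True lam_mod(1)[of n] unfolding K_def[symmetric]
        by (simp add: coeff_ppoly p q)
    next
      case False
      then show ?thesis by (simp add: coeff_ppoly)
    qed
  qed
  have d': "data p' q'"
    using d \<eta> unfolding data_def pp by (simp add: norm_mult norm_power)
  have zero': "\<forall>n\<ge>N. p' n = 0 \<and> q' n = 0" using zero by (simp add: p'_def q'_def)
  have supp': "(\<forall>n\<ge>W. q' n = 0) \<or> (\<forall>n\<ge>W. p' n = 0)" using supp by (auto simp: p'_def q'_def)
  have ag: "agree p' q' L"
    using nz lam_mod by (auto simp: agree_def p'_def q'_def pL qL)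
  define c where "c = c2 / (\<eta>1 * \<eta>2 ^ (2 * L))"
  have k: "\<eta>1 * \<eta>2 ^ (2 * L) \<noteq> 0" using nz by simp
  have "smult (inverse (\<eta>1 * \<eta>2 ^ (2 * L))) (ppoly p q (2 * L)) = ppoly p' q' (2 * L)"
    unfolding pp smult_smult left_inverse[OF k] by simp
  then have c: "ppoly p' q' (2 * L) = smult c (ppoly X V (2 * L))"
    unfolding c2(2) by (simp add: c_def divide_inverse mult.commute)
  have "X L * V L \<noteq> 0" using X_nonzero[of L] V_nonzero[of L] LW WN by simp
  moreover have "X L * V L = c * (X L * V L)"
    using arg_cong[OF c, of "\<lambda>p. coeff p L"] ag by (simp add: coeff_ppoly agree_def)
  ultimately have "c = 1" by simp
  then have "ppoly p' q' (L + L) = ppoly X V (L + L)" using c by (simp add: mult_2)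
  then have "agree p' q' (L + L)"
    using N_large by (intro agree_extend[OF ag _ _ zero' supp']) auto
  then have all: "p' n = X n \<and> q' n = V n" for n
    by (intro agree_all[OF d' _ zero' supp']) (simp add: mult_2)
  show ?thesis
  proof (rule that[OF \<eta> lam])
    show "p n = \<eta>1 * \<eta>2 ^ n * lam (n mod L) * X n" for n using p[of n] all[of n] by simp
    show "q n = \<eta>2 ^ n * inverse (lam (rev_index L n)) * V n" for n using q[of n] all[of n] by simp
  qed
qed

text \<open>On the circle, conjugation combined with the substitution of \<open>K - n\<close> for
  \<open>n\<close> costs only the factor \<open>z^K\<close>.\<close>

lemma ppoly_cnj_swap:
  assumes "cmod z = 1"
  shows "cmod (poly (ppoly (\<lambda>n. cnj (q n)) (\<lambda>n. cnj (p n)) K) z) = cmod (poly (ppoly p q K) z)"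
proof -
  have inv: "z * cnj z = 1" using assms by (simp flip: complex_norm_square)
  have "poly (ppoly (\<lambda>n. cnj (q n)) (\<lambda>n. cnj (p n)) K) z
      = (\<Sum>n\<le>K. cnj (q (K - n)) * cnj (p n) * z ^ (K - n))"
    unfolding poly_ppoly by (subst sum.nat_diff_reindex[symmetric, of _ "Suc K", simplified lessThan_Suc_atMost])
      (auto intro!: sum.cong)
  also have "\<dots> = (\<Sum>n\<le>K. z ^ K * cnj (p n * q (K - n) * z ^ n))"
  proof (intro sum.cong refl)
    fix n assume "n \<in> {..K}"
    then have "z ^ K = z ^ (K - n) * z ^ n" by (simp flip: power_add)
    then have "z ^ K * cnj z ^ n = z ^ (K - n) * (z * cnj z) ^ n" by (simp add: power_mult_distrib)
    then have "z ^ K * cnj z ^ n = z ^ (K - n)" using inv by simp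
    then show "cnj (q (K - n)) * cnj (p n) * z ^ (K - n) = z ^ K * cnj (p n * q (K - n) * z ^ n)"
      by (simp add: mult_ac)
  qed
  also have "\<dots> = z ^ K * cnj (poly (ppoly p q K) z)"
    by (simp add: poly_ppoly sum_distrib_left)
  finally show ?thesis using assms by (simp add: norm_mult norm_power)
qed

lemma uniqueness:
  assumes "\<forall>m < numM N W L. \<forall>k \<le> Qf L m. cmod (stft N W L x' w' k m) = cmod (stft N W L x w k m)"
  shows "\<exists>\<eta>1 \<eta>2 lam. cmod \<eta>1 = 1 \<and> cmod \<eta>2 = 1 \<and> (\<forall>i < L. lam i \<noteq> 0) \<and>
      (((\<forall>n < N. x' n = amb_x L \<eta>1 \<eta>2 lam x n) \<and> (\<forall>n < W. w' n = amb_w L \<eta>2 lam w n))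
       \<or> (N = W \<and> (\<forall>n < N. x' n = amb_x L \<eta>1 \<eta>2 lam (\<lambda>j. cnj (w j)) n)
                \<and> (\<forall>n < W. w' n = amb_w L \<eta>2 lam (\<lambda>j. cnj (x j)) n)))"
proof -
  let ?p = "zext N x'" and ?q = "zext W w'"
  have d: "data ?p ?q" using assms unfolding stft_eq_ppoly data_def .
  from orientation[OF d] show ?thesis
  proof (elim disjE exE conjE)
    fix c assume c: "cmod c = 1" "ppoly ?p ?q (2 * L) = smult c (ppoly X V (2 * L))"
    obtain \<eta>1 \<eta>2 lam where *: "cmod \<eta>1 = 1" "cmod \<eta>2 = 1" "\<And>i. i < L \<Longrightarrow> lam i \<noteq> 0"
      "\<And>n. ?p n = \<eta>1 * \<eta>2 ^ n * lam (n mod L) * X n"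
      "\<And>n. ?q n = \<eta>2 ^ n * inverse (lam (rev_index L n)) * V n"
      by (rule uniqueness_oriented[OF d c]) (use WN in \<open>auto simp: zext_def\<close>)
    have "x' n = amb_x L \<eta>1 \<eta>2 lam x n" if "n < N" for n
      using *(4)[of n] that by (simp add: amb_x_def zext_def)
    moreover have "w' n = amb_w L \<eta>2 lam w n" if "n < W" for n
      using *(5)[of n] that by (simp add: amb_w_def zext_def rev_index_def)
    ultimately show ?thesis using *(1-3) by blast
  next
    fix c assume c: "cmod c = 1"
      "\<forall>i\<le>2 * L. coeff (ppoly ?p ?q (2 * L)) i = c * cnj (coeff (ppoly X V (2 * L)) (2 * L - i))"
    let ?p' = "\<lambda>n. cnj (?q n)" and ?q' = "\<lambda>n. cnj (?p n)"
    have d': "data ?p' ?q'"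
      using d unfolding data_def by (simp add: ppoly_cnj_swap norm_power)
    have "ppoly ?p' ?q' (2 * L) = smult (cnj c) (ppoly X V (2 * L))"
    proof (rule poly_eqI)
      fix i
      show "coeff (ppoly ?p' ?q' (2 * L)) i = coeff (smult (cnj c) (ppoly X V (2 * L))) i"
      proof (cases "i \<le> 2 * L")
        case True
        have "coeff (ppoly ?p' ?q' (2 * L)) i = cnj (coeff (ppoly ?p ?q (2 * L)) (2 * L - i))"
          using True by (simp add: coeff_ppoly mult.commute)
        also have "\<dots> = cnj c * coeff (ppoly X V (2 * L)) i"
          using c(2)[rule_format, of "2 * L - i"] True by simp
        finally show ?thesis by simp
      qed (simp add: coeff_ppoly)
    qed
    moreover have "cmod (cnj c) = 1" using c by simp
    ultimately obtain \<eta>1 \<eta>2 lam where *: "cmod \<eta>1 = 1" "cmod \<eta>2 = 1" "\<And>i. i < L \<Longrightarrow> lam i \<noteq> 0"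
      "\<And>n. ?p' n = \<eta>1 * \<eta>2 ^ n * lam (n mod L) * X n"
      "\<And>n. ?q' n = \<eta>2 ^ n * inverse (lam (rev_index L n)) * V n"
      using uniqueness_oriented[OF d', of "cnj c"] WN by (auto simp: zext_def)
    have nz: "\<eta>1 \<noteq> 0" "\<eta>2 \<noteq> 0" using * by auto
    \<comment> \<open>For \<open>W < N\<close> the first component of the exchanged pair vanishes at
      \<open>W\<close>, whereas \<open>X W\<close> does not.\<close>
    have "N = W"
    proof (rule ccontr)
      assume "N \<noteq> W"
      then have "X W \<noteq> 0" using WN by (intro X_nonzero) simp
      moreover have "lam (W mod L) \<noteq> 0" using *(3) L1 by simp
      ultimately show False using *(4)[of W] nz by (simp add: zext_def)
    qed
    \<comment> \<open>Conjugating back replaces \<open>lam\<close> by its inverse at the reversed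
      index. The factor \<open>\<eta>1\<close> sits on the wrong component afterwards and is moved
      into \<open>lam'\<close> by \<open>cnj \<eta>1 * \<eta>1 = 1\<close>.\<close>
    define lam' where "lam' i = cnj (inverse (lam (rev_index L i))) * \<eta>1" for i
    have rev: "rev_index L (n mod L) = rev_index L n" "rev_index L (rev_index L n) = n mod L" for n
    proof -
      show "rev_index L (n mod L) = rev_index L n"
        by (simp add: rev_index_def zmod_int mod_diff_right_eq mod_minus_eq)
      have "int (rev_index L n) = (int L - int n) mod int L"
        using L1 by (simp add: rev_index_def)
      then have "rev_index L (rev_index L n) = nat ((int L - (int L - int n)) mod int L)"
        unfolding rev_index_def[of L "rev_index L n"] by (simp only: mod_diff_right_eq)
      then show "rev_index L (rev_index L n) = n mod L" by (simp add: zmod_int[symmetric])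
    qed
    have "x' n = amb_x L (cnj \<eta>1) (cnj \<eta>2) lam' (\<lambda>j. cnj (w j)) n" if "n < N" for n
    proof -
      have "x' n = cnj (?q' n)" using that by (simp add: zext_def)
      also have "\<dots> = cnj \<eta>2 ^ n * cnj (inverse (lam (rev_index L n))) * cnj (w n)"
        unfolding *(5) using that \<open>N = W\<close> by (simp add: zext_def)
      also have "\<dots> = (cnj \<eta>1 * \<eta>1) * \<dots>"
        using *(1) by (simp add: mult.commute[of "cnj \<eta>1"] flip: complex_norm_square)
      finally show ?thesis by (simp add: amb_x_def lam'_def rev(1) mult_ac)
    qed
    moreover have "w' n = amb_w L (cnj \<eta>2) lam' (\<lambda>j. cnj (x j)) n" if "n < W" for n
    proof -
      have "w' n = cnj (?p' n)" using that by (simp add: zext_def)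
      also have "\<dots> = cnj \<eta>1 * cnj \<eta>2 ^ n * cnj (lam (n mod L)) * cnj (x n)"
        unfolding *(4) using that \<open>N = W\<close> by (simp add: zext_def)
      also have "cnj \<eta>1 = inverse \<eta>1"
        using *(1) by (metis complex_norm_square inverse_unique of_real_1 power_one)
      finally have "w' n = cnj \<eta>2 ^ n * inverse (lam' (rev_index L n)) * cnj (x n)"
        by (simp add: lam'_def rev(2) mult_ac)
      then show ?thesis by (simp add: amb_w_def rev_index_def)
    qed
    moreover have "lam' i \<noteq> 0" for i
      using *(3)[OF rev_index_less[OF L1, of i]] nz by (simp add: lam'_def)
    ultimately show ?thesis using *(1,2) \<open>N = W\<close>
      by (intro exI[of _ "cnj \<eta>1"] exI[of _ "cnj \<eta>2"] exI[of _ lam']) simp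
  qed
qed

end

text \<open>Column 0 costs 2 measurements and each of the other \<open>M\<close> columns at most
  \<open>10 L - 2\<close>, where \<open>M L < N + W - 1\<close>.\<close>

lemma measurement_count:
  assumes "1 \<le> L" "L < W" "W \<le> N"
  shows "(\<Sum>m < numM N W L. Qf L m + 1) < 10 * (N + W)"
proof (cases "numM N W L")
  case 0
  then show ?thesis using assms by simp
next
  case (Suc M)
  define A where "A = N + W - 1"
  have "0 \<le> real A / real L" by simp
  then have "real (numM N W L) < real A / real L + 1"
    unfolding numM_def A_def by linarith
  then have "real M < real A / real L" using Suc by simp
  then have "real (M * L) < real A" using assms by (simp add: field_simps)
  then have M: "M * L < N + W - 1" unfolding A_def by (simp only: of_nat_less_iff)
  have "(\<Sum>m < numM N W L. Qf L m + 1) = (Qf L 0 + 1) + (\<Sum>m<M. Qf L (Suc m) + 1)"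
    unfolding Suc by (rule sum.lessThan_Suc_shift)
  also have "\<dots> \<le> 2 + (\<Sum>m<M. 10 * L)"
    using assms by (intro add_mono sum_mono) (auto simp: Qf_def)
  also have "\<dots> = 2 + 10 * (M * L)" by simp
  also have "\<dots> < 10 * (N + W)"
  proof -
    have "M * L + 2 \<le> N + W" using M by arith
    then have "10 * (M * L + 2) \<le> 10 * (N + W)" by (rule mult_le_mono2)
    then show ?thesis by simp
  qed
  finally show ?thesis .
qed

lemma generic_mono: "generic N W P \<Longrightarrow> (\<And>x w. P x w \<Longrightarrow> P' x w) \<Longrightarrow> generic N W P'"
  unfolding generic_def by blast

theorem theorem2:
  fixes N W L :: nat
  assumes "L \<ge> 1" and "W > L" and "N \<ge> W"
    and "\<forall>m < numM N W L. Qf L m < N"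
  shows "(\<Sum>m < numM N W L. Qf L m + 1) < 10 * (N + W)
    \<and> generic N W (\<lambda>x w. \<forall>x' w'.
        (\<forall>m < numM N W L. \<forall>k \<le> Qf L m.
            cmod (stft N W L x' w' k m) = cmod (stft N W L x w k m))
        \<longrightarrow> (\<exists>\<eta>1 \<eta>2 lam. cmod \<eta>1 = 1 \<and> cmod \<eta>2 = 1 \<and> (\<forall>i < L. lam i \<noteq> 0) \<and>
              (((\<forall>n < N. x' n = amb_x L \<eta>1 \<eta>2 lam x n) \<and> (\<forall>n < W. w' n = amb_w L \<eta>2 lam w n))
               \<or> (N = W \<and> (\<forall>n < N. x' n = amb_x L \<eta>1 \<eta>2 lam (\<lambda>j. cnj (w j)) n)
                        \<and> (\<forall>n < W. w' n = amb_w L \<eta>2 lam (\<lambda>j. cnj (x j)) n)))))"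
proof
  interpret blind N W L for x w by standard (use assms in auto)
  show "(\<Sum>m < numM N W L. Qf L m + 1) < 10 * (N + W)"
    using assms by (intro measurement_count) auto
  have "generic N W (good N W L)"
    using generic_good assms N_large by simp
  moreover have "good_blind N W L x w" if "good N W L x w" for x w
    by standard (use assms that in auto)
  then have "good N W L x w \<Longrightarrow> \<forall>x' w'.
        (\<forall>m < numM N W L. \<forall>k \<le> Qf L m.
            cmod (stft N W L x' w' k m) = cmod (stft N W L x w k m))
        \<longrightarrow> (\<exists>\<eta>1 \<eta>2 lam. cmod \<eta>1 = 1 \<and> cmod \<eta>2 = 1 \<and> (\<forall>i < L. lam i \<noteq> 0) \<and>
              (((\<forall>n < N. x' n = amb_x L \<eta>1 \<eta>2 lam x n) \<and> (\<forall>n < W. w' n = amb_w L \<eta>2 lam w n))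
               \<or> (N = W \<and> (\<forall>n < N. x' n = amb_x L \<eta>1 \<eta>2 lam (\<lambda>j. cnj (w j)) n)
                        \<and> (\<forall>n < W. w' n = amb_w L \<eta>2 lam (\<lambda>j. cnj (x j)) n))))" for x w
    by (intro allI impI, rule good_blind.uniqueness) (blast | assumption)+
  ultimately show "generic N W (\<lambda>x w. \<forall>x' w'.
        (\<forall>m < numM N W L. \<forall>k \<le> Qf L m.
            cmod (stft N W L x' w' k m) = cmod (stft N W L x w k m))
        \<longrightarrow> (\<exists>\<eta>1 \<eta>2 lam. cmod \<eta>1 = 1 \<and> cmod \<eta>2 = 1 \<and> (\<forall>i < L. lam i \<noteq> 0) \<and>
              (((\<forall>n < N. x' n = amb_x L \<eta>1 \<eta>2 lam x n) \<and> (\<forall>n < W. w' n = amb_w L \<eta>2 lam w n))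
               \<or> (N = W \<and> (\<forall>n < N. x' n = amb_x L \<eta>1 \<eta>2 lam (\<lambda>j. cnj (w j)) n)
                        \<and> (\<forall>n < W. w' n = amb_w L \<eta>2 lam (\<lambda>j. cnj (x j)) n)))))"
    by (rule generic_mono)
qed

end
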